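(* There exists a finite positive value $\mathring\vartheta_e$ of $\vartheta$, which does not depend on $\ell$, such that for any cell size $\ell>0$ and any $\vartheta>\mathring\vartheta_e$ the following properties hold: (a) The quadratic form $(\varepsilon,\eta)\mapsto\mathring e_\vartheta(\varepsilon,\eta)$ defined by $$2\mathring e_\vartheta(\varepsilon,\eta):=\varepsilon_{ij}C^0_{ijk\ell'}\varepsilon_{k\ell'}+\ell\,\varepsilon_{ij}C^1_{ijk\ell' m}\eta_{k\ell' m}+\ell^2\,\eta_{ijn}\mathring A_{ijnk\ell' m}(\vartheta)\,\eta_{k\ell' m}$$ is positive definite on $S^2(\mathbb R^d)\times\big(S^2(\mathbb R^d)\otimes\mathbb R^d\big)$. (b) The bilinear form $\mathring{\mathcal Q}_\vartheta$ is positive and $H^2(\mathbb R^d)$-coercive, in that $$\mathring{\mathcal Q}_\vartheta(U,U)\ \ge\ C\Big(\|U\|^2_{H^2(\mathbb R^d)}-\|U\|^2_{L^2(\mathbb R^d)}\Big)\ \ge 0\qquad\text{for all }U\in H^2(\mathbb R^d;\mathbb R^d)$$ for some constant $C=C(\vartheta)>0$ (the cell, the material and $\ell$ being fixed). Here $C^0,C^1$ are the leading- and first-order elastostatic effective tensors, and $\mathring A(\vartheta)$, $\mathring{\mathcal Q}_\vartheta$ are defined in the context.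
   Context: Let $d\in\{2,3\}$; repeated indices are summed; $\ell>0$ denotes the cell size while $\ell'$ (and $i,j,k,m,n,\dots$) denotes tensor indices. $S^2(\mathbb R^d)$ is the space of symmetric $d\times d$ tensors; $\eta\in S^2(\mathbb R^d)\otimes\mathbb R^d$ means $\eta_{ijn}=\eta_{jin}$. Cell and material. $v_1,\dots,v_d$ is a basis of $\mathbb R^d$ and $\mathcal Z=\{\sum_i n_iv_i:\ n_i\in\mathbb Z\}$. The (reference, nondimensional) periodicity cell $\mathcal Y\subset\mathbb R^d$ is a bounded open set (with Lebesgue-null boundary) whose translates $\mathcal Y+V$, $V\in\mathcal Z$, are pairwise disjoint and have closures covering $\mathbb R^d$. The elasticity tensor $C=(C_{ijkl})\in L^\infty(\mathcal Y)$ is real, has the symmetries $C_{ijkl}=C_{jikl}=C_{ijlk}=C_{klij}$ and satisfies $\varepsilon_{ij}C_{ijkl}(y)\varepsilon_{kl}\ge\kappa_m|\varepsilon|^2$ for all symmetric $\varepsilon$ and some $\kappa_m>0$. Function spaces. $H^1_{per}(\mathcal Y;\mathbb R^d)$ is the closure in $H^1(\mathcal Y)$ of smooth $\mathcal Z$-periodic vector functions on $\mathbb R^d$; $H^1_\#(\mathcal Y)$ is its subspace of zero-mean functions. $\langle f\rangle:=|\mathcal Y|^{-1}\int_{\mathcal Y}f\,dy$, $f_{,s}=\partial f/\partial y_s$, and $A(w,v):=\int_{\mathcal Y}w_{i,j}C_{ijkl}v_{k,l}\,dy$. Effective tensors (each cell function is the unique element of $H^1_\#(\mathcal Y)$ satisfying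 the identity for all $v\in H^1_\#(\mathcal Y)$): - $A(\chi^{1kl},v)=-\int_{\mathcal Y}C_{klrs}v_{r,s}\,dy$; $\ S^{0,kl}_{ij}:=C_{ijpq}\chi^{1kl}_{p,q}+C_{ijkl}$; $\ C^0_{ijkl}:=\langle S^{0,kl}_{ij}\rangle$. - $A(\chi^{2klm},v)=\int_{\mathcal Y}\{(S^{0,kl}_{mr}-C^0_{klmr})v_r-\chi^{1kl}_pC_{pmrs}v_{r,s}\}\,dy$; $\ S^{1,klm}_{ij}:=C_{ijpq}\chi^{2klm}_{p,q}+C_{ijpm}\chi^{1kl}_p$; $\ C^1_{ijklm}:=\langle S^{1,klm}_{ij}\rangle$. - $A(\chi^{3klmn},v)=\int_{\mathcal Y}\{(S^{1,klm}_{rn}-C^1_{rnklm})v_r-\chi^{2klm}_pC_{pnrs}v_{r,s}\}\,dy$; $\ C^2_{ijnklm}:=\langle C_{ijpq}(\chi^{3klmn}_{p,q}+\chi^{2klm}_p\delta_{qn})\rangle$. Known properties: $C^0$ has the minor and major symmetries and is elliptic on $S^2(\mathbb R^d)$; $C^1_{ijklm}=C^1_{jiklm}=C^1_{ijlkm}=-C^1_{klijm}$; $C^2_{ijnklm}=C^2_{jinklm}=C^2_{ijnlkm}=C^2_{klmijn}$. Corrected second-order tensor, for a real weight $\vartheta$: $\mathring A_{ijnklm}(\vartheta):=\vartheta\,C^0_{ijkl}\delta_{nm}-C^2_{ijnklm}$. Bilinear form: for $U,W\in H^2(\mathbb R^d;\mathbb R^d)$, with $\varepsilon_{ij}(U)=\frac12(\partial_jU_i+\partial_iU_j)$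 and $\eta_{ijn}(U)=\partial_n\varepsilon_{ij}(U)$, $$\mathring{\mathcal Q}_\vartheta(U,W):=\int_{\mathbb R^d}\Big(\varepsilon_{ij}(W)C^0_{ijkl}\varepsilon_{kl}(U)+\ell\,\varepsilon_{ij}(W)C^1_{ijklm}\eta_{klm}(U)+\ell^2\eta_{ijn}(W)\mathring A_{ijnklm}(\vartheta)\eta_{klm}(U)\Big)dx.$$ Norm: $\|U\|_{H^2}^2=\|U\|_{L^2}^2+\|\nabla U\|_{L^2}^2+\|\nabla^2U\|_{L^2}^2$. *)

theory Defs
  imports "HOL-Analysis.Analysis"
begin

section \<open>Sobolev spaces\<close>

definition pd :: "'d::finite \<Rightarrow> (real ^ 'd \<Rightarrow> real) \<Rightarrow> real ^ 'd \<Rightarrow> real" where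
  "pd s f x = frechet_derivative f (at x) (axis s 1)"

text \<open>Differentiability of every iterated partial derivative also makes them all continuous, so
  this is \<open>C\<^sup>\<infinity>\<close> on the whole space.\<close>

definition smooth :: "(real ^ 'd::finite \<Rightarrow> real) \<Rightarrow> bool" where
  "smooth f \<longleftrightarrow> (\<forall>ss x. foldr pd ss f differentiable (at x))"

definition test_functions :: "(real ^ 'd::finite) set \<Rightarrow> (real ^ 'd \<Rightarrow> real) set" where
  "test_functions \<Omega> = {\<phi>. smooth \<phi> \<and> compact (closure {x. \<phi> x \<noteq> 0}) \<and> closure {x. \<phi> x \<noteq> 0} \<subseteq> \<Omega>}"

definition L2_space :: "(real ^ 'd::finite) set \<Rightarrow> (real ^ 'd \<Rightarrow> real) set" where
  "L2_space \<Omega> = {f \<in> borel_measurable (lebesgue_on \<Omega>). integrable (lebesgue_on \<Omega>) (\<lambda>x. (f x)\<^sup>2)}"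

definition has_weak_pd ::
  "(real ^ 'd::finite) set \<Rightarrow> 'd \<Rightarrow> (real ^ 'd \<Rightarrow> real) \<Rightarrow> (real ^ 'd \<Rightarrow> real) \<Rightarrow> bool" where
  "has_weak_pd \<Omega> s f g \<longleftrightarrow> f \<in> L2_space \<Omega> \<and> g \<in> L2_space \<Omega> \<and>
     (\<forall>\<phi>\<in>test_functions \<Omega>.
        (LINT x|lebesgue_on \<Omega>. f x * pd s \<phi> x) = - (LINT x|lebesgue_on \<Omega>. g x * \<phi> x))"

text \<open>A representative of the weak derivative; on open sets it is unique up to null sets, and it
  is only used on functions possessing a square-integrable weak derivative.\<close>

definition wpd :: "(real ^ 'd::finite) set \<Rightarrow> 'd \<Rightarrow> (real ^ 'd \<Rightarrow> real) \<Rightarrow> real ^ 'd \<Rightarrow> real" where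
  "wpd \<Omega> s f = (SOME g. has_weak_pd \<Omega> s f g)"

definition H1_space :: "(real ^ 'd::finite) set \<Rightarrow> (real ^ 'd \<Rightarrow> real) set" where
  "H1_space \<Omega> = {f \<in> L2_space \<Omega>. \<forall>s. \<exists>g. has_weak_pd \<Omega> s f g}"

definition H2_space :: "(real ^ 'd::finite) set \<Rightarrow> (real ^ 'd \<Rightarrow> real) set" where
  "H2_space \<Omega> = {f \<in> H1_space \<Omega>. \<forall>s. wpd \<Omega> s f \<in> H1_space \<Omega>}"

definition H2_vec :: "(real ^ 'd::finite \<Rightarrow> real ^ 'd) set" where
  "H2_vec = {U. \<forall>i. (\<lambda>x. U x $ i) \<in> H2_space UNIV}"

definition L2_norm_sq :: "(real ^ 'd::finite \<Rightarrow> real ^ 'd) \<Rightarrow> real" where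
  "L2_norm_sq U = (\<Sum>i\<in>UNIV. LINT x|lebesgue_on UNIV. (U x $ i)\<^sup>2)"

definition H2_norm_sq :: "(real ^ 'd::finite \<Rightarrow> real ^ 'd) \<Rightarrow> real" where
  "H2_norm_sq U = L2_norm_sq U
     + (\<Sum>i\<in>UNIV. \<Sum>j\<in>UNIV. LINT x|lebesgue_on UNIV. (wpd UNIV j (\<lambda>x. U x $ i) x)\<^sup>2)
     + (\<Sum>i\<in>UNIV. \<Sum>j\<in>UNIV. \<Sum>n\<in>UNIV.
          LINT x|lebesgue_on UNIV. (wpd UNIV n (wpd UNIV j (\<lambda>x. U x $ i)) x)\<^sup>2)"

section \<open>Periodicity cell and elasticity tensor\<close>

type_synonym 'd tensor4 = "'d \<Rightarrow> 'd \<Rightarrow> 'd \<Rightarrow> 'd \<Rightarrow> real"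
type_synonym 'd tensor5 = "'d \<Rightarrow> 'd \<Rightarrow> 'd \<Rightarrow> 'd \<Rightarrow> 'd \<Rightarrow> real"
type_synonym 'd tensor6 = "'d \<Rightarrow> 'd \<Rightarrow> 'd \<Rightarrow> 'd \<Rightarrow> 'd \<Rightarrow> 'd \<Rightarrow> real"

definition kdelta :: "'d \<Rightarrow> 'd \<Rightarrow> real" where
  "kdelta i j = (if i = j then 1 else 0)"

definition sym2 :: "(real ^ 'd::finite ^ 'd) set" where
  "sym2 = {\<epsilon>. \<forall>i j. \<epsilon> $ i $ j = \<epsilon> $ j $ i}"

text \<open>The tensor component \<open>\<eta>\<^sub>i\<^sub>j\<^sub>n\<close> is \<open>\<eta> $ i $ j $ n\<close>.\<close>

definition sym2_vec :: "(real ^ 'd::finite ^ 'd ^ 'd) set" where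
  "sym2_vec = {\<eta>. \<forall>i j n. \<eta> $ i $ j $ n = \<eta> $ j $ i $ n}"

definition is_basis :: "('d::finite \<Rightarrow> real ^ 'd) \<Rightarrow> bool" where
  "is_basis v \<longleftrightarrow> inj v \<and> independent (range v) \<and> span (range v) = UNIV"

definition lattice :: "('d::finite \<Rightarrow> real ^ 'd) \<Rightarrow> (real ^ 'd) set" where
  "lattice v = range (\<lambda>n :: 'd \<Rightarrow> int. \<Sum>i\<in>UNIV. real_of_int (n i) *\<^sub>R v i)"

definition periodicity_cell :: "('d::finite \<Rightarrow> real ^ 'd) \<Rightarrow> (real ^ 'd) set \<Rightarrow> bool" where
  "periodicity_cell v Y \<longleftrightarrow> bounded Y \<and> open Y \<and> negligible (frontier Y) \<and>
     disjoint_family_on (\<lambda>V. (+) V ` Y) (lattice v) \<and>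
     (\<Union>V\<in>lattice v. closure ((+) V ` Y)) = UNIV"

definition elasticity_tensor :: "(real ^ 'd::finite) set \<Rightarrow> (real ^ 'd \<Rightarrow> 'd tensor4) \<Rightarrow> bool" where
  "elasticity_tensor Y C \<longleftrightarrow>
     (\<forall>i j k l. (\<lambda>y. C y i j k l) \<in> borel_measurable (lebesgue_on Y)) \<and>
     (\<exists>M. AE y in lebesgue_on Y. \<forall>i j k l. \<bar>C y i j k l\<bar> \<le> M) \<and>
     (AE y in lebesgue_on Y. \<forall>i j k l.
        C y i j k l = C y j i k l \<and> C y i j k l = C y i j l k \<and> C y i j k l = C y k l i j) \<and>
     (\<exists>\<kappa>>0. AE y in lebesgue_on Y. \<forall>\<epsilon>\<in>sym2.
        (\<Sum>i\<in>UNIV. \<Sum>j\<in>UNIV. \<Sum>k\<in>UNIV. \<Sum>l\<in>UNIV. \<epsilon> $ i $ j * C y i j k l * \<epsilon> $ k $ l)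
          \<ge> \<kappa> * (norm \<epsilon>)\<^sup>2)"

definition smooth_periodic :: "('d::finite \<Rightarrow> real ^ 'd) \<Rightarrow> (real ^ 'd \<Rightarrow> real ^ 'd) \<Rightarrow> bool" where
  "smooth_periodic v \<phi> \<longleftrightarrow>
     (\<forall>i. smooth (\<lambda>y. \<phi> y $ i)) \<and> (\<forall>V\<in>lattice v. \<forall>y. \<phi> (y + V) = \<phi> y)"

text \<open>The sequence below is the squared \<open>H\<^sup>1(Y)\<close> distance from \<open>w\<close> to the smooth functions
  \<open>\<phi> n\<close>, whose weak derivatives are the classical ones.\<close>

definition H1_per ::
  "('d::finite \<Rightarrow> real ^ 'd) \<Rightarrow> (real ^ 'd) set \<Rightarrow> (real ^ 'd \<Rightarrow> real ^ 'd) set" where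
  "H1_per v Y = {w. (\<forall>i. (\<lambda>y. w y $ i) \<in> H1_space Y) \<and>
     (\<exists>\<phi> :: nat \<Rightarrow> real ^ 'd \<Rightarrow> real ^ 'd. (\<forall>n. smooth_periodic v (\<phi> n)) \<and>
        (\<lambda>n. \<Sum>i\<in>UNIV. (LINT y|lebesgue_on Y. (\<phi> n y $ i - w y $ i)\<^sup>2)
           + (\<Sum>s\<in>UNIV. LINT y|lebesgue_on Y.
                (pd s (\<lambda>y. \<phi> n y $ i) y - wpd Y s (\<lambda>y. w y $ i) y)\<^sup>2)) \<longlonglongrightarrow> 0)}"

definition H1_mean_zero ::
  "('d::finite \<Rightarrow> real ^ 'd) \<Rightarrow> (real ^ 'd) set \<Rightarrow> (real ^ 'd \<Rightarrow> real ^ 'd) set" where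
  "H1_mean_zero v Y = {w \<in> H1_per v Y. \<forall>i. (LINT y|lebesgue_on Y. w y $ i) = 0}"

definition cell_mean :: "(real ^ 'd::finite) set \<Rightarrow> (real ^ 'd \<Rightarrow> real) \<Rightarrow> real" where
  "cell_mean Y f = (LINT y|lebesgue_on Y. f y) / measure lebesgue Y"

text \<open>The derivative \<open>w\<^sub>i\<^sub>,\<^sub>s\<close> on the cell.\<close>

definition cell_pd ::
  "(real ^ 'd::finite) set \<Rightarrow> (real ^ 'd \<Rightarrow> real ^ 'd) \<Rightarrow> 'd \<Rightarrow> 'd \<Rightarrow> real ^ 'd \<Rightarrow> real" where
  "cell_pd Y w i s = wpd Y s (\<lambda>y. w y $ i)"

definition cell_form :: "(real ^ 'd::finite) set \<Rightarrow> (real ^ 'd \<Rightarrow> 'd tensor4) \<Rightarrow>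
    (real ^ 'd \<Rightarrow> real ^ 'd) \<Rightarrow> (real ^ 'd \<Rightarrow> real ^ 'd) \<Rightarrow> real" where
  "cell_form Y C w v = (LINT y|lebesgue_on Y.
     (\<Sum>i\<in>UNIV. \<Sum>j\<in>UNIV. \<Sum>k\<in>UNIV. \<Sum>l\<in>UNIV.
       cell_pd Y w i j y * C y i j k l * cell_pd Y v k l y))"

section \<open>Cell functions and effective tensors\<close>

type_synonym 'd field = "real ^ 'd \<Rightarrow> real ^ 'd"

text \<open>The upper indices of the cell functions and stresses come first, in the written order.\<close>

definition stress0 :: "(real ^ 'd::finite) set \<Rightarrow> (real ^ 'd \<Rightarrow> 'd tensor4) \<Rightarrow>
    ('d \<Rightarrow> 'd \<Rightarrow> 'd field) \<Rightarrow> 'd \<Rightarrow> 'd \<Rightarrow> 'd \<Rightarrow> 'd \<Rightarrow> real ^ 'd \<Rightarrow> real" where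
  "stress0 Y C chi1 k l i j y =
     (\<Sum>p\<in>UNIV. \<Sum>q\<in>UNIV. C y i j p q * cell_pd Y (chi1 k l) p q y) + C y i j k l"

definition eff0 :: "(real ^ 'd::finite) set \<Rightarrow> (real ^ 'd \<Rightarrow> 'd tensor4) \<Rightarrow>
    ('d \<Rightarrow> 'd \<Rightarrow> 'd field) \<Rightarrow> 'd tensor4" where
  "eff0 Y C chi1 i j k l = cell_mean Y (stress0 Y C chi1 k l i j)"

definition stress1 :: "(real ^ 'd::finite) set \<Rightarrow> (real ^ 'd \<Rightarrow> 'd tensor4) \<Rightarrow>
    ('d \<Rightarrow> 'd \<Rightarrow> 'd field) \<Rightarrow> ('d \<Rightarrow> 'd \<Rightarrow> 'd \<Rightarrow> 'd field) \<Rightarrow>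
    'd \<Rightarrow> 'd \<Rightarrow> 'd \<Rightarrow> 'd \<Rightarrow> 'd \<Rightarrow> real ^ 'd \<Rightarrow> real" where
  "stress1 Y C chi1 chi2 k l m i j y =
     (\<Sum>p\<in>UNIV. \<Sum>q\<in>UNIV. C y i j p q * cell_pd Y (chi2 k l m) p q y)
     + (\<Sum>p\<in>UNIV. C y i j p m * chi1 k l y $ p)"

definition eff1 :: "(real ^ 'd::finite) set \<Rightarrow> (real ^ 'd \<Rightarrow> 'd tensor4) \<Rightarrow>
    ('d \<Rightarrow> 'd \<Rightarrow> 'd field) \<Rightarrow> ('d \<Rightarrow> 'd \<Rightarrow> 'd \<Rightarrow> 'd field) \<Rightarrow> 'd tensor5" where
  "eff1 Y C chi1 chi2 i j k l m = cell_mean Y (stress1 Y C chi1 chi2 k l m i j)"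

definition eff2 :: "(real ^ 'd::finite) set \<Rightarrow> (real ^ 'd \<Rightarrow> 'd tensor4) \<Rightarrow>
    ('d \<Rightarrow> 'd \<Rightarrow> 'd \<Rightarrow> 'd field) \<Rightarrow> ('d \<Rightarrow> 'd \<Rightarrow> 'd \<Rightarrow> 'd \<Rightarrow> 'd field) \<Rightarrow> 'd tensor6" where
  "eff2 Y C chi2 chi3 i j n k l m = cell_mean Y (\<lambda>y. \<Sum>p\<in>UNIV. \<Sum>q\<in>UNIV.
     C y i j p q * (cell_pd Y (chi3 k l m n) p q y + chi2 k l m y $ p * kdelta q n))"

text \<open>Elements of \<open>H\<^sup>1\<close> are functions rather than equivalence classes, so the unique solution of
  each cell problem is described by a predicate that determines it up to null sets; the effective
  tensors do not depend on the representative.\<close>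

definition cell_functions1 :: "('d::finite \<Rightarrow> real ^ 'd) \<Rightarrow> (real ^ 'd) set \<Rightarrow>
    (real ^ 'd \<Rightarrow> 'd tensor4) \<Rightarrow> ('d \<Rightarrow> 'd \<Rightarrow> 'd field) \<Rightarrow> bool" where
  "cell_functions1 v Y C chi1 \<longleftrightarrow> (\<forall>k l. chi1 k l \<in> H1_mean_zero v Y \<and>
     (\<forall>w\<in>H1_mean_zero v Y. cell_form Y C (chi1 k l) w =
        - (LINT y|lebesgue_on Y. (\<Sum>r\<in>UNIV. \<Sum>s\<in>UNIV. C y k l r s * cell_pd Y w r s y))))"

definition cell_functions2 :: "('d::finite \<Rightarrow> real ^ 'd) \<Rightarrow> (real ^ 'd) set \<Rightarrow>
    (real ^ 'd \<Rightarrow> 'd tensor4) \<Rightarrow> ('d \<Rightarrow> 'd \<Rightarrow> 'd field) \<Rightarrow>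
    ('d \<Rightarrow> 'd \<Rightarrow> 'd \<Rightarrow> 'd field) \<Rightarrow> bool" where
  "cell_functions2 v Y C chi1 chi2 \<longleftrightarrow> (\<forall>k l m. chi2 k l m \<in> H1_mean_zero v Y \<and>
     (\<forall>w\<in>H1_mean_zero v Y. cell_form Y C (chi2 k l m) w =
        (LINT y|lebesgue_on Y.
           ((\<Sum>r\<in>UNIV. (stress0 Y C chi1 k l m r y - eff0 Y C chi1 k l m r) * w y $ r)
           - (\<Sum>p\<in>UNIV. \<Sum>r\<in>UNIV. \<Sum>s\<in>UNIV.
                chi1 k l y $ p * C y p m r s * cell_pd Y w r s y)))))"

definition cell_functions3 :: "('d::finite \<Rightarrow> real ^ 'd) \<Rightarrow> (real ^ 'd) set \<Rightarrow>
    (real ^ 'd \<Rightarrow> 'd tensor4) \<Rightarrow> ('d \<Rightarrow> 'd \<Rightarrow> 'd field) \<Rightarrow>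
    ('d \<Rightarrow> 'd \<Rightarrow> 'd \<Rightarrow> 'd field) \<Rightarrow> ('d \<Rightarrow> 'd \<Rightarrow> 'd \<Rightarrow> 'd \<Rightarrow> 'd field) \<Rightarrow> bool" where
  "cell_functions3 v Y C chi1 chi2 chi3 \<longleftrightarrow> (\<forall>k l m n. chi3 k l m n \<in> H1_mean_zero v Y \<and>
     (\<forall>w\<in>H1_mean_zero v Y. cell_form Y C (chi3 k l m n) w =
        (LINT y|lebesgue_on Y.
           ((\<Sum>r\<in>UNIV. (stress1 Y C chi1 chi2 k l m r n y - eff1 Y C chi1 chi2 r n k l m) * w y $ r)
           - (\<Sum>p\<in>UNIV. \<Sum>r\<in>UNIV. \<Sum>s\<in>UNIV.
                chi2 k l m y $ p * C y p n r s * cell_pd Y w r s y)))))"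

section \<open>Second-order energy and bilinear form\<close>

definition corrected_tensor :: "'d tensor4 \<Rightarrow> 'd tensor6 \<Rightarrow> real \<Rightarrow> 'd tensor6" where
  "corrected_tensor C0 C2 \<theta> i j n k l m = \<theta> * C0 i j k l * kdelta n m - C2 i j n k l m"

definition energy :: "real \<Rightarrow> 'd::finite tensor4 \<Rightarrow> 'd tensor5 \<Rightarrow> 'd tensor6 \<Rightarrow>
    real ^ 'd ^ 'd \<Rightarrow> real ^ 'd ^ 'd ^ 'd \<Rightarrow> real" where
  "energy L C0 C1 A \<epsilon> \<eta> = 1 / 2 * (
     (\<Sum>i\<in>UNIV. \<Sum>j\<in>UNIV. \<Sum>k\<in>UNIV. \<Sum>l\<in>UNIV. \<epsilon> $ i $ j * C0 i j k l * \<epsilon> $ k $ l)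
     + L * (\<Sum>i\<in>UNIV. \<Sum>j\<in>UNIV. \<Sum>k\<in>UNIV. \<Sum>l\<in>UNIV. \<Sum>m\<in>UNIV.
              \<epsilon> $ i $ j * C1 i j k l m * \<eta> $ k $ l $ m)
     + L\<^sup>2 * (\<Sum>i\<in>UNIV. \<Sum>j\<in>UNIV. \<Sum>n\<in>UNIV. \<Sum>k\<in>UNIV. \<Sum>l\<in>UNIV. \<Sum>m\<in>UNIV.
               \<eta> $ i $ j $ n * A i j n k l m * \<eta> $ k $ l $ m))"

definition strain :: "'d::finite field \<Rightarrow> 'd \<Rightarrow> 'd \<Rightarrow> real ^ 'd \<Rightarrow> real" where
  "strain U i j x = 1 / 2 * (wpd UNIV j (\<lambda>x. U x $ i) x + wpd UNIV i (\<lambda>x. U x $ j) x)"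

definition strain_gradient :: "'d::finite field \<Rightarrow> 'd \<Rightarrow> 'd \<Rightarrow> 'd \<Rightarrow> real ^ 'd \<Rightarrow> real" where
  "strain_gradient U i j n = wpd UNIV n (strain U i j)"

definition bilinear_Q :: "real \<Rightarrow> 'd::finite tensor4 \<Rightarrow> 'd tensor5 \<Rightarrow> 'd tensor6 \<Rightarrow>
    'd field \<Rightarrow> 'd field \<Rightarrow> real" where
  "bilinear_Q L C0 C1 A U W = (LINT x|lebesgue_on UNIV.
     ((\<Sum>i\<in>UNIV. \<Sum>j\<in>UNIV. \<Sum>k\<in>UNIV. \<Sum>l\<in>UNIV. strain W i j x * C0 i j k l * strain U k l x)
     + L * (\<Sum>i\<in>UNIV. \<Sum>j\<in>UNIV. \<Sum>k\<in>UNIV. \<Sum>l\<in>UNIV. \<Sum>m\<in>UNIV.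
              strain W i j x * C1 i j k l m * strain_gradient U k l m x)
     + L\<^sup>2 * (\<Sum>i\<in>UNIV. \<Sum>j\<in>UNIV. \<Sum>n\<in>UNIV. \<Sum>k\<in>UNIV. \<Sum>l\<in>UNIV. \<Sum>m\<in>UNIV.
               strain_gradient W i j n x * A i j n k l m * strain_gradient U k l m x)))"

end

theory Submission
  imports Defs
begin

text \<open>
  The form \<open>2 e(\<epsilon>, \<eta>)\<close> is a quadratic form in the pair \<open>(\<epsilon>, L \<eta>)\<close>, so \<open>L\<close> disappears by scaling
  and what remains is a \<open>2 \<times> 2\<close> block form with diagonal blocks \<open>C0\<close> and \<open>\<theta> C0 \<delta> - C2\<close> and
  off-diagonal part \<open>C1\<close>. If \<open>C0\<close> is elliptic with constant \<open>\<kappa>\<close>, then \<open>\<theta> C0 \<delta>\<close> contributes at least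
  \<open>\<theta> \<kappa> |L \<eta>|\<^sup>2\<close>, and a large \<open>\<theta>\<close> absorbs both \<open>C2\<close> and, by Young's inequality, the cross term with
  \<open>C1\<close>. This gives a lower bound \<open>c (|\<epsilon>|\<^sup>2 + L\<^sup>2 |\<eta>|\<^sup>2)\<close> with \<open>c\<close> independent of \<open>L\<close>
  (\<open>energy_form_coercive\<close>), hence the positive definiteness of the energy density.

  Ellipticity of \<open>C0\<close> (\<open>eff0_elliptic\<close>) is the classical energy argument. For symmetric \<open>e\<close> the field
  \<open>T = e + \<Sum> e\<^sub>k\<^sub>l \<nabla>\<chi>\<^sup>k\<^sup>l\<close> satisfies \<open>e : C0 : e = \<langle>T : C : T\<rangle>\<close>, because the cell problem tested with the cell
  functions says that \<open>C : T\<close> is orthogonal to their gradients. Pointwise ellipticity of \<open>C\<close> and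
  Jensen's inequality bound this below by \<open>\<kappa> |\<langle>sym T\<rangle>|\<^sup>2\<close>, and \<open>\<langle>T\<rangle> = e\<close> since gradients of periodic
  functions have mean zero. The last fact (\<open>integral_cell_pd_eq_0\<close>) holds because the integral of a
  periodic function over the cell does not change when the function is translated.

  For the bilinear form, integrating the pointwise lower bound at \<open>\<epsilon>(U)\<close>, \<open>\<eta>(U)\<close> leaves two estimates: Korn's
  inequality \<open>\<integral> |\<epsilon>(U)|\<^sup>2 \<ge> 1/2 \<integral> |\<nabla>U|\<^sup>2\<close> on the whole space, and the control of \<open>\<nabla>\<nabla>U\<close> by the strain
  gradient, which is pointwise because
  \<open>\<partial>\<^sub>n\<partial>\<^sub>jU\<^sub>i = \<eta>\<^sub>i\<^sub>j\<^sub>n + \<eta>\<^sub>i\<^sub>n\<^sub>j - \<eta>\<^sub>j\<^sub>n\<^sub>i\<close>. Both rest on three facts about weak derivatives in \<open>L\<^sup>2(\<real>\<^sup>d)\<close>: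
  uniqueness, symmetry of second derivatives, and integration by parts for two \<open>H\<^sup>1\<close> functions.
  All three are derived from a single family of test functions, the translates of a radial bump
  \<open>\<rho>\<^sub>\<delta>\<close>. The tool is the correlation \<open>z \<mapsto> \<integral> g(x) f(z + x) dx\<close> of two square integrable functions. It
  is continuous, and its integral against \<open>\<rho>\<^sub>\<delta>\<close> is, by Fubini, a superposition of integrals of \<open>f\<close>
  against translated bumps. An identity that holds against all bumps can therefore be moved to the
  correlation and evaluated at \<open>z = 0\<close> by letting \<open>\<delta> \<rightarrow> 0\<close>.
\<close>

section \<open>Square integrable functions\<close>

text \<open>Square integrability over an arbitrary measure, so that the same lemmas serve \<open>L\<^sup>2(Y)\<close>,
  \<open>L\<^sup>2(\<real>\<^sup>d)\<close> and Borel representatives of elements of the latter.\<close>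

definition sqint :: "'a measure \<Rightarrow> ('a \<Rightarrow> real) \<Rightarrow> bool" where
  "sqint M f \<longleftrightarrow> f \<in> borel_measurable M \<and> integrable M (\<lambda>x. (f x)\<^sup>2)"

lemma L2_space_iff_sqint: "f \<in> L2_space \<Omega> \<longleftrightarrow> sqint (lebesgue_on \<Omega>) f"
  by (simp add: L2_space_def sqint_def)

lemma sqint_integrable_mult:
  assumes "sqint M f" "sqint M g"
  shows "integrable M (\<lambda>x. f x * g x)"
proof (rule Bochner_Integration.integrable_bound)
  show "integrable M (\<lambda>x. (f x)\<^sup>2 + (g x)\<^sup>2)"
    using assms by (simp add: sqint_def)
  show "(\<lambda>x. f x * g x) \<in> borel_measurable M"
    using assms by (intro borel_measurable_times) (simp_all add: sqint_def)
  show "AE x in M. norm (f x * g x) \<le> norm ((f x)\<^sup>2 + (g x)\<^sup>2)"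
  proof (rule AE_I2)
    fix x
    have "2 * (\<bar>f x\<bar> * \<bar>g x\<bar>) \<le> (f x)\<^sup>2 + (g x)\<^sup>2"
      using sum_squares_bound[of "\<bar>f x\<bar>" "\<bar>g x\<bar>"] by simp
    moreover have "0 \<le> \<bar>f x\<bar> * \<bar>g x\<bar>" by simp
    ultimately show "norm (f x * g x) \<le> norm ((f x)\<^sup>2 + (g x)\<^sup>2)"
      unfolding real_norm_def abs_mult by linarith
  qed
qed

lemma sqint_cmult: "sqint M f \<Longrightarrow> sqint M (\<lambda>x. c * f x)"
  by (auto simp: sqint_def power_mult_distrib intro: borel_measurable_times)

lemma sqint_uminus: "sqint M f \<Longrightarrow> sqint M (\<lambda>x. - f x)"
  by (simp add: sqint_def)

lemma sqint_add:
  assumes "sqint M f" "sqint M g"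
  shows "sqint M (\<lambda>x. f x + g x)"
proof -
  have "integrable M (\<lambda>x. (f x)\<^sup>2 + (g x)\<^sup>2 + 2 * (f x * g x))"
    using assms sqint_integrable_mult[OF assms] by (auto simp: sqint_def)
  then show ?thesis
    using assms by (auto simp: sqint_def power2_sum mult.assoc intro: borel_measurable_add)
qed

lemma sqint_diff: "sqint M f \<Longrightarrow> sqint M g \<Longrightarrow> sqint M (\<lambda>x. f x - g x)"
  using sqint_add[of M f "\<lambda>x. - g x"] sqint_uminus[of M g] by simp

lemma sqint_sum: "(\<And>i. i \<in> I \<Longrightarrow> sqint M (f i)) \<Longrightarrow> sqint M (\<lambda>x. \<Sum>i\<in>I. f i x)"
proof (induction I rule: infinite_finite_induct)
  case (insert i I)
  then show ?case by (simp add: sqint_add)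
qed (auto simp: sqint_def)

lemma sqint_bounded:
  assumes "finite_measure M" "f \<in> borel_measurable M" "AE x in M. \<bar>f x\<bar> \<le> B"
  shows "sqint M f"
  unfolding sqint_def
proof (intro conjI assms(2))
  interpret finite_measure M by fact
  show "integrable M (\<lambda>x. (f x)\<^sup>2)"
  proof (rule integrable_const_bound[where B="B\<^sup>2"])
    show "AE x in M. norm ((f x)\<^sup>2) \<le> B\<^sup>2"
      using assms(3)
    proof eventually_elim
      case (elim x)
      then have "\<bar>f x\<bar>\<^sup>2 \<le> B\<^sup>2" by (intro power_mono) auto
      then show ?case by simp
    qed
  qed (use assms(2) in measurable)
qed

lemma sqint_bounded_mult:
  assumes "sqint M f" "c \<in> borel_measurable M" "AE x in M. \<bar>c x\<bar> \<le> B"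
  shows "sqint M (\<lambda>x. c x * f x)"
  unfolding sqint_def
proof (intro conjI)
  have [measurable]: "f \<in> borel_measurable M" using assms(1) by (simp add: sqint_def)
  note [measurable] = assms(2)
  show "(\<lambda>x. c x * f x) \<in> borel_measurable M" by measurable
  show "integrable M (\<lambda>x. (c x * f x)\<^sup>2)"
  proof (rule Bochner_Integration.integrable_bound)
    show "integrable M (\<lambda>x. B\<^sup>2 * (f x)\<^sup>2)" using assms(1) by (simp add: sqint_def)
    show "AE x in M. norm ((c x * f x)\<^sup>2) \<le> norm (B\<^sup>2 * (f x)\<^sup>2)"
      using assms(3)
    proof eventually_elim
      case (elim x)
      then have "\<bar>c x\<bar>\<^sup>2 \<le> B\<^sup>2" by (intro power_mono) auto
      then show ?case by (simp add: power_mult_distrib mult_right_mono)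
    qed
  qed measurable
qed

text \<open>The quadratic \<open>t \<mapsto> \<integral> (t f + g)\<^sup>2\<close> is nonnegative, which bounds its discriminant.\<close>

lemma sqint_Cauchy_Schwarz:
  assumes "sqint M f" "sqint M g"
  shows "(LINT x|M. f x * g x)\<^sup>2 \<le> (LINT x|M. (f x)\<^sup>2) * (LINT x|M. (g x)\<^sup>2)"
proof -
  define a b c where "a = (LINT x|M. (f x)\<^sup>2)" and "b = (LINT x|M. f x * g x)"
    and "c = (LINT x|M. (g x)\<^sup>2)"
  have int: "integrable M (\<lambda>x. (f x)\<^sup>2)" "integrable M (\<lambda>x. (g x)\<^sup>2)" "integrable M (\<lambda>x. f x * g x)"
    using assms sqint_integrable_mult[OF assms] by (auto simp: sqint_def)
  have quad: "0 \<le> t\<^sup>2 * a + 2 * t * b + c" for t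
  proof -
    have "0 \<le> (LINT x|M. (t * f x + g x)\<^sup>2)" by (simp add: integral_nonneg_AE)
    also have "\<dots> = (LINT x|M. t\<^sup>2 * (f x)\<^sup>2 + (2 * t) * (f x * g x) + (g x)\<^sup>2)"
      by (intro Bochner_Integration.integral_cong) (auto simp: power2_sum power_mult_distrib algebra_simps)
    also have "\<dots> = t\<^sup>2 * a + 2 * t * b + c"
      using int by (simp add: a_def b_def c_def)
    finally show ?thesis .
  qed
  have "a \<ge> 0" by (simp add: a_def integral_nonneg_AE)
  have "b\<^sup>2 \<le> a * c"
  proof (cases "a = 0")
    case True
    have "b = 0"
    proof (rule ccontr)
      assume "b \<noteq> 0"
      with quad[of "- (c + 1) / (2 * b)"] True show False by (simp add: field_simps)
    qed
    with True show ?thesis by simp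
  next
    case False
    with \<open>a \<ge> 0\<close> have "a > 0" by simp
    have "0 \<le> a * ((- b / a)\<^sup>2 * a + 2 * (- b / a) * b + c)"
      using quad[of "- b / a"] \<open>a > 0\<close> by (intro mult_nonneg_nonneg) auto
    also have "\<dots> = a * c - b\<^sup>2"
      using \<open>a > 0\<close> by (simp add: field_simps power2_eq_square)
    finally show ?thesis by simp
  qed
  then show ?thesis by (simp add: a_def b_def c_def)
qed

section \<open>Integrals of periodic functions over the cell\<close>

lemma countable_lattice: "countable (lattice v)"
  by (simp add: lattice_def)

lemma lattice_uminus: "V \<in> lattice v \<Longrightarrow> - V \<in> lattice v"
proof -
  assume "V \<in> lattice v"
  then obtain n where "V = (\<Sum>i\<in>UNIV. real_of_int (n i) *\<^sub>R v i)" by (auto simp: lattice_def)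
  then have "- V = (\<Sum>i\<in>UNIV. real_of_int ((- n) i) *\<^sub>R v i)"
    by (simp add: sum_negf)
  then show ?thesis unfolding lattice_def by blast
qed

lemma nn_integral_lborel_shift:
  fixes f :: "'a::euclidean_space \<Rightarrow> ennreal"
  assumes [measurable]: "f \<in> borel_measurable borel"
  shows "(\<integral>\<^sup>+x. f (c + x) \<partial>lborel) = (\<integral>\<^sup>+x. f x \<partial>lborel)"
proof -
  have "(\<integral>\<^sup>+x. f x \<partial>lborel) = (\<integral>\<^sup>+x. f x \<partial>distr lborel borel ((+) c))"
    by (simp add: lborel_distr_plus)
  also have "\<dots> = (\<integral>\<^sup>+x. f (c + x) \<partial>lborel)"
    by (subst nn_integral_distr) auto
  finally show ?thesis ..
qed


lemma smooth_differentiable: "smooth f \<Longrightarrow> f differentiable (at x)"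
  unfolding smooth_def by (metis foldr.simps(1) id_apply)

lemma smooth_continuous_on: "smooth f \<Longrightarrow> continuous_on S f"
  by (intro continuous_at_imp_continuous_on ballI differentiable_imp_continuous_within smooth_differentiable)

lemma smooth_pd: "smooth f \<Longrightarrow> smooth (pd s f)"
  unfolding smooth_def
proof (intro allI)
  fix ss x assume "\<forall>ss x. foldr pd ss f differentiable (at x)"
  then have "foldr pd (ss @ [s]) f differentiable (at x)" by blast
  then show "foldr pd ss (pd s f) differentiable (at x)" by simp
qed

lemma pd_has_real_derivative:
  assumes "f differentiable (at (y + t *\<^sub>R axis s 1))"
  shows "((\<lambda>t. f (y + t *\<^sub>R axis s 1)) has_real_derivative pd s f (y + t *\<^sub>R axis s 1)) (at t)"
proof -
  let ?g = "\<lambda>t. y + t *\<^sub>R axis s (1::real)"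
  let ?F = "frechet_derivative f (at (?g t))"
  have f: "(f has_derivative ?F) (at (?g t))"
    using assms frechet_derivative_works by blast
  have "(?g has_derivative (\<lambda>t. t *\<^sub>R axis s 1)) (at t)"
    by (auto intro!: derivative_eq_intros)
  from diff_chain_at[OF this f] have "((\<lambda>t. f (?g t)) has_derivative (\<lambda>t. ?F (t *\<^sub>R axis s 1))) (at t)"
    by (simp add: o_def)
  moreover have "?F (r *\<^sub>R axis s 1) = pd s f (?g t) * r" for r
    using has_derivative_linear[OF f] by (simp add: pd_def linear_cmul)
  ultimately show ?thesis
    by (simp add: has_field_derivative_def)
qed

lemma H1_space_sqint_wpd: "f \<in> H1_space \<Omega> \<Longrightarrow> sqint (lebesgue_on \<Omega>) (wpd \<Omega> s f)"
proof -
  assume "f \<in> H1_space \<Omega>"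
  then have "\<exists>g. has_weak_pd \<Omega> s f g" by (simp add: H1_space_def)
  then have "has_weak_pd \<Omega> s f (wpd \<Omega> s f)" unfolding wpd_def by (rule someI_ex)
  then show ?thesis by (simp add: has_weak_pd_def L2_space_iff_sqint)
qed

lemma H1_per_component:
  assumes "w \<in> H1_per v Y"
  shows "(\<lambda>y. w y $ i) \<in> H1_space Y"
  using assms unfolding H1_per_def by (rule CollectE) (drule conjunct1, erule spec)

context
  fixes v :: "'d::finite \<Rightarrow> real ^ 'd" and Y :: "(real ^ 'd) set"
  assumes cell: "periodicity_cell v Y"
begin

lemma cell_facts:
  shows "bounded Y" "open Y" "negligible (frontier Y)"
    "disjoint_family_on (\<lambda>V. (+) V ` Y) (lattice v)"
    "(\<Union>V\<in>lattice v. closure ((+) V ` Y)) = UNIV"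
  using cell by (auto simp: periodicity_cell_def)

lemma cell_finite_measure: "finite_measure (lebesgue_on Y)"
  using cell_facts(1,2)
  by (intro finite_measure_lebesgue_on) (simp add: bounded_set_imp_lmeasurable borel_open)

lemma cell_measure_pos: "measure lebesgue Y > 0"
proof -
  have "Y \<noteq> {}" using cell_facts(5) by auto
  then have "\<not> negligible Y" using cell_facts(2) open_not_negligible by blast
  moreover have "Y \<in> lmeasurable" using cell_facts(1,2)
    by (simp add: bounded_set_imp_lmeasurable borel_open)
  ultimately show ?thesis
    by (metis negligible_iff_measure0 less_eq_real_def measure_nonneg)
qed

text \<open>The exceptional set consists of the translated frontiers, which are null together because
  the lattice is countable. The sum counts the translates of \<open>Y\<close> that contain \<open>x\<close>, a form of the
  tiling property that can be inserted under an integral.\<close>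

lemma cell_tiling: "AE x in lborel. (\<integral>\<^sup>+V. indicator Y (x - V) \<partial>count_space (lattice v)) = (1::ennreal)"
proof -
  have null: "(\<Union>V\<in>lattice v. (+) V ` frontier Y) \<in> null_sets lebesgue"
    using cell_facts(3) countable_lattice
    by (intro null_sets_UN') (auto simp: negligible_iff_null_sets[symmetric] intro!: negligible_translation)
  then have "AE x in lebesgue. x \<notin> (\<Union>V\<in>lattice v. (+) V ` frontier Y)" by (rule AE_not_in)
  then have "AE x in lborel. x \<notin> (\<Union>V\<in>lattice v. (+) V ` frontier Y)"
    by (simp only: AE_completion_iff)
  then show ?thesis
  proof eventually_elim
    case (elim x)
    obtain V where V: "V \<in> lattice v" "x \<in> closure ((+) V ` Y)" using cell_facts(5) by blast
    then have "x \<in> (+) V ` closure Y" by (simp add: closure_translation)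
    then obtain y where y: "y \<in> closure Y" "x = V + y" by blast
    with elim V(1) have "y \<notin> frontier Y" by blast
    with y(1) cell_facts(2) have "y \<in> Y" by (simp add: frontier_def interior_open)
    with y(2) have xV: "x - V \<in> Y" by simp
    have uniq: "indicator Y (x - W) = (indicator {V} W :: ennreal)" if "W \<in> lattice v" for W
    proof (cases "W = V")
      case False
      have "x - W \<notin> Y"
      proof
        assume "x - W \<in> Y"
        then have "x \<in> (+) W ` Y" "x \<in> (+) V ` Y" using xV
          by (metis add_diff_cancel_left' diff_add_cancel add.commute imageI)+
        with cell_facts(4) V(1) that False show False
          unfolding disjoint_family_on_def by blast
      qed
      with False show ?thesis by simp
    qed (simp add: xV)
    have "(\<integral>\<^sup>+W. indicator Y (x - W) \<partial>count_space (lattice v)) = (\<integral>\<^sup>+W. indicator {V} W \<partial>count_space (lattice v))"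
      by (intro nn_integral_cong) (simp add: uniq)
    also have "\<dots> = 1" using V(1) by simp
    finally show ?case .
  qed
qed

text \<open>Cut the translated cell along the tiling, move every piece back into \<open>Y\<close> by a lattice
  vector, which does not change the integrand, and reassemble: the pieces tile \<open>Y\<close>. In the
  nonnegative setting both interchanges of sum and integral are unconditional.\<close>

lemma nn_integral_cell_shift:
  assumes [measurable]: "f \<in> borel_measurable borel"
    and per: "\<And>V y. V \<in> lattice v \<Longrightarrow> f (y + V) = (f y :: ennreal)"
  shows "(\<integral>\<^sup>+y. f (a + y) * indicator Y y \<partial>lborel) = (\<integral>\<^sup>+y. f y * indicator Y y \<partial>lborel)"
proof -
  have [measurable]: "Y \<in> sets borel" using cell_facts(2) by auto
  have cnt: "countable (lattice v)" by (rule countable_lattice)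
  have "(\<integral>\<^sup>+y. f (a + y) * indicator Y y \<partial>lborel) = (\<integral>\<^sup>+y. f (a + y) * indicator Y (- a + (a + y)) \<partial>lborel)"
    by simp
  also have "\<dots> = (\<integral>\<^sup>+y. f y * indicator Y (- a + y) \<partial>lborel)"
    by (rule nn_integral_lborel_shift[of "\<lambda>y. f y * indicator Y (- a + y)"]) measurable
  also have "\<dots> = (\<integral>\<^sup>+y. (\<integral>\<^sup>+V. f y * indicator Y (- a + y) * indicator Y (y - V) \<partial>count_space (lattice v)) \<partial>lborel)"
    using cell_tiling by (intro nn_integral_cong_AE) (auto elim!: eventually_mono simp: nn_integral_cmult)
  also have "\<dots> = (\<integral>\<^sup>+V. (\<integral>\<^sup>+y. f y * indicator Y (- a + y) * indicator Y (y - V) \<partial>lborel) \<partial>count_space (lattice v))"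
    by (rule nn_integral_count_space_nn_integral[OF cnt]) measurable
  also have "\<dots> = (\<integral>\<^sup>+V. (\<integral>\<^sup>+y. f y * indicator Y y * indicator Y (y - a + V) \<partial>lborel) \<partial>count_space (lattice v))"
  proof (rule nn_integral_cong)
    fix V assume "V \<in> space (count_space (lattice v))"
    then have V: "V \<in> lattice v" by simp
    have "(\<integral>\<^sup>+y. f y * indicator Y (- a + y) * indicator Y (y - V) \<partial>lborel)
        = (\<integral>\<^sup>+y. f (V + y) * indicator Y (- a + (V + y)) * indicator Y (V + y - V) \<partial>lborel)"
      by (rule nn_integral_lborel_shift[symmetric]) measurable
    also have "\<dots> = (\<integral>\<^sup>+y. f y * indicator Y y * indicator Y (y - a + V) \<partial>lborel)"
      using per[OF V] by (intro nn_integral_cong) (simp add: algebra_simps)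
    finally show "(\<integral>\<^sup>+y. f y * indicator Y (- a + y) * indicator Y (y - V) \<partial>lborel)
      = (\<integral>\<^sup>+y. f y * indicator Y y * indicator Y (y - a + V) \<partial>lborel)" .
  qed
  also have "\<dots> = (\<integral>\<^sup>+y. (\<integral>\<^sup>+V. f y * indicator Y y * indicator Y (y - a + V) \<partial>count_space (lattice v)) \<partial>lborel)"
    by (rule nn_integral_count_space_nn_integral[OF cnt, symmetric]) measurable
  also have "\<dots> = (\<integral>\<^sup>+y. f y * indicator Y y \<partial>lborel)"
  proof (rule nn_integral_cong_AE)
    have "AE y in distr lborel borel ((+) (- a)). (\<integral>\<^sup>+V. indicator Y (y - V) \<partial>count_space (lattice v)) = (1::ennreal)"
      unfolding lborel_distr_plus by (rule cell_tiling)
    then have "AE y in lborel. (\<integral>\<^sup>+V. indicator Y (- a + y - V) \<partial>count_space (lattice v)) = (1::ennreal)"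
      by (rule AE_distrD[rotated]) simp
    then show "AE y in lborel. (\<integral>\<^sup>+V. f y * indicator Y y * indicator Y (y - a + V) \<partial>count_space (lattice v))
      = f y * indicator Y y"
    proof eventually_elim
      case (elim y)
      have bij: "bij_betw uminus (lattice v) (lattice v)"
        by (rule bij_betwI[of _ _ _ uminus]) (auto simp: lattice_uminus)
      have "(\<integral>\<^sup>+V. indicator Y (y - a + V) \<partial>count_space (lattice v))
        = (\<integral>\<^sup>+V. indicator Y (y - a - V) \<partial>count_space (lattice v))"
        by (subst nn_integral_bij_count_space[OF bij, symmetric]) simp
      with elim show ?case by (simp add: nn_integral_cmult)
    qed
  qed
  finally show ?thesis .
qed

lemma integral_cell_shift:
  fixes f :: "real ^ 'd \<Rightarrow> real"
  assumes f: "continuous_on UNIV f" and per: "\<And>V y. V \<in> lattice v \<Longrightarrow> f (y + V) = f y"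
  shows "(LINT y|lebesgue_on Y. f (a + y)) = (LINT y|lebesgue_on Y. f y)"
proof -
  have [measurable]: "f \<in> borel_measurable borel" using f by (rule borel_measurable_continuous_onI)
  have [measurable]: "Y \<in> sets borel" using cell_facts(2) by auto
  have bnd: "\<exists>B. \<forall>y\<in>Y. \<bar>f (c + y)\<bar> \<le> B" for c
  proof -
    have "compact (closure Y)" using cell_facts(1) by (simp add: compact_closure)
    moreover have "continuous_on (closure Y) (\<lambda>y. f (c + y))"
      by (intro continuous_on_compose2[OF f] continuous_intros) auto
    ultimately have "bounded ((\<lambda>y. f (c + y)) ` closure Y)"
      by (intro compact_imp_bounded compact_continuous_image)
    then show ?thesis using closure_subset[of Y] by (auto simp: bounded_iff)
  qed
  have int: "integrable (lebesgue_on Y) (\<lambda>y. f (c + y))" for c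
  proof -
    interpret finite_measure "lebesgue_on Y" by (rule cell_finite_measure)
    obtain B where "\<forall>y\<in>Y. \<bar>f (c + y)\<bar> \<le> B" using bnd by blast
    moreover have "(\<lambda>y. f (c + y)) \<in> borel_measurable (lebesgue_on Y)"
      by (intro borel_measurable_continuous_onI continuous_imp_measurable_on_sets_lebesgue
            continuous_on_compose2[OF f] continuous_intros) auto
    ultimately show ?thesis
      by (intro integrable_const_bound[where B=B]) (auto simp: space_restrict_space)
  qed
  have nn: "(\<integral>\<^sup>+y. ennreal (g (c + y)) \<partial>lebesgue_on Y) = (\<integral>\<^sup>+y. ennreal (g y) \<partial>lebesgue_on Y)"
    if g[measurable]: "g \<in> borel_measurable borel" and "\<And>V y. V \<in> lattice v \<Longrightarrow> g (y + V) = g y"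
    for g :: "real ^ 'd \<Rightarrow> real" and c
  proof -
    have "(\<integral>\<^sup>+y. ennreal (g (d + y)) \<partial>lebesgue_on Y) = (\<integral>\<^sup>+y. ennreal (g (d + y)) * indicator Y y \<partial>lborel)" for d
      by (subst nn_integral_restrict_space) (auto simp: nn_integral_completion)
    note this[of c] this[of 0]
    moreover have "(\<integral>\<^sup>+y. ennreal (g (c + y)) * indicator Y y \<partial>lborel) = (\<integral>\<^sup>+y. ennreal (g y) * indicator Y y \<partial>lborel)"
      using that by (intro nn_integral_cell_shift) auto
    ultimately show ?thesis by simp
  qed
  have "(LINT y|lebesgue_on Y. f (a + y)) = enn2real (\<integral>\<^sup>+y. ennreal (f (a + y)) \<partial>lebesgue_on Y)
      - enn2real (\<integral>\<^sup>+y. ennreal (- f (a + y)) \<partial>lebesgue_on Y)"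
    by (rule real_lebesgue_integral_def) (rule int)
  also have "\<dots> = enn2real (\<integral>\<^sup>+y. ennreal (f y) \<partial>lebesgue_on Y)
      - enn2real (\<integral>\<^sup>+y. ennreal (- f y) \<partial>lebesgue_on Y)"
    using nn[of f a] nn[of "\<lambda>y. - f y" a] per by simp
  also have "\<dots> = (LINT y|lebesgue_on Y. f y)"
    by (rule real_lebesgue_integral_def[symmetric]) (use int[of 0] in simp)
  finally show ?thesis .
qed

text \<open>The integral of \<open>f\<close> over the cell does not change when \<open>f\<close> is translated along \<open>s\<close>, so the
  difference quotients of \<open>f\<close> have integral zero; they converge boundedly to the derivative.\<close>

lemma integral_cell_pd_eq_0:
  assumes f: "smooth f" and per: "\<And>V y. V \<in> lattice v \<Longrightarrow> f (y + V) = f y"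
  shows "(LINT y|lebesgue_on Y. pd s f y) = 0"
proof -
  interpret finite_measure "lebesgue_on Y" by (rule cell_finite_measure)
  let ?e = "axis s (1::real) :: real ^ 'd"
  define D where "D n y = real (Suc n) * (f ((1 / real (Suc n)) *\<^sub>R ?e + y) - f y)" for n y
  have meas: "g \<in> borel_measurable (lebesgue_on Y)" if "continuous_on UNIV g" for g :: "real ^ 'd \<Rightarrow> real"
    using cell_facts(2) that
    by (intro continuous_imp_measurable_on_sets_lebesgue) (auto intro: continuous_on_subset)
  have cf: "continuous_on UNIV f" and cpd: "continuous_on UNIV (pd s f)"
    using f by (auto intro: smooth_continuous_on smooth_pd)
  have shift: "continuous_on S (\<lambda>y. f (c + y))" for c S
    by (rule continuous_on_compose2[OF cf]) (auto intro: continuous_intros)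
  have "compact (closure Y \<times> {0..1::real})" using cell_facts(1) by (simp add: compact_Times)
  moreover have "continuous_on (closure Y \<times> {0..1::real}) (\<lambda>p. pd s f (fst p + snd p *\<^sub>R ?e))"
    by (intro continuous_on_compose2[OF cpd] continuous_intros) auto
  ultimately have "bounded ((\<lambda>p. pd s f (fst p + snd p *\<^sub>R ?e)) ` (closure Y \<times> {0..1}))"
    by (intro compact_imp_bounded compact_continuous_image)
  then obtain B where B: "\<And>y t. y \<in> closure Y \<Longrightarrow> 0 \<le> t \<Longrightarrow> t \<le> 1 \<Longrightarrow> \<bar>pd s f (y + t *\<^sub>R ?e)\<bar> \<le> B"
    unfolding bounded_iff by fastforce
  have der: "((\<lambda>t. f (y + t *\<^sub>R ?e)) has_real_derivative pd s f (y + t *\<^sub>R ?e)) (at t)" for y t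
    by (rule pd_has_real_derivative[OF smooth_differentiable[OF f]])
  have lim: "(\<lambda>n. D n y) \<longlonglongrightarrow> pd s f y" for y
  proof -
    have "((\<lambda>h. (f (y + h *\<^sub>R ?e) - f y) / h) \<longlongrightarrow> pd s f y) (at 0)"
      using der[of y 0] by (simp add: DERIV_def)
    moreover have "filterlim (\<lambda>n. 1 / real (Suc n)) (at 0) sequentially"
      unfolding filterlim_at using LIMSEQ_inverse_real_of_nat by (simp add: inverse_eq_divide)
    ultimately have "(\<lambda>n. (f (y + (1 / real (Suc n)) *\<^sub>R ?e) - f y) / (1 / real (Suc n))) \<longlonglongrightarrow> pd s f y"
      by (rule filterlim_compose)
    moreover have "(f (y + (1 / real (Suc n)) *\<^sub>R ?e) - f y) / (1 / real (Suc n)) = D n y" for n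
      unfolding D_def by (simp only: add.commute[of y] mult.commute[of "real (Suc n)"] divide_divide_eq_right div_by_1)
    ultimately show ?thesis by (simp only:)
  qed
  have bound: "\<bar>D n y\<bar> \<le> B" if "y \<in> Y" for n y
  proof -
    let ?h = "1 / real (Suc n)"
    obtain z where z: "0 < z" "z < ?h" "f (y + ?h *\<^sub>R ?e) - f (y + 0 *\<^sub>R ?e) = (?h - 0) * pd s f (y + z *\<^sub>R ?e)"
      using MVT2[of 0 ?h "\<lambda>t. f (y + t *\<^sub>R ?e)" "\<lambda>t. pd s f (y + t *\<^sub>R ?e)"] der by auto
    have "?h \<le> 1" by simp
    with z(2) have "z \<le> 1" by linarith
    have "D n y = pd s f (y + z *\<^sub>R ?e)"
      unfolding D_def add.commute[of _ y] using z(3) by simp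
    with B[of y z] that z(1) \<open>z \<le> 1\<close> show ?thesis using closure_subset by auto
  qed
  have Dint: "(LINT y|lebesgue_on Y. D n y) = 0" for n
  proof -
    have int: "integrable (lebesgue_on Y) (\<lambda>y. f (c + y))" for c
    proof -
      have "bounded ((\<lambda>y. f (c + y)) ` closure Y)"
        using cell_facts(1)
        by (intro compact_imp_bounded compact_continuous_image shift) (auto simp: compact_closure)
      then obtain B where "\<And>y. y \<in> closure Y \<Longrightarrow> \<bar>f (c + y)\<bar> \<le> B" by (auto simp: bounded_iff)
      then show ?thesis
        using closure_subset[of Y]
        by (intro integrable_const_bound[where B=B] AE_I2 meas shift)
          (auto simp: space_restrict_space)
    qed
    have "(LINT y|lebesgue_on Y. D n y)
      = real (Suc n) * ((LINT y|lebesgue_on Y. f ((1 / real (Suc n)) *\<^sub>R ?e + y)) - (LINT y|lebesgue_on Y. f y))"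
      unfolding D_def using int int[of 0]
      by (subst integral_mult_right_zero, subst Bochner_Integration.integral_diff) auto
    also have "\<dots> = 0"
      using integral_cell_shift[OF cf per] by simp
    finally show ?thesis .
  qed
  have "(\<lambda>n. LINT y|lebesgue_on Y. D n y) \<longlonglongrightarrow> (LINT y|lebesgue_on Y. pd s f y)"
  proof (rule integral_dominated_convergence[where w="\<lambda>_. B"])
    show "D n \<in> borel_measurable (lebesgue_on Y)" for n
      unfolding D_def by (intro meas continuous_intros cf shift)
    show "pd s f \<in> borel_measurable (lebesgue_on Y)" by (rule meas[OF cpd])
    show "integrable (lebesgue_on Y) (\<lambda>_. B)" by (rule integrable_const)
    show "AE y in lebesgue_on Y. (\<lambda>n. D n y) \<longlonglongrightarrow> pd s f y" by (rule AE_I2) (rule lim)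
    show "AE y in lebesgue_on Y. norm (D n y) \<le> B" for n
      by (rule AE_I2) (simp add: space_restrict_space bound)
  qed
  then show ?thesis by (simp add: Dint LIMSEQ_const_iff)
qed

text \<open>The identity for smooth periodic functions passes to their \<open>H\<^sup>1\<close> limits, since the mean is
  continuous in \<open>L\<^sup>2\<close> of a set of finite measure.\<close>

lemma H1_per_integral_pd_eq_0:
  assumes w: "w \<in> H1_per v Y"
  shows "(LINT y|lebesgue_on Y. cell_pd Y w i s y) = 0"
proof -
  let ?M = "lebesgue_on Y"
  interpret finite_measure ?M by (rule cell_finite_measure)
  define S where "S \<phi> n = (\<Sum>i\<in>UNIV. (LINT y|?M. (\<phi> n y $ i - w y $ i)\<^sup>2)
    + (\<Sum>s\<in>UNIV. LINT y|?M. (pd s (\<lambda>y. \<phi> n y $ i) y - wpd Y s (\<lambda>y. w y $ i) y)\<^sup>2))"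
    for \<phi> :: "nat \<Rightarrow> real ^ 'd \<Rightarrow> real ^ 'd" and n
  have "\<exists>\<phi>. (\<forall>n. smooth_periodic v (\<phi> n)) \<and> S \<phi> \<longlonglongrightarrow> 0"
    using w unfolding H1_per_def S_def by (rule CollectE) (erule conjunct2)
  then obtain \<phi> where per: "\<And>n. smooth_periodic v (\<phi> n)" and lim: "S \<phi> \<longlonglongrightarrow> 0"
    by blast
  define u where "u = wpd Y s (\<lambda>y. w y $ i)"
  define p where "p n = pd s (\<lambda>y. \<phi> n y $ i)" for n
  have u: "sqint ?M u"
    unfolding u_def by (rule H1_space_sqint_wpd) (rule H1_per_component[OF w])
  have p: "sqint ?M (p n)" for n
  proof -
    have c: "continuous_on S (p n)" for S
      using per[of n] unfolding p_def smooth_periodic_def by (auto intro: smooth_continuous_on smooth_pd)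
    then have "bounded (p n ` closure Y)"
      using cell_facts(1) by (intro compact_imp_bounded compact_continuous_image) auto
    then obtain B where "\<And>y. y \<in> closure Y \<Longrightarrow> \<bar>p n y\<bar> \<le> B" by (auto simp: bounded_iff)
    then show ?thesis
      using closure_subset[of Y] cell_facts(2)
      by (intro sqint_bounded[where B=B] cell_finite_measure continuous_imp_measurable_on_sets_lebesgue c AE_I2)
        (auto simp: space_restrict_space)
  qed
  have pint: "(LINT y|?M. p n y) = 0" for n
    unfolding p_def using per[of n] by (intro integral_cell_pd_eq_0) (auto simp: smooth_periodic_def)
  have one: "sqint ?M (\<lambda>_. 1)" by (simp add: sqint_def)
  have le: "(LINT y|?M. u y)\<^sup>2 \<le> measure ?M (space ?M) * S \<phi> n" for n
  proof -
    have up: "sqint ?M (\<lambda>y. p n y - u y)" by (intro sqint_diff p u)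
    have int: "integrable ?M (p n)" "integrable ?M u"
      using sqint_integrable_mult[OF p one] sqint_integrable_mult[OF u one] by auto
    have "(LINT y|?M. (p n y - u y)\<^sup>2)
      \<le> (LINT y|?M. (\<phi> n y $ i - w y $ i)\<^sup>2)
           + (\<Sum>s\<in>UNIV. LINT y|?M. (pd s (\<lambda>y. \<phi> n y $ i) y - wpd Y s (\<lambda>y. w y $ i) y)\<^sup>2)"
      using member_le_sum[of s UNIV "\<lambda>s. LINT y|?M. (pd s (\<lambda>y. \<phi> n y $ i) y - wpd Y s (\<lambda>y. w y $ i) y)\<^sup>2"]
      by (intro add_increasing) (auto simp: p_def u_def integral_nonneg_AE)
    also have "\<dots> \<le> S \<phi> n"
      unfolding S_def by (rule member_le_sum) (auto intro!: add_nonneg_nonneg sum_nonneg simp: integral_nonneg_AE)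
    finally have S: "(LINT y|?M. (p n y - u y)\<^sup>2) \<le> S \<phi> n" .
    have "(LINT y|?M. u y)\<^sup>2 = (LINT y|?M. (p n y - u y) * 1)\<^sup>2"
      using int pint by simp
    also have "\<dots> \<le> (LINT y|?M. (p n y - u y)\<^sup>2) * (LINT y|?M. 1\<^sup>2)"
      by (rule sqint_Cauchy_Schwarz[OF up one])
    also have "\<dots> = measure ?M (space ?M) * (LINT y|?M. (p n y - u y)\<^sup>2)"
      by simp
    also have "\<dots> \<le> measure ?M (space ?M) * S \<phi> n"
      by (rule mult_left_mono[OF S]) simp
    finally show ?thesis .
  qed
  have "(\<lambda>n. measure ?M (space ?M) * S \<phi> n) \<longlonglongrightarrow> measure ?M (space ?M) * 0"
    by (intro tendsto_mult lim tendsto_const)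
  then have "(LINT y|?M. u y)\<^sup>2 \<le> measure ?M (space ?M) * 0"
    by (rule Lim_bounded2[where N=0]) (use le in auto)
  then show ?thesis by (simp add: cell_pd_def u_def)
qed

end

section \<open>Ellipticity of the homogenised tensor\<close>

definition bform :: "'d::finite tensor4 \<Rightarrow> ('d \<Rightarrow> 'd \<Rightarrow> real) \<Rightarrow> ('d \<Rightarrow> 'd \<Rightarrow> real) \<Rightarrow> real" where
  "bform c S T = (\<Sum>i\<in>UNIV. \<Sum>j\<in>UNIV. \<Sum>k\<in>UNIV. \<Sum>l\<in>UNIV. S i j * c i j k l * T k l)"

definition unit_mat :: "'d \<Rightarrow> 'd \<Rightarrow> 'd \<Rightarrow> 'd \<Rightarrow> real" where
  "unit_mat k l i j = kdelta k i * kdelta l j"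

lemma bform_add_left: "bform c (\<lambda>i j. S i j + S' i j) T = bform c S T + bform c S' T"
  by (simp add: bform_def sum.distrib algebra_simps)

lemma bform_add_right: "bform c S (\<lambda>i j. T i j + T' i j) = bform c S T + bform c S T'"
  by (simp add: bform_def sum.distrib algebra_simps)

lemma bform_cmult_left: "bform c (\<lambda>i j. a * S i j) T = a * bform c S T"
  by (simp add: bform_def sum_distrib_left algebra_simps)

lemma bform_cmult_right: "bform c S (\<lambda>i j. a * T i j) = a * bform c S T"
  by (simp add: bform_def sum_distrib_left algebra_simps)

lemma bform_sum_left: "bform c (\<lambda>i j. \<Sum>a\<in>A. S a i j) T = (\<Sum>a\<in>A. bform c (S a) T)"
proof (induction A rule: infinite_finite_induct)
  case (insert a A)
  then show ?case by (simp add: bform_add_left)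
qed (simp_all add: bform_def)

lemma bform_sum_right: "bform c S (\<lambda>i j. \<Sum>a\<in>A. T a i j) = (\<Sum>a\<in>A. bform c S (T a))"
proof (induction A rule: infinite_finite_induct)
  case (insert a A)
  then show ?case by (simp add: bform_add_right)
qed (simp_all add: bform_def)

lemma bform_swap:
  assumes "\<And>i j k l. c i j k l = c k l i j"
  shows "bform c S T = bform c T S"
proof -
  have "bform c S T = (\<Sum>k\<in>UNIV. \<Sum>l\<in>UNIV. \<Sum>i\<in>UNIV. \<Sum>j\<in>UNIV. S i j * c i j k l * T k l)"
    unfolding bform_def
    by (subst sum.swap, subst (2) sum.swap, subst (3) sum.swap, subst (2) sum.swap) (rule refl)
  also have "\<dots> = bform c T S"
    unfolding bform_def
    by (intro sum.cong refl) (metis assms mult.commute mult.assoc)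
  finally show ?thesis .
qed

lemma bform_transpose_left:
  assumes "\<And>i j k l. c i j k l = c j i k l"
  shows "bform c (\<lambda>i j. S j i) T = bform c S T"
proof -
  have "bform c (\<lambda>i j. S j i) T = (\<Sum>j\<in>UNIV. \<Sum>i\<in>UNIV. \<Sum>k\<in>UNIV. \<Sum>l\<in>UNIV. S j i * c i j k l * T k l)"
    unfolding bform_def by (rule sum.swap)
  also have "\<dots> = bform c S T"
    unfolding bform_def by (intro sum.cong refl) (metis assms)
  finally show ?thesis .
qed

text \<open>A tensor with the symmetries of elasticity only sees the symmetric part of its arguments;
  this is what makes ellipticity on symmetric tensors applicable to gradients.\<close>

lemma bform_sym_part:
  assumes minor: "\<And>i j k l. c i j k l = c j i k l" and major: "\<And>i j k l. c i j k l = c k l i j"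
  shows "bform c (\<lambda>i j. (T i j + T j i) / 2) (\<lambda>i j. (T i j + T j i) / 2) = bform c T T"
proof -
  let ?S = "\<lambda>i j. (1 / 2) * (T i j + T j i)"
  have left: "bform c ?S X = bform c T X" for X
    unfolding bform_cmult_left bform_add_left using bform_transpose_left[of c T X] minor by simp
  have "bform c ?S ?S = bform c T ?S" by (rule left)
  also have "\<dots> = bform c ?S T" by (rule bform_swap[OF major])
  also have "\<dots> = bform c T T" by (rule left)
  finally show ?thesis by simp
qed

lemma bform_unit_left: "bform c (unit_mat k l) T = (\<Sum>p\<in>UNIV. \<Sum>q\<in>UNIV. c k l p q * T p q)"
proof -
  have "bform c (unit_mat k l) T = (\<Sum>i\<in>UNIV. \<Sum>j\<in>UNIV. (if k = i then (if l = j then (\<Sum>p\<in>UNIV. \<Sum>q\<in>UNIV. c i j p q * T p q) else 0) else 0))"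
    unfolding bform_def by (intro sum.cong refl) (auto simp: unit_mat_def kdelta_def)
  also have "\<dots> = (\<Sum>i\<in>UNIV. if k = i then (\<Sum>j\<in>UNIV. (if l = j then (\<Sum>p\<in>UNIV. \<Sum>q\<in>UNIV. c i j p q * T p q) else 0)) else 0)"
    by (intro sum.cong refl) auto
  also have "\<dots> = (\<Sum>p\<in>UNIV. \<Sum>q\<in>UNIV. c k l p q * T p q)"
    by (simp only: sum.delta' finite UNIV_I if_True)
  finally show ?thesis .
qed

lemma norm_matrix_sq: "(norm (A :: real ^ 'm ^ 'n))\<^sup>2 = (\<Sum>i\<in>UNIV. \<Sum>j\<in>UNIV. (A $ i $ j)\<^sup>2)"
  by (simp add: norm_vec_def L2_set_def sum_nonneg real_sqrt_pow2)

context
  fixes v :: "'d::finite \<Rightarrow> real ^ 'd" and Y :: "(real ^ 'd) set"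
    and C :: "real ^ 'd \<Rightarrow> 'd tensor4" and chi1 :: "'d \<Rightarrow> 'd \<Rightarrow> 'd field"
  assumes cell: "periodicity_cell v Y" and C: "elasticity_tensor Y C"
    and chi1: "cell_functions1 v Y C chi1"
begin

lemma integrable_bform:
  assumes "\<And>i j. sqint (lebesgue_on Y) (\<lambda>y. S y i j)" "\<And>i j. sqint (lebesgue_on Y) (\<lambda>y. T y i j)"
  shows "integrable (lebesgue_on Y) (\<lambda>y. bform (C y) (S y) (T y))"
proof -
  obtain B where "AE y in lebesgue_on Y. \<forall>i j k l. \<bar>C y i j k l\<bar> \<le> B"
    using C unfolding elasticity_tensor_def by blast
  then have B: "AE y in lebesgue_on Y. \<bar>C y i j k l\<bar> \<le> B" for i j k l
    by (rule eventually_mono) blast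
  have meas: "(\<lambda>y. C y i j k l) \<in> borel_measurable (lebesgue_on Y)" for i j k l
    using C unfolding elasticity_tensor_def by blast
  show ?thesis
    unfolding bform_def mult.assoc
    by (intro Bochner_Integration.integrable_sum sqint_integrable_mult sqint_bounded_mult[OF _ _ B] assms meas)
qed

lemma chi1_mean_zero: "chi1 k l \<in> H1_mean_zero v Y"
  using chi1 unfolding cell_functions1_def by blast

lemma chi1_H1_per: "chi1 k l \<in> H1_per v Y"
  using chi1_mean_zero[of k l] unfolding H1_mean_zero_def by (rule CollectE) (erule conjunct1)

text \<open>The gradient of \<open>y\<^sub>l e\<^sub>k + \<chi>\<^sup>k\<^sup>l(y)\<close>, the oscillating displacement that the homogenised medium
  sees as the unit strain \<open>kl\<close>.\<close>

definition corrector_strain :: "'d \<Rightarrow> 'd \<Rightarrow> real ^ 'd \<Rightarrow> 'd \<Rightarrow> 'd \<Rightarrow> real" where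
  "corrector_strain k l y i j = cell_pd Y (chi1 k l) i j y + unit_mat k l i j"

lemma sqint_cell_pd: "sqint (lebesgue_on Y) (cell_pd Y (chi1 k l) i j)"
  unfolding cell_pd_def by (rule H1_space_sqint_wpd[OF H1_per_component[OF chi1_H1_per]])

lemma sqint_const: "sqint (lebesgue_on Y) (\<lambda>y. c)"
  using cell_finite_measure[OF cell] by (intro sqint_bounded[where B="\<bar>c\<bar>"]) auto

lemma sqint_corrector_strain: "sqint (lebesgue_on Y) (\<lambda>y. corrector_strain k l y i j)"
  unfolding corrector_strain_def by (intro sqint_add sqint_cell_pd sqint_const)

lemma integral_corrector_strain:
  "(LINT y|lebesgue_on Y. corrector_strain k l y i j) = measure lebesgue Y * unit_mat k l i j"
proof -
  interpret finite_measure "lebesgue_on Y" by (rule cell_finite_measure[OF cell])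
  have "integrable (lebesgue_on Y) (\<lambda>y. cell_pd Y (chi1 k l) i j y * 1)"
    by (intro sqint_integrable_mult sqint_cell_pd sqint_const)
  then show ?thesis
    using H1_per_integral_pd_eq_0[OF cell chi1_H1_per, of k l i j] cell_facts(2)[OF cell]
    unfolding corrector_strain_def by (simp add: measure_restrict_space)
qed

text \<open>The cell problem, tested with another cell function, says that the stress
  \<open>C : (e\<^sup>k\<^sup>l + \<nabla>\<chi>\<^sup>k\<^sup>l)\<close> is orthogonal to gradients of cell functions. The test functions are the
  cell functions one at a time, so that linear combinations are formed under the integral sign
  and not inside \<open>wpd\<close>.\<close>

lemma corrector_strain_orthogonal:
  "(LINT y|lebesgue_on Y. bform (C y) (corrector_strain k l y) (\<lambda>i j. cell_pd Y (chi1 m n) i j y)) = 0"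
proof -
  let ?G = "\<lambda>k l y i j. cell_pd Y (chi1 k l) i j y"
  have "cell_form Y C (chi1 k l) (chi1 m n) = - (LINT y|lebesgue_on Y. (\<Sum>r\<in>UNIV. \<Sum>s\<in>UNIV. C y k l r s * ?G m n y r s))"
    using chi1 chi1_mean_zero[of m n] unfolding cell_functions1_def by blast
  then have "(LINT y|lebesgue_on Y. bform (C y) (?G k l y) (?G m n y))
      = - (LINT y|lebesgue_on Y. bform (C y) (unit_mat k l) (?G m n y))"
    unfolding bform_unit_left by (simp only: cell_form_def bform_def)
  moreover have "(LINT y|lebesgue_on Y. bform (C y) (corrector_strain k l y) (?G m n y))
      = (LINT y|lebesgue_on Y. bform (C y) (?G k l y) (?G m n y))
        + (LINT y|lebesgue_on Y. bform (C y) (unit_mat k l) (?G m n y))"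
    unfolding corrector_strain_def bform_add_left
    by (intro Bochner_Integration.integral_add integrable_bform sqint_cell_pd sqint_const)
  ultimately show ?thesis by simp
qed

lemma C_symmetries:
  "AE y in lebesgue_on Y. (\<forall>i j k l. C y i j k l = C y j i k l) \<and> (\<forall>i j k l. C y i j k l = C y k l i j)"
proof -
  have "AE y in lebesgue_on Y. \<forall>i j k l.
        C y i j k l = C y j i k l \<and> C y i j k l = C y i j l k \<and> C y i j k l = C y k l i j"
    using C unfolding elasticity_tensor_def by blast
  then show ?thesis by (rule eventually_mono) blast
qed

text \<open>By orthogonality the gradient part of one of the two factors drops out, leaving the mean
  stress; so the effective tensor is a Gram matrix for the energy form of \<open>C\<close>.\<close>

lemma integral_bform_corrector_strain:
  "(LINT y|lebesgue_on Y. bform (C y) (corrector_strain m n y) (corrector_strain k l y))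
    = measure lebesgue Y * eff0 Y C chi1 k l m n"
proof -
  let ?E = corrector_strain
  have meas: "(\<lambda>y. bform (C y) (S y) (T y)) \<in> borel_measurable (lebesgue_on Y)"
    if "\<And>i j. sqint (lebesgue_on Y) (\<lambda>y. S y i j)" "\<And>i j. sqint (lebesgue_on Y) (\<lambda>y. T y i j)" for S T
    using integrable_bform[OF that] by (rule borel_measurable_integrable)
  have "(LINT y|lebesgue_on Y. bform (C y) (?E m n y) (?E k l y))
    = (LINT y|lebesgue_on Y. bform (C y) (?E m n y) (\<lambda>i j. cell_pd Y (chi1 k l) i j y)
        + bform (C y) (?E m n y) (unit_mat k l))"
    by (subst (2) corrector_strain_def[abs_def]) (simp only: bform_add_right)
  also have "\<dots> = (LINT y|lebesgue_on Y. bform (C y) (?E m n y) (\<lambda>i j. cell_pd Y (chi1 k l) i j y))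
      + (LINT y|lebesgue_on Y. bform (C y) (?E m n y) (unit_mat k l))"
    by (intro Bochner_Integration.integral_add integrable_bform sqint_cell_pd sqint_const sqint_corrector_strain)
  also have "\<dots> = (LINT y|lebesgue_on Y. bform (C y) (?E m n y) (unit_mat k l))"
    by (simp only: corrector_strain_orthogonal add_0)
  also have "\<dots> = (LINT y|lebesgue_on Y. bform (C y) (unit_mat k l) (?E m n y))"
  proof (intro integral_cong_AE meas sqint_const sqint_corrector_strain)
    show "AE y in lebesgue_on Y. bform (C y) (?E m n y) (unit_mat k l) = bform (C y) (unit_mat k l) (?E m n y)"
      using C_symmetries by (rule eventually_mono) (rule bform_swap, blast)
  qed
  also have "\<dots> = (LINT y|lebesgue_on Y. stress0 Y C chi1 m n k l y)"
  proof (rule Bochner_Integration.integral_cong[OF refl])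
    fix y
    have "(\<Sum>p\<in>UNIV. \<Sum>q\<in>UNIV. C y k l p q * unit_mat m n p q) = C y k l m n"
      by (simp add: unit_mat_def kdelta_def if_distrib[of "\<lambda>x. _ * x"] sum.delta' cong: if_cong)
    then show "bform (C y) (unit_mat k l) (?E m n y) = stress0 Y C chi1 m n k l y"
      unfolding bform_unit_left corrector_strain_def stress0_def distrib_left sum.distrib by simp
  qed
  also have "\<dots> = measure lebesgue Y * eff0 Y C chi1 k l m n"
    using cell_measure_pos[OF cell] by (simp add: eff0_def cell_mean_def)
  finally show ?thesis .
qed

text \<open>With \<open>T = e + \<Sum> e\<^sub>k\<^sub>l \<nabla>\<chi>\<^sup>k\<^sup>l\<close> the Gram representation gives \<open>|Y| e : C0 : e = \<integral> T : C : T\<close>.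
  The ellipticity of \<open>C\<close> bounds this by \<open>\<kappa> \<integral> |D|\<^sup>2\<close>, where \<open>D\<close> is the symmetric part of \<open>T\<close>. As
  \<open>D\<close> has mean \<open>e\<close>, the tangent inequality \<open>D\<^sup>2 \<ge> 2 e D - e\<^sup>2\<close> integrates to \<open>\<integral> |D|\<^sup>2 \<ge> |Y| |e|\<^sup>2\<close>.
  The constant is that of \<open>C\<close>.\<close>

lemma eff0_elliptic:
  "\<exists>\<kappa>>0. \<forall>e. (\<forall>i j. e i j = e j i) \<longrightarrow> bform (eff0 Y C chi1) e e \<ge> \<kappa> * (\<Sum>i\<in>UNIV. \<Sum>j\<in>UNIV. (e i j)\<^sup>2)"
proof -
  let ?M = "lebesgue_on Y" and ?m = "measure lebesgue Y"
  interpret finite_measure ?M by (rule cell_finite_measure[OF cell])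
  have m: "?m > 0" by (rule cell_measure_pos[OF cell])
  obtain \<kappa> where \<kappa>: "\<kappa> > 0" and ell: "AE y in ?M. \<forall>\<epsilon>\<in>sym2.
        (\<Sum>i\<in>UNIV. \<Sum>j\<in>UNIV. \<Sum>k\<in>UNIV. \<Sum>l\<in>UNIV. \<epsilon> $ i $ j * C y i j k l * \<epsilon> $ k $ l)
          \<ge> \<kappa> * (norm \<epsilon>)\<^sup>2"
    using C unfolding elasticity_tensor_def by blast
  have "bform (eff0 Y C chi1) e e \<ge> \<kappa> * (\<Sum>i\<in>UNIV. \<Sum>j\<in>UNIV. (e i j)\<^sup>2)"
    if sym: "\<And>i j. e i j = e j i" for e
  proof -
    define T where "T y i j = (\<Sum>k\<in>UNIV. \<Sum>l\<in>UNIV. e k l * corrector_strain k l y i j)" for y i j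
    define D where "D y i j = (T y i j + T y j i) / 2" for y i j
    have T: "sqint ?M (\<lambda>y. T y i j)" for i j
      unfolding T_def by (intro sqint_sum sqint_cmult sqint_corrector_strain)
    have D: "sqint ?M (\<lambda>y. D y i j)" for i j
      using sqint_cmult[OF sqint_add[OF T[of i j] T[of j i]], of "1/2"] by (simp add: D_def)
    have int: "integrable ?M (\<lambda>y. f y)" if "sqint ?M f" for f
      using sqint_integrable_mult[OF that sqint_const[of 1]] by simp
    have intT: "(LINT y|?M. T y i j) = ?m * e i j" for i j
    proof -
      have "(LINT y|?M. T y i j) = (\<Sum>k\<in>UNIV. \<Sum>l\<in>UNIV. e k l * (?m * unit_mat k l i j))"
        unfolding T_def by (simp add: int sqint_cmult sqint_sum sqint_corrector_strain integral_corrector_strain)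
      also have "\<dots> = ?m * e i j"
        by (simp add: unit_mat_def kdelta_def if_distrib[of "\<lambda>x. _ * x"] cong: if_cong)
      finally show ?thesis .
    qed
    have intD: "(LINT y|?M. D y i j) = ?m * e i j" for i j
    proof -
      have "(LINT y|?M. D y i j) = ((LINT y|?M. T y i j) + (LINT y|?M. T y j i)) / 2"
        unfolding D_def by (simp add: int T)
      then show ?thesis using sym[of j i] by (simp add: intT)
    qed
    have "?m * bform (eff0 Y C chi1) e e
      = (\<Sum>i\<in>UNIV. \<Sum>j\<in>UNIV. \<Sum>k\<in>UNIV. \<Sum>l\<in>UNIV. e i j * (e k l *
          (LINT y|?M. bform (C y) (corrector_strain k l y) (corrector_strain i j y))))"
      unfolding integral_bform_corrector_strain bform_def[of "eff0 Y C chi1"]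
      by (simp add: sum_distrib_left mult_ac)
    also have "\<dots> = (LINT y|?M. (\<Sum>i\<in>UNIV. \<Sum>j\<in>UNIV. \<Sum>k\<in>UNIV. \<Sum>l\<in>UNIV. e i j * (e k l *
          bform (C y) (corrector_strain k l y) (corrector_strain i j y))))"
      by (simp add: integrable_bform sqint_corrector_strain)
    also have "\<dots> = (LINT y|?M. bform (C y) (T y) (T y))"
      unfolding T_def[abs_def] bform_sum_right bform_cmult_right
      unfolding bform_sum_left bform_cmult_left
      by (intro Bochner_Integration.integral_cong refl) (simp only: sum_distrib_left)
    also have "\<dots> \<ge> (LINT y|?M. \<kappa> * (\<Sum>i\<in>UNIV. \<Sum>j\<in>UNIV. 2 * e i j * D y i j - (e i j)\<^sup>2))"
    proof (rule integral_mono_AE)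
      show "integrable ?M (\<lambda>y. \<kappa> * (\<Sum>i\<in>UNIV. \<Sum>j\<in>UNIV. 2 * e i j * D y i j - (e i j)\<^sup>2))"
        by (intro int sqint_cmult sqint_sum sqint_diff D sqint_const)
      show "integrable ?M (\<lambda>y. bform (C y) (T y) (T y))" by (intro integrable_bform T)
      show "AE y in ?M. \<kappa> * (\<Sum>i\<in>UNIV. \<Sum>j\<in>UNIV. 2 * e i j * D y i j - (e i j)\<^sup>2) \<le> bform (C y) (T y) (T y)"
        using ell C_symmetries
      proof eventually_elim
        case (elim y)
        define \<epsilon> where "\<epsilon> = (\<chi> i j. D y i j)"
        have "2 * e i j * D y i j - (e i j)\<^sup>2 \<le> (D y i j)\<^sup>2" for i j
          using sum_squares_bound[of "e i j" "D y i j"] by (simp add: mult.assoc)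
        then have "\<kappa> * (\<Sum>i\<in>UNIV. \<Sum>j\<in>UNIV. 2 * e i j * D y i j - (e i j)\<^sup>2)
            \<le> \<kappa> * (\<Sum>i\<in>UNIV. \<Sum>j\<in>UNIV. (D y i j)\<^sup>2)"
          using \<kappa> by (intro mult_left_mono sum_mono) auto
        also have "\<dots> = \<kappa> * (norm \<epsilon>)\<^sup>2" by (simp add: norm_matrix_sq \<epsilon>_def)
        also have "\<epsilon> \<in> sym2" by (simp add: sym2_def \<epsilon>_def D_def add.commute)
        with elim(1) have "\<kappa> * (norm \<epsilon>)\<^sup>2 \<le> bform (C y) (D y) (D y)"
          unfolding bform_def by (auto simp: \<epsilon>_def)
        also have "bform (C y) (D y) (D y) = bform (C y) (T y) (T y)"
          unfolding D_def[abs_def] using elim(2) by (intro bform_sym_part) blast+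
        finally show ?case .
      qed
    qed
    also have "(LINT y|?M. \<kappa> * (\<Sum>i\<in>UNIV. \<Sum>j\<in>UNIV. 2 * e i j * D y i j - (e i j)\<^sup>2))
      = \<kappa> * (\<Sum>i\<in>UNIV. \<Sum>j\<in>UNIV. ?m * (e i j)\<^sup>2)"
    proof -
      have "(LINT y|?M. 2 * e i j * D y i j - (e i j)\<^sup>2) = ?m * (e i j)\<^sup>2" for i j
        using intD[of i j] int[OF D[of i j]] cell_facts(2)[OF cell]
        by (simp add: measure_restrict_space power2_eq_square)
      then show ?thesis
        by (simp add: int sqint_cmult sqint_sum sqint_diff D sqint_const)
    qed
    also have "\<dots> = ?m * (\<kappa> * (\<Sum>i\<in>UNIV. \<Sum>j\<in>UNIV. (e i j)\<^sup>2))"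
      by (simp add: sum_distrib_left mult_ac)
    finally show ?thesis using m by simp
  qed
  with \<kappa> show ?thesis by blast
qed

end

section \<open>Smooth bump functions\<close>

text \<open>The classical flat function \<open>exp (- 1 / t)\<close> and its multiples by negative powers of \<open>t\<close>,
  which are what its derivatives are made of.\<close>

definition psi :: "nat \<Rightarrow> real \<Rightarrow> real" where
  "psi k t = (if 0 < t then exp (- 1 / t) / t ^ k else 0)"

lemma psi_pos: "0 < t \<Longrightarrow> 0 < psi k t"
  by (simp add: psi_def)

lemma psi_eq_0: "t \<le> 0 \<Longrightarrow> psi k t = 0"
  by (simp add: psi_def)

lemma psi_tendsto_0: "(psi k \<longlongrightarrow> 0) (at_right 0)"
proof -
  have "((\<lambda>t::real. inverse t ^ k / exp (inverse t)) \<longlongrightarrow> 0) (at_right 0)"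
    by (rule filterlim_compose[OF tendsto_power_div_exp_0 filterlim_inverse_at_top_right])
  moreover have "\<forall>\<^sub>F t in at_right 0. inverse t ^ k / exp (inverse t) = psi k t"
    unfolding eventually_at_right_field
    by (rule exI[of _ 1]) (simp add: psi_def exp_minus field_simps)
  ultimately show ?thesis by (rule Lim_transform_eventually)
qed

text \<open>The family is closed under differentiation up to linear combinations, so one
  differentiability statement for all \<open>k\<close> yields derivatives of every order. At \<open>0\<close> the right
  difference quotient of \<open>psi k\<close> is \<open>psi (k + 1)\<close>, which tends to \<open>0\<close>.\<close>

lemma DERIV_psi: "(psi k has_real_derivative psi (k + 2) t - real k * psi (k + 1) t) (at t)"
proof -
  consider "t > 0" | "t < 0" | "t = 0" by linarith
  then show ?thesis
  proof cases
    case 1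
    have "((\<lambda>t. exp (- inverse t) * inverse t ^ k) has_real_derivative
        exp (- inverse t) * (inverse t)\<^sup>2 * inverse t ^ k
          - exp (- inverse t) * (real k * inverse t ^ (k - 1) * (inverse t)\<^sup>2)) (at t)"
      using 1 by (auto intro!: derivative_eq_intros simp: power2_eq_square algebra_simps)
    also have "exp (- inverse t) * (inverse t)\<^sup>2 * inverse t ^ k
          - exp (- inverse t) * (real k * inverse t ^ (k - 1) * (inverse t)\<^sup>2)
        = psi (k + 2) t - real k * psi (k + 1) t"
      using 1 by (cases k) (simp_all add: psi_def field_simps power2_eq_square)
    finally show ?thesis
      by (rule has_field_derivative_transform_within_open[where S="{0<..}"])
        (use 1 in \<open>auto simp: psi_def field_simps\<close>)
  next
    case 2
    have "((\<lambda>t. 0) has_real_derivative psi (k + 2) t - real k * psi (k + 1) t) (at t)"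
      using 2 by (simp add: psi_eq_0)
    then show ?thesis
      by (rule has_field_derivative_transform_within_open[where S="{..<0}"])
        (use 2 in \<open>auto simp: psi_eq_0\<close>)
  next
    case 3
    have "((\<lambda>h. psi k h / h) \<longlongrightarrow> 0) (at 0)"
    proof (rule filterlim_split_at)
      have "\<forall>\<^sub>F h in at_left 0. 0 = psi k h / h"
        unfolding eventually_at_left_field by (rule exI[of _ "-1"]) (simp add: psi_eq_0)
      then show "((\<lambda>h. psi k h / h) \<longlongrightarrow> 0) (at_left 0)"
        by (rule Lim_transform_eventually[OF tendsto_const])
      have "\<forall>\<^sub>F h in at_right 0. psi (Suc k) h = psi k h / h"
        unfolding eventually_at_right_field by (rule exI[of _ 1]) (simp add: psi_def)
      then show "((\<lambda>h. psi k h / h) \<longlongrightarrow> 0) (at_right 0)"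
        by (rule Lim_transform_eventually[OF psi_tendsto_0])
    qed
    then show ?thesis by (simp add: 3 DERIV_def psi_eq_0)
  qed
qed

lemma continuous_on_psi: "continuous_on S (psi k)"
  by (rule continuous_at_imp_continuous_on) (use DERIV_psi DERIV_isCont in blast)

text \<open>This algebra contains the bumps centred at \<open>a\<close> and is closed under partial derivatives,
  because the derivative of each \<open>psi k\<close> is a combination of other members of the family.\<close>

inductive_set bump_algebra :: "real \<Rightarrow> real ^ 'd::finite \<Rightarrow> (real ^ 'd \<Rightarrow> real) set"
  for r :: real and a :: "real ^ 'd" where
  const: "(\<lambda>x. c) \<in> bump_algebra r a"
| coord: "(\<lambda>x. x $ s) \<in> bump_algebra r a"
| psi: "(\<lambda>x. psi k (r - (x - a) \<bullet> (x - a))) \<in> bump_algebra r a"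
| add: "f \<in> bump_algebra r a \<Longrightarrow> g \<in> bump_algebra r a \<Longrightarrow> (\<lambda>x. f x + g x) \<in> bump_algebra r a"
| mult: "f \<in> bump_algebra r a \<Longrightarrow> g \<in> bump_algebra r a \<Longrightarrow> (\<lambda>x. f x * g x) \<in> bump_algebra r a"

lemma pd_eqI: "(f has_derivative D) (at x) \<Longrightarrow> pd s f x = D (axis s 1)"
  unfolding pd_def by (metis frechet_derivative_at)

lemma has_derivative_psi_ball:
  "((\<lambda>x. psi k (r - (x - a) \<bullet> (x - a))) has_derivative
     (\<lambda>h. (psi (k + 2) (r - (x - a) \<bullet> (x - a)) - real k * psi (k + 1) (r - (x - a) \<bullet> (x - a))) * (-2 * ((x - a) \<bullet> h))))
     (at (x :: real ^ 'd))"
proof -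
  have 1: "((\<lambda>x. r - (x - a) \<bullet> (x - a)) has_derivative (\<lambda>h. -2 * ((x - a) \<bullet> h))) (at x)"
    by (auto intro!: derivative_eq_intros simp: inner_commute)
  have 2: "(psi k has_derivative (*) (psi (k + 2) t - real k * psi (k + 1) t)) (at t)" for t
    using DERIV_psi[of k t] by (simp add: has_field_derivative_def)
  show ?thesis
    using diff_chain_at[OF 1 2] by (simp add: o_def)
qed

lemma bump_algebra_derivative:
  assumes "f \<in> bump_algebra r a"
  shows "(\<forall>x. f differentiable (at x)) \<and> pd s f \<in> bump_algebra r a"
  using assms
proof induction
  case (const c)
  have "pd s (\<lambda>x. c) = (\<lambda>x :: real ^ 'a. 0)"
    by (rule ext, rule pd_eqI) (rule has_derivative_const)
  then show ?case by (simp add: bump_algebra.const)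
next
  case (coord i)
  have *: "((\<lambda>x. x $ i) has_derivative (\<lambda>x. x $ i)) (at x)" for x :: "real ^ 'a"
    by (rule bounded_linear_imp_has_derivative) (rule bounded_linear_vec_nth)
  then have "pd s (\<lambda>x. x $ i) = (\<lambda>x :: real ^ 'a. axis s 1 $ i)"
    by (intro ext pd_eqI)
  with * show ?case by (auto simp: bump_algebra.const differentiable_def)
next
  case (psi k)
  let ?q = "\<lambda>x. r - (x - a) \<bullet> (x - a)"
  have "pd s (\<lambda>x. psi k (?q x)) = (\<lambda>x. (psi (k + 2) (?q x) + (- real k) * psi (k + 1) (?q x)) * (-2 * (x $ s + (- a $ s))))"
    by (rule ext, subst pd_eqI[OF has_derivative_psi_ball]) (simp add: inner_axis)
  moreover have "\<dots> \<in> bump_algebra r a" by (intro bump_algebra.intros)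
  moreover have "(\<lambda>x. psi k (?q x)) differentiable (at x)" for x
    unfolding differentiable_def using has_derivative_psi_ball by blast
  ultimately show ?case by simp
next
  case (add f g)
  then have *: "((\<lambda>x. f x + g x) has_derivative (\<lambda>h. frechet_derivative f (at x) h + frechet_derivative g (at x) h)) (at x)" for x
    by (intro has_derivative_add) (auto simp: frechet_derivative_works[symmetric])
  then have "pd s (\<lambda>x. f x + g x) = (\<lambda>x. pd s f x + pd s g x)"
    by (intro ext, subst pd_eqI[OF *]) (simp add: pd_def)
  with * add show ?case by (auto simp: differentiable_def intro: bump_algebra.add)
next
  case (mult f g)
  then have *: "((\<lambda>x. f x * g x) has_derivative (\<lambda>h. f x * frechet_derivative g (at x) h + frechet_derivative f (at x) h * g x)) (at x)" for x
    by (intro has_derivative_mult) (auto simp: frechet_derivative_works[symmetric])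
  then have "pd s (\<lambda>x. f x * g x) = (\<lambda>x. f x * pd s g x + pd s f x * g x)"
    by (intro ext, subst pd_eqI[OF *]) (simp add: pd_def)
  with * mult show ?case by (auto simp: differentiable_def intro: bump_algebra.intros)
qed

text \<open>Smoothness asks for differentiability of all iterated partial derivatives; it is enough to
  exhibit a set of differentiable functions that is closed under partial derivatives.\<close>

lemma bump_algebra_smooth:
  assumes "f \<in> bump_algebra r a"
  shows "smooth f"
proof -
  have "foldr pd ss f \<in> bump_algebra r a" for ss
    using assms by (induction ss) (auto simp: bump_algebra_derivative)
  then show ?thesis unfolding smooth_def using bump_algebra_derivative by blast
qed

definition bump :: "real \<Rightarrow> real ^ 'd::finite \<Rightarrow> real" where
  "bump \<delta> z = psi 0 (\<delta>\<^sup>2 - z \<bullet> z)"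

text \<open>The partial derivative of the bump in direction \<open>s\<close>: differentiating \<open>\<delta>\<^sup>2 - |z|\<^sup>2\<close> gives
  \<open>- 2 z\<^sub>s\<close>, and \<open>psi 2\<close> is the derivative of \<open>psi 0\<close>.\<close>

definition dbump :: "real \<Rightarrow> 'd \<Rightarrow> real ^ 'd::finite \<Rightarrow> real" where
  "dbump \<delta> s z = -2 * z $ s * psi 2 (\<delta>\<^sup>2 - z \<bullet> z)"

lemma bump_even: "bump \<delta> (- z) = bump \<delta> z"
  by (simp add: bump_def)

lemma dbump_odd: "dbump \<delta> s (- z) = - dbump \<delta> s z"
  by (simp add: dbump_def)

lemma norm_lt_iff_inner: "0 < \<delta> \<Longrightarrow> norm z < \<delta> \<longleftrightarrow> 0 < \<delta>\<^sup>2 - z \<bullet> z"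
  by (metis abs_of_pos diff_gt_0_iff_gt norm_lt_square power2_norm_eq_inner)

lemma bump_pos: "norm z < \<delta> \<Longrightarrow> 0 < bump \<delta> z"
  unfolding bump_def by (rule psi_pos) (metis norm_lt_iff_inner norm_ge_zero le_less_trans)

lemma bump_eq_0: "0 < \<delta> \<Longrightarrow> \<delta> \<le> norm z \<Longrightarrow> bump \<delta> z = 0"
  unfolding bump_def by (rule psi_eq_0) (metis norm_lt_iff_inner not_less)

lemma dbump_eq_0: "0 < \<delta> \<Longrightarrow> \<delta> \<le> norm z \<Longrightarrow> dbump \<delta> s z = 0"
  unfolding dbump_def by (metis norm_lt_iff_inner not_less psi_eq_0 mult_zero_right)

lemma continuous_on_bump: "continuous_on S (bump \<delta>)"
  unfolding bump_def[abs_def]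
  by (rule continuous_on_compose2[OF continuous_on_psi[of UNIV] _ subset_UNIV]) (intro continuous_intros)

lemma continuous_on_dbump: "continuous_on S (dbump \<delta> s)"
  unfolding dbump_def[abs_def]
  by (intro continuous_intros continuous_on_compose2[OF continuous_on_psi[of UNIV] _ subset_UNIV])

lemma pd_bump: "pd s (\<lambda>y. bump \<delta> (y - a)) = (\<lambda>y. dbump \<delta> s (y - a))"
  unfolding bump_def[abs_def] dbump_def[abs_def]
  by (rule ext, subst pd_eqI[OF has_derivative_psi_ball]) (simp add: inner_axis numeral_2_eq_2)

text \<open>Differentiating the explicit formula gives an expression symmetric in \<open>n\<close> and \<open>j\<close>. Testing
  with bumps carries this symmetry over to weak second derivatives.\<close>

lemma pd_dbump_commute:
  "pd n (\<lambda>y. dbump \<delta> j (y - a)) = pd j (\<lambda>y. dbump \<delta> n (y - a))"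
proof
  fix x :: "real ^ 'a"
  let ?q = "\<lambda>x. \<delta>\<^sup>2 - (x - a) \<bullet> (x - a)"
  have *: "pd n (\<lambda>y. dbump \<delta> j (y - a)) x
    = - 2 * (x $ j - a $ j) * ((psi 4 (?q x) - 2 * psi 3 (?q x)) * (- 2 * (x $ n - a $ n))) - 2 * axis n 1 $ j * psi 2 (?q x)"
    for n j
  proof -
    have "((\<lambda>x. -2 * (x - a) $ j) has_derivative (\<lambda>h. -2 * h $ j)) (at x)"
      by (auto intro!: derivative_eq_intros bounded_linear_imp_has_derivative bounded_linear_vec_nth)
    from has_derivative_mult[OF this has_derivative_psi_ball[of 2 "\<delta>\<^sup>2" a x]]
    show ?thesis
      unfolding dbump_def by (subst pd_eqI, assumption) (simp add: inner_axis)
  qed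
  have axis: "axis n (1::real) $ j = axis j 1 $ n" by (simp add: axis_def)
  show "pd n (\<lambda>y. dbump \<delta> j (y - a)) x = pd j (\<lambda>y. dbump \<delta> n (y - a)) x"
    unfolding *[of n j] *[of j n] axis by (simp only: mult_ac)
qed

lemma test_functionI:
  assumes "smooth f" "\<And>x. f x \<noteq> 0 \<Longrightarrow> x \<in> cball a \<delta>"
  shows "f \<in> test_functions UNIV"
proof -
  have "bounded {x. f x \<noteq> 0}"
    by (rule bounded_subset[OF bounded_cball]) (use assms(2) in blast)
  with assms(1) show ?thesis by (simp add: test_functions_def)
qed

lemma smooth_bump: "smooth (\<lambda>y. bump \<delta> (y - a))"
  unfolding bump_def by (rule bump_algebra_smooth) (rule bump_algebra.psi)

lemma bump_test_function: "0 < \<delta> \<Longrightarrow> (\<lambda>y. bump \<delta> (y - a)) \<in> test_functions UNIV"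
  by (rule test_functionI[of _ a \<delta>, OF smooth_bump])
    (use bump_eq_0 in \<open>force simp: dist_norm norm_minus_commute\<close>)

lemma dbump_test_function: "0 < \<delta> \<Longrightarrow> (\<lambda>y. dbump \<delta> s (y - a)) \<in> test_functions UNIV"
  by (rule test_functionI[of _ a \<delta>, OF smooth_pd[OF smooth_bump, unfolded pd_bump]])
    (use dbump_eq_0 in \<open>force simp: dist_norm norm_minus_commute\<close>)

section \<open>Correlations of square integrable functions\<close>

lemma integral_lborel_shift:
  fixes f :: "'a::euclidean_space \<Rightarrow> real"
  assumes "f \<in> borel_measurable borel"
  shows "(LINT x|lborel. f (c + x)) = (LINT x|lborel. f x)"
  using integral_distr[of "(+) c" lborel borel f] assms by (simp add: lborel_distr_plus)

lemma integrable_lborel_shift: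
  fixes f :: "'a::euclidean_space \<Rightarrow> real"
  assumes "integrable lborel f"
  shows "integrable lborel (\<lambda>x. f (c + x))"
  using integrable_distr[of "(+) c" lborel borel f] assms by (simp add: lborel_distr_plus)

lemma integral_lborel_reflect:
  fixes f :: "'a::euclidean_space \<Rightarrow> real"
  assumes "f \<in> borel_measurable borel"
  shows "(LINT x|lborel. f (- x)) = (LINT x|lborel. f x)"
proof -
  have "distr lborel borel uminus = (lborel :: 'a measure)"
    using lborel_affine[of "-1" "0 :: 'a"] by (simp add: density_1)
  then show ?thesis using integral_distr[of uminus lborel borel f] assms by simp
qed

lemma sqint_lborel_shift:
  fixes f :: "'a::euclidean_space \<Rightarrow> real"
  assumes "sqint lborel f"
  shows "sqint lborel (\<lambda>x. f (c + x))"
proof -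
  have [measurable]: "f \<in> borel_measurable borel" using assms by (simp add: sqint_def)
  have "(\<lambda>x. f (c + x)) \<in> borel_measurable lborel" by measurable
  then show ?thesis
    using assms integrable_lborel_shift[of "\<lambda>x. (f x)\<^sup>2" c] by (simp add: sqint_def)
qed

lemma sqint_indicator_ball: "sqint lborel (\<lambda>x::'a::euclidean_space. B * indicator (cball 0 R) x)"
proof -
  have "integrable lborel (\<lambda>x::'a. B\<^sup>2 * indicator (cball 0 R) x)"
    using emeasure_lborel_cball_finite[of 0 R] by (intro integrable_mult_right integrable_real_indicator) (auto simp: less_top[symmetric])
  moreover have "(\<lambda>x::'a. B * indicator (cball 0 R) x) \<in> borel_measurable lborel"
    by (intro borel_measurable_times borel_measurable_const borel_measurable_indicator) simp
  moreover have "(\<lambda>x::'a. (B * indicator (cball 0 R) x)\<^sup>2) = (\<lambda>x. B\<^sup>2 * indicator (cball 0 R) x)"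
    by (auto simp: fun_eq_iff indicator_def)
  ultimately show ?thesis by (simp add: sqint_def)
qed

text \<open>Truncation of both the values and the domain at level \<open>n\<close>, with \<open>f\<^sup>2\<close> as dominating
  function.\<close>

lemma sqint_cutoff_approx:
  fixes f :: "'a::euclidean_space \<Rightarrow> real"
  assumes f: "sqint lborel f" and e: "0 < e"
  obtains F M where "F \<in> borel_measurable borel" "\<And>x. \<bar>F x\<bar> \<le> M" "\<And>x. M < norm x \<Longrightarrow> F x = 0" "0 \<le> M"
    "(LINT x|lborel. (f x - F x)\<^sup>2) < e"
proof -
  have [measurable]: "f \<in> borel_measurable borel" using f by (simp add: sqint_def)
  define F where "F n x = (if norm x \<le> real n then max (- real n) (min (real n) (f x)) else 0)" for n x
  have [measurable]: "F n \<in> borel_measurable borel" for n unfolding F_def[abs_def] by measurable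
  have "(\<lambda>n. LINT x|lborel. (f x - F n x)\<^sup>2) \<longlonglongrightarrow> (LINT x|(lborel :: 'a measure). 0 :: real)"
  proof (rule integral_dominated_convergence[where w="\<lambda>x. (f x)\<^sup>2"])
    show "integrable lborel (\<lambda>x. (f x)\<^sup>2)" using f by (simp add: sqint_def)
    show "AE x in lborel. (\<lambda>n. (f x - F n x)\<^sup>2) \<longlonglongrightarrow> 0"
    proof (rule AE_I2)
      fix x
      have "\<forall>\<^sub>F n in sequentially. (f x - F n x)\<^sup>2 = 0"
      proof (rule eventually_sequentiallyI[of "nat \<lceil>max (norm x) \<bar>f x\<bar>\<rceil>"])
        fix n assume "nat \<lceil>max (norm x) \<bar>f x\<bar>\<rceil> \<le> n"
        then have "norm x \<le> real n" "\<bar>f x\<bar> \<le> real n" by linarith+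
        then show "(f x - F n x)\<^sup>2 = 0" by (simp add: F_def)
      qed
      then show "(\<lambda>n. (f x - F n x)\<^sup>2) \<longlonglongrightarrow> 0" by (rule tendsto_eventually)
    qed
    show "AE x in lborel. norm ((f x - F n x)\<^sup>2) \<le> (f x)\<^sup>2" for n
    proof (rule AE_I2)
      fix x
      have "\<bar>f x - F n x\<bar> \<le> \<bar>f x\<bar>" by (auto simp: F_def)
      then show "norm ((f x - F n x)\<^sup>2) \<le> (f x)\<^sup>2" by (simp add: abs_le_square_iff)
    qed
  qed measurable
  then have "\<forall>\<^sub>F n in sequentially. (LINT x|lborel. (f x - F n x)\<^sup>2) < e"
    by (rule order_tendstoD(2)) (use e in simp)
  then obtain n where n: "(LINT x|lborel. (f x - F n x)\<^sup>2) < e"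
    using eventually_happens'[OF sequentially_bot] by blast
  show ?thesis
    by (rule that[of "F n" "real n"]) (use n in \<open>auto simp: F_def\<close>)
qed

text \<open>Continuous functions of compact support are dense in \<open>L\<^sup>2\<close>: a bounded function of bounded
  support is an almost everywhere limit of continuous functions, which may be clipped to the
  same bound and multiplied by a continuous cutoff, and then convergence is dominated.\<close>

lemma sqint_continuous_approx:
  fixes f :: "'a::euclidean_space \<Rightarrow> real"
  assumes f: "sqint lborel f" and e: "0 < e"
  obtains h B R where "continuous_on UNIV h" "\<And>x. \<bar>h x\<bar> \<le> B" "\<And>x. R < norm x \<Longrightarrow> h x = 0"
    "sqint lborel h" "(LINT x|lborel. (f x - h x)\<^sup>2) < e"
proof -
  obtain F M where F[measurable]: "F \<in> borel_measurable borel" and M: "\<And>x. \<bar>F x\<bar> \<le> M" "\<And>x. M < norm x \<Longrightarrow> F x = 0" "0 \<le> M"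
    and fF: "(LINT x|lborel. (f x - F x)\<^sup>2) < e / 4"
    using sqint_cutoff_approx[OF f, of "e / 4"] e by auto
  have "F measurable_on UNIV"
    by (intro lebesgue_measurable_imp_measurable_on_real measurable_completion) auto
  then obtain N g where N: "negligible N" and g: "\<And>n. continuous_on UNIV (g n)"
    and lim: "\<And>x. x \<notin> N \<Longrightarrow> (\<lambda>n. g n x) \<longlonglongrightarrow> F x"
    unfolding measurable_on_def by auto
  \<comment> \<open>Clipped to the range of \<open>F\<close> and cut off linearly between the radii \<open>M\<close> and \<open>M + 1\<close>.\<close>
  define h where "h n x = max (- M) (min M (g n x)) * max 0 (min 1 (M + 1 - norm x))" for n x
  have h: "continuous_on UNIV (h n)" for n
    unfolding h_def by (intro continuous_intros g)
  have [measurable]: "h n \<in> borel_measurable borel" for n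
    by (rule borel_measurable_continuous_onI[OF h])
  have hM: "\<bar>h n x\<bar> \<le> M * 1" for n x
    unfolding h_def abs_mult using M(3) by (intro mult_mono) auto
  have h0: "h n x = 0" if "M + 1 < norm x" for n x
    using that by (simp add: h_def)
  have FB: "\<bar>F x\<bar> \<le> M * indicator (cball 0 (M + 1)) x" for x
    using M(1)[of x] M(2)[of x] M(3) by (auto simp: indicator_def)
  have hB: "\<bar>h n x\<bar> \<le> M * indicator (cball 0 (M + 1)) x" for n x
    using hM[of n x] h0[of x n] M(3) by (auto simp: indicator_def)
  have ind: "integrable lborel (\<lambda>x::'a. (M * indicator (cball 0 (M + 1)) x)\<^sup>2)"
    using sqint_indicator_ball[of M "M + 1", where 'a='a] by (simp add: sqint_def)
  have sq: "sqint lborel u" if [measurable]: "u \<in> borel_measurable borel"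
    and "\<And>x. \<bar>u x\<bar> \<le> M * indicator (cball 0 (M + 1)) x" for u :: "'a \<Rightarrow> real"
    unfolding sqint_def
  proof (intro conjI)
    show "integrable lborel (\<lambda>x. (u x)\<^sup>2)"
    proof (rule Bochner_Integration.integrable_bound[OF ind])
      show "AE x in lborel. norm ((u x)\<^sup>2) \<le> norm ((M * indicator (cball 0 (M + 1)) x)\<^sup>2)"
        using that(2) M(3) by (intro AE_I2) (simp add: abs_le_square_iff[symmetric] abs_mult)
    qed measurable
  qed measurable
  have sqF: "sqint lborel F" by (rule sq[of F]) (rule F, rule FB)
  have sqh: "sqint lborel (h n)" for n by (rule sq[of "h n"]) (measurable, rule hB)
  have "(\<lambda>n. LINT x|lborel. (F x - h n x)\<^sup>2) \<longlonglongrightarrow> (LINT x|(lborel :: 'a measure). 0 :: real)"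
  proof (rule integral_dominated_convergence[where w="\<lambda>x. (2 * M * indicator (cball 0 (M + 1)) x)\<^sup>2"])
    show "integrable lborel (\<lambda>x::'a. (2 * M * indicator (cball 0 (M + 1)) x)\<^sup>2)"
      using sqint_indicator_ball[of "2 * M" "M + 1", where 'a='a] by (simp add: sqint_def)
    have "AE x in lebesgue. x \<notin> N" using N by (intro AE_not_in) (simp add: negligible_iff_null_sets)
    then have "AE x in lborel. x \<notin> N" by (simp only: AE_completion_iff)
    then show "AE x in lborel. (\<lambda>n. (F x - h n x)\<^sup>2) \<longlonglongrightarrow> 0"
    proof eventually_elim
      case (elim x)
      have "(\<lambda>n. h n x) \<longlonglongrightarrow> max (- M) (min M (F x)) * max 0 (min 1 (M + 1 - norm x))"
        unfolding h_def by (intro tendsto_intros lim elim)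
      moreover have "max (- M) (min M (F x)) * max 0 (min 1 (M + 1 - norm x)) = F x"
        using M(1)[of x] M(2)[of x] by (cases "M < norm x") auto
      ultimately have "(\<lambda>n. (F x - h n x)\<^sup>2) \<longlonglongrightarrow> (F x - F x)\<^sup>2"
        by (intro tendsto_intros) simp
      then show ?case by simp
    qed
    show "AE x in lborel. norm ((F x - h n x)\<^sup>2) \<le> (2 * M * indicator (cball 0 (M + 1)) x)\<^sup>2" for n
    proof (rule AE_I2)
      fix x
      have "\<bar>F x - h n x\<bar> \<le> \<bar>2 * M * indicator (cball 0 (M + 1)) x\<bar>"
        using FB[of x] hB[of n x] M(3) by (auto simp: abs_mult indicator_def)
      then show "norm ((F x - h n x)\<^sup>2) \<le> (2 * M * indicator (cball 0 (M + 1)) x)\<^sup>2"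
        by (simp add: abs_le_square_iff)
    qed
  qed measurable
  then have "\<forall>\<^sub>F n in sequentially. (LINT x|lborel. (F x - h n x)\<^sup>2) < e / 4"
    by (rule order_tendstoD(2)) (use e in simp)
  then obtain n where n: "(LINT x|lborel. (F x - h n x)\<^sup>2) < e / 4"
    using eventually_happens'[OF sequentially_bot] by blast
  have "(LINT x|lborel. (f x - h n x)\<^sup>2) \<le> (LINT x|lborel. 2 * (f x - F x)\<^sup>2 + 2 * (F x - h n x)\<^sup>2)"
  proof (rule integral_mono)
    show "integrable lborel (\<lambda>x. (f x - h n x)\<^sup>2)"
      using sqint_diff[OF f sqh[of n]] by (simp add: sqint_def)
    show "integrable lborel (\<lambda>x. 2 * (f x - F x)\<^sup>2 + 2 * (F x - h n x)\<^sup>2)"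
      using sqint_diff[OF f sqF] sqint_diff[OF sqF sqh[of n]] by (simp add: sqint_def)
    fix x
    have "0 \<le> ((f x - F x) - (F x - h n x))\<^sup>2" by simp
    then show "(f x - h n x)\<^sup>2 \<le> 2 * (f x - F x)\<^sup>2 + 2 * (F x - h n x)\<^sup>2"
      by (simp add: power2_eq_square algebra_simps)
  qed
  also have "\<dots> = 2 * (LINT x|lborel. (f x - F x)\<^sup>2) + 2 * (LINT x|lborel. (F x - h n x)\<^sup>2)"
    using sqint_diff[OF f sqF] sqint_diff[OF sqF sqh[of n]] by (simp add: sqint_def)
  also have "\<dots> < e" using fF n by simp
  finally show ?thesis
    using h[of n] hM[of n] h0[of _ n] sqh[of n] by (intro that[of "h n" "M * 1" "M + 1"])
qed

definition corr :: "('a::euclidean_space \<Rightarrow> real) \<Rightarrow> ('a \<Rightarrow> real) \<Rightarrow> 'a \<Rightarrow> real" where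
  "corr g f z = (LINT x|lborel. g x * f (z + x))"

lemma corr_reflect:
  assumes "f \<in> borel_measurable borel" "g \<in> borel_measurable borel"
  shows "corr g f (- z) = corr f g z"
proof -
  note [measurable] = assms
  have "corr f g z = (LINT x|lborel. f (- z + (z + x)) * g (z + x))" by (simp add: corr_def)
  also have "\<dots> = (LINT x|lborel. f (- z + x) * g x)"
    by (rule integral_lborel_shift[of "\<lambda>x. f (- z + x) * g x"]) measurable
  finally show ?thesis by (simp add: corr_def mult.commute)
qed

text \<open>For continuous \<open>h\<close> of compact support the integrand converges pointwise as the shift
  converges, dominated by a multiple of \<open>|g|\<close> on a fixed ball.\<close>

lemma continuous_corr_compact:
  fixes h :: "'a::euclidean_space \<Rightarrow> real"
  assumes g: "sqint lborel g" and h: "continuous_on UNIV h" "\<And>x. \<bar>h x\<bar> \<le> B" "\<And>x. R < norm x \<Longrightarrow> h x = 0"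
  shows "continuous (at z) (corr g h)"
  unfolding continuous_at_sequentially
proof (intro allI impI)
  fix u assume u: "u \<longlonglongrightarrow> z"
  have [measurable]: "g \<in> borel_measurable borel" using g by (simp add: sqint_def)
  have [measurable]: "h \<in> borel_measurable borel" by (rule borel_measurable_continuous_onI[OF h(1)])
  obtain K where K: "\<And>n. norm (u n) \<le> K"
    using convergent_imp_bounded[OF u] by (auto simp: bounded_iff)
  have "0 \<le> B" using h(2)[of 0] by linarith
  show "(corr g h \<circ> u) \<longlonglongrightarrow> corr g h z"
    unfolding o_def corr_def
  proof (rule integral_dominated_convergence[where w="\<lambda>x. \<bar>g x * (B * indicator (cball 0 (R + K)) x)\<bar>"])
    show "integrable lborel (\<lambda>x. \<bar>g x * (B * indicator (cball 0 (R + K)) x)\<bar>)"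
      by (intro integrable_abs sqint_integrable_mult g sqint_indicator_ball)
    show "AE x in lborel. (\<lambda>n. g x * h (u n + x)) \<longlonglongrightarrow> g x * h (z + x)"
    proof (rule AE_I2)
      fix x
      have "isCont h (z + x)" using h(1) by (simp add: continuous_on_eq_continuous_at)
      then have "(\<lambda>n. h (u n + x)) \<longlonglongrightarrow> h (z + x)"
        by (rule isCont_tendsto_compose) (intro tendsto_intros u)
      then show "(\<lambda>n. g x * h (u n + x)) \<longlonglongrightarrow> g x * h (z + x)" by (intro tendsto_intros)
    qed
    show "AE x in lborel. norm (g x * h (u n + x)) \<le> \<bar>g x * (B * indicator (cball 0 (R + K)) x)\<bar>" for n
    proof (rule AE_I2)
      fix x
      have "\<bar>h (u n + x)\<bar> \<le> B * indicator (cball 0 (R + K)) x"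
      proof (cases "R < norm (u n + x)")
        case True
        then show ?thesis using h(3) \<open>0 \<le> B\<close> by simp
      next
        case False
        have "norm x \<le> norm (u n + x) + norm (u n)" by (metis add_diff_cancel_left' norm_triangle_ineq4)
        with False K[of n] h(2) show ?thesis by simp
      qed
      then show "norm (g x * h (u n + x)) \<le> \<bar>g x * (B * indicator (cball 0 (R + K)) x)\<bar>"
        using \<open>0 \<le> B\<close> by (simp add: abs_mult mult_left_mono)
    qed
  qed measurable
qed

text \<open>By Cauchy-Schwarz and translation invariance, replacing \<open>f\<close> by an \<open>L\<^sup>2\<close> approximation
  changes the correlation uniformly little. Hence it is a uniform limit of the continuous
  correlations with continuous functions of compact support.\<close>

lemma continuous_on_corr:
  fixes f :: "'a::euclidean_space \<Rightarrow> real"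
  assumes g: "sqint lborel g" and f: "sqint lborel f"
  shows "continuous_on UNIV (corr g f)"
  unfolding continuous_on_iff
proof (intro ballI allI impI)
  fix z :: 'a and e :: real assume e: "0 < e"
  define G where "G = (LINT x|lborel. (g x)\<^sup>2)"
  have G: "0 \<le> G" by (simp add: G_def integral_nonneg_AE)
  have "0 < (e / 3)\<^sup>2 / (G + 1)" using e G by simp
  then obtain h B R where h: "continuous_on UNIV h" "\<And>x. \<bar>h x\<bar> \<le> B" "\<And>x. R < norm x \<Longrightarrow> h x = 0"
    "sqint lborel h" and fh: "(LINT x|lborel. (f x - h x)\<^sup>2) < (e / 3)\<^sup>2 / (G + 1)"
    using sqint_continuous_approx[OF f] by blast
  have close: "\<bar>corr g f y - corr g h y\<bar> < e / 3" for y
  proof -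
    have d: "sqint lborel (\<lambda>x. f (y + x) - h (y + x))"
      by (intro sqint_diff sqint_lborel_shift f h(4))
    have [measurable]: "f \<in> borel_measurable borel" "h \<in> borel_measurable borel"
      using f h(4) by (auto simp: sqint_def)
    have "corr g f y - corr g h y = (LINT x|lborel. g x * f (y + x) - g x * h (y + x))"
      unfolding corr_def
      by (intro Bochner_Integration.integral_diff[symmetric] sqint_integrable_mult sqint_lborel_shift f g h(4))
    then have "(corr g f y - corr g h y)\<^sup>2 = (LINT x|lborel. g x * (f (y + x) - h (y + x)))\<^sup>2"
      by (simp add: right_diff_distrib)
    also have "\<dots> \<le> G * (LINT x|lborel. (f (y + x) - h (y + x))\<^sup>2)"
      unfolding G_def by (rule sqint_Cauchy_Schwarz[OF g d])
    also have "(LINT x|lborel. (f (y + x) - h (y + x))\<^sup>2) = (LINT x|lborel. (f x - h x)\<^sup>2)"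
      by (rule integral_lborel_shift[of "\<lambda>x. (f x - h x)\<^sup>2"]) measurable
    also have "G * (LINT x|lborel. (f x - h x)\<^sup>2) \<le> G * ((e / 3)\<^sup>2 / (G + 1))"
      using fh G by (intro mult_left_mono) auto
    also have "\<dots> < (e / 3)\<^sup>2" using G e by (simp add: field_simps)
    finally have "\<bar>corr g f y - corr g h y\<bar>\<^sup>2 < (e / 3)\<^sup>2" by simp
    then show ?thesis by (rule power2_less_imp_less) (use e in simp)
  qed
  have "continuous (at z) (corr g h)" by (rule continuous_corr_compact[OF g h(1-3)])
  then have "\<forall>e>0. \<exists>d>0. \<forall>y. dist y z < d \<longrightarrow> dist (corr g h y) (corr g h z) < e"
    by (simp only: continuous_at_eps_delta)
  moreover have "0 < e / 3" using e by simp
  ultimately obtain d where d: "d > 0" "\<And>y. dist y z < d \<Longrightarrow> dist (corr g h y) (corr g h z) < e / 3"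
    by blast
  show "\<exists>d>0. \<forall>y\<in>UNIV. dist y z < d \<longrightarrow> dist (corr g f y) (corr g f z) < e"
  proof (intro exI conjI ballI impI)
    fix y assume "dist y z < d"
    then have "\<bar>corr g h y - corr g h z\<bar> < e / 3" using d(2)[of y] by (simp add: dist_real_def)
    with close[of y] close[of z] show "dist (corr g f y) (corr g f z) < e"
      unfolding dist_real_def by linarith
  qed (rule d(1))
qed

lemma sqint_abs: "sqint M f \<Longrightarrow> sqint M (\<lambda>x. \<bar>f x\<bar>)"
  by (auto simp: sqint_def)

lemma integrable_continuous_compact_support:
  fixes f :: "'a::euclidean_space \<Rightarrow> real"
  assumes "continuous_on UNIV f" "\<And>x. R < norm x \<Longrightarrow> f x = 0"
  shows "integrable lborel f"
proof -
  have "integrable lborel (\<lambda>x. indicator (cball 0 R) x *\<^sub>R f x)"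
    by (intro borel_integrable_compact continuous_on_subset[OF assms(1)]) auto
  moreover have "(\<lambda>x. indicator (cball 0 R) x *\<^sub>R f x) = f"
    using assms(2) by (auto simp: fun_eq_iff indicator_def)
  ultimately show ?thesis by simp
qed

text \<open>Fubini followed by the substitution \<open>y = x + z\<close>. When \<open>k\<close> is a bump, the inner integral on
  the right tests \<open>f\<close> with the bump centred at \<open>x\<close>, which is where hypotheses on weak
  derivatives enter.\<close>

lemma integral_kernel_corr:
  fixes f g k :: "'a::euclidean_space \<Rightarrow> real"
  assumes f: "sqint lborel f" and g: "sqint lborel g"
    and k: "continuous_on UNIV k" "\<And>z. R < norm z \<Longrightarrow> k z = 0"
  shows "(LINT z|lborel. k z * corr g f z) = (LINT x|lborel. g x * (LINT y|lborel. f y * k (y - x)))"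
proof -
  have [measurable]: "f \<in> borel_measurable borel" "g \<in> borel_measurable borel"
    using f g by (auto simp: sqint_def)
  have [measurable]: "k \<in> borel_measurable borel" by (rule borel_measurable_continuous_onI[OF k(1)])
  let ?P = "\<lambda>z x. k z * (g x * f (z + x))"
  have "integrable (lborel \<Otimes>\<^sub>M lborel) (case_prod ?P)"
  proof (rule lborel_pair.Fubini_integrable)
    have "(\<lambda>z. LINT x|lborel. norm (case_prod ?P (z, x))) = (\<lambda>z. \<bar>k z\<bar> * corr (\<lambda>x. \<bar>g x\<bar>) (\<lambda>x. \<bar>f x\<bar>) z)"
      by (simp add: corr_def abs_mult)
    moreover have "integrable lborel (\<lambda>z. \<bar>k z\<bar> * corr (\<lambda>x. \<bar>g x\<bar>) (\<lambda>x. \<bar>f x\<bar>) z)"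
      by (rule integrable_continuous_compact_support[where R=R])
        (auto intro!: continuous_intros k continuous_on_corr sqint_abs f g)
    ultimately show "integrable lborel (\<lambda>z. LINT x|lborel. norm (case_prod ?P (z, x)))" by simp
    show "AE z in lborel. integrable lborel (\<lambda>x. case_prod ?P (z, x))"
      by (intro AE_I2) (simp add: sqint_integrable_mult sqint_lborel_shift f g)
  qed measurable
  from lborel_pair.Fubini_integral[OF this]
  have "(LINT z|lborel. k z * corr g f z) = (LINT x|lborel. LINT z|lborel. ?P z x)"
    by (simp add: corr_def)
  also have "\<dots> = (LINT x|lborel. g x * (LINT y|lborel. f y * k (y - x)))"
  proof (rule Bochner_Integration.integral_cong[OF refl])
    fix x
    have "(LINT z|lborel. ?P z x) = (LINT z|lborel. g x * (f (x + z) * k (x + z - x)))"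
      by (intro Bochner_Integration.integral_cong refl) (simp add: add.commute)
    also have "\<dots> = g x * (LINT z|lborel. f (x + z) * k (x + z - x))" by simp
    also have "(LINT z|lborel. f (x + z) * k (x + z - x)) = (LINT y|lborel. f y * k (y - x))"
      by (rule integral_lborel_shift[of "\<lambda>y. f y * k (y - x)"]) measurable
    finally show "(LINT z|lborel. ?P z x) = g x * (LINT y|lborel. f y * k (y - x))" .
  qed
  finally show ?thesis .
qed

text \<open>If \<open>\<phi> 0 > 0\<close> then, by continuity, \<open>\<phi>\<close> is positive on a ball around \<open>0\<close>, and the integral
  against a bump supported in that ball is positive.\<close>

lemma bump_integrals_determine_value:
  fixes \<phi> :: "real ^ 'd::finite \<Rightarrow> real"
  assumes \<phi>: "continuous_on UNIV \<phi>" and zero: "\<And>\<delta>. 0 < \<delta> \<Longrightarrow> (LINT z|lborel. bump \<delta> z * \<phi> z) = 0"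
  shows "\<phi> 0 = 0"
proof -
  have not_pos: "\<not> 0 < h 0" if h: "continuous_on UNIV h" and hz: "\<And>\<delta>. 0 < \<delta> \<Longrightarrow> (LINT z|lborel. bump \<delta> z * h z) = 0"
    for h :: "real ^ 'd \<Rightarrow> real"
  proof
    assume "0 < h 0"
    moreover have "\<forall>e>0. \<exists>d>0. \<forall>z. dist z 0 < d \<longrightarrow> dist (h z) (h 0) < e"
      using h unfolding continuous_on_eq_continuous_at[OF open_UNIV] continuous_at_eps_delta by blast
    ultimately obtain \<delta> where \<delta>: "0 < \<delta>" "\<And>z. dist z 0 < \<delta> \<Longrightarrow> dist (h z) (h 0) < h 0"
      by blast
    have pos: "0 < bump \<delta> z * h z" if "norm z < \<delta>" for z
      using \<delta>(2)[of z] that by (intro mult_pos_pos bump_pos) (auto simp: dist_real_def)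
    have int: "integrable lborel (\<lambda>z. bump \<delta> z * h z)"
      by (rule integrable_continuous_compact_support[where R=\<delta>])
        (auto intro!: continuous_intros continuous_on_bump h bump_eq_0 \<delta>)
    have "AE z in lborel. bump \<delta> z * h z = 0"
    proof -
      have "0 \<le> bump \<delta> z * h z" for z
        by (cases "norm z < \<delta>") (use pos[of z] bump_eq_0[OF \<delta>(1), of z] in auto)
      then show ?thesis
        using integral_nonneg_eq_0_iff_AE[OF int] hz[OF \<delta>(1)] by simp
    qed
    then have "AE z in lebesgue. bump \<delta> z * h z = 0" by (rule AE_completion)
    then have "AE z :: real ^ 'd in lebesgue. z \<notin> ball 0 \<delta>" by (rule eventually_mono) (use pos in force)
    then have "negligible (ball 0 \<delta> :: (real ^ 'd) set)"
      by (simp add: negligible_iff_null_sets AE_iff_null_sets)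
    then show False using \<delta>(1) open_not_negligible[of "ball 0 \<delta> :: (real ^ 'd) set"] by simp
  qed
  have "\<not> 0 < \<phi> 0" by (rule not_pos[OF \<phi> zero])
  moreover have "\<not> 0 < - \<phi> 0"
    by (rule not_pos[of "\<lambda>x. - \<phi> x", OF continuous_on_minus[OF \<phi>]]) (simp add: zero)
  ultimately show ?thesis by linarith
qed

text \<open>Orthogonality to all translated bumps makes the autocorrelation of \<open>f\<close> orthogonal to all
  centred bumps. Its value at \<open>0\<close>, the squared norm of \<open>f\<close>, is therefore zero.\<close>

lemma sqint_eq_0_if_orthogonal_to_bumps:
  fixes f :: "real ^ 'd::finite \<Rightarrow> real"
  assumes f: "sqint lborel f" and "\<And>\<delta> a. 0 < \<delta> \<Longrightarrow> (LINT y|lborel. f y * bump \<delta> (y - a)) = 0"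
  shows "AE x in lborel. f x = 0"
proof -
  have "(LINT z|lborel. bump \<delta> z * corr f f z) = 0" if "0 < \<delta>" for \<delta>
  proof -
    have "(LINT z|lborel. bump \<delta> z * corr f f z) = (LINT x|lborel. f x * (LINT y|lborel. f y * bump \<delta> (y - x)))"
      by (rule integral_kernel_corr[OF f f continuous_on_bump bump_eq_0[OF that less_imp_le]])
    then show ?thesis by (simp add: assms(2)[OF that])
  qed
  then have "corr f f 0 = 0"
    by (rule bump_integrals_determine_value[of "corr f f", OF continuous_on_corr[OF f f]])
  then have "(LINT x|lborel. (f x)\<^sup>2) = 0" by (simp add: corr_def power2_eq_square)
  then show ?thesis
    using f integral_nonneg_eq_0_iff_AE[of lborel "\<lambda>x. (f x)\<^sup>2"] by (simp add: sqint_def)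
qed

text \<open>Let \<open>\<rho>\<close> be a bump. Moving the derivative from \<open>f\<close> to \<open>\<rho>\<close> gives
  \<open>\<integral> \<rho> corr g f' = - \<integral> \<partial>\<rho> corr g f\<close>. The same for \<open>g\<close>, after the reflection \<open>z \<mapsto> -z\<close> that
  exchanges the two factors of a correlation, gives \<open>\<integral> \<rho> corr g' f = \<integral> \<partial>\<rho> corr g f\<close>, since \<open>\<rho>\<close>
  is even and \<open>\<partial>\<rho>\<close> odd. So the continuous function \<open>corr g f' + corr g' f\<close> integrates to zero
  against every \<open>\<rho>\<close> and vanishes at \<open>0\<close>.\<close>

lemma integral_by_parts_bump_derivative:
  fixes f f' g g' :: "real ^ 'd::finite \<Rightarrow> real"
  assumes sq: "sqint lborel f" "sqint lborel f'" "sqint lborel g" "sqint lborel g'"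
    and f': "\<And>\<delta> a. 0 < \<delta> \<Longrightarrow> (LINT y|lborel. f y * dbump \<delta> s (y - a)) = - (LINT y|lborel. f' y * bump \<delta> (y - a))"
    and g': "\<And>\<delta> a. 0 < \<delta> \<Longrightarrow> (LINT y|lborel. g y * dbump \<delta> s (y - a)) = - (LINT y|lborel. g' y * bump \<delta> (y - a))"
  shows "(LINT x|lborel. g x * f' x) = - (LINT x|lborel. g' x * f x)"
proof -
  have [measurable]: "f \<in> borel_measurable borel" "f' \<in> borel_measurable borel"
      "g \<in> borel_measurable borel" "g' \<in> borel_measurable borel"
    using sq by (auto simp: sqint_def)
  have transfer: "(LINT z|lborel. bump \<delta> z * corr w u' z) = - (LINT z|lborel. dbump \<delta> s z * corr w u z)"
    if "0 < \<delta>" "sqint lborel u" "sqint lborel u'" "sqint lborel w"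
      "\<And>a. (LINT y|lborel. u y * dbump \<delta> s (y - a)) = - (LINT y|lborel. u' y * bump \<delta> (y - a))"
    for \<delta> u u' w
  proof -
    have "(LINT z|lborel. bump \<delta> z * corr w u' z) = (LINT x|lborel. w x * (LINT y|lborel. u' y * bump \<delta> (y - x)))"
      by (rule integral_kernel_corr[OF that(3,4) continuous_on_bump bump_eq_0[OF that(1) less_imp_le]])
    also have "\<dots> = - (LINT x|lborel. w x * (LINT y|lborel. u y * dbump \<delta> s (y - x)))"
      by (simp add: that(5))
    also have "(LINT x|lborel. w x * (LINT y|lborel. u y * dbump \<delta> s (y - x))) = (LINT z|lborel. dbump \<delta> s z * corr w u z)"
      by (rule integral_kernel_corr[OF that(2,4) continuous_on_dbump dbump_eq_0[OF that(1) less_imp_le], symmetric])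
    finally show ?thesis .
  qed
  have meas: "corr w u \<in> borel_measurable borel" if "sqint lborel w" "sqint lborel u" for w u :: "real ^ 'd \<Rightarrow> real"
    by (rule borel_measurable_continuous_onI[OF continuous_on_corr[OF that]])
  have [measurable]: "bump \<delta> \<in> borel_measurable borel" "dbump \<delta> s \<in> borel_measurable borel" for \<delta> :: real
    by (auto intro: borel_measurable_continuous_onI continuous_on_bump continuous_on_dbump)
  have zero: "(LINT z|lborel. bump \<delta> z * (corr g f' z + corr g' f z)) = 0" if \<delta>: "0 < \<delta>" for \<delta>
  proof -
    have int: "integrable lborel (\<lambda>z. bump \<delta> z * corr w u z)"
      if "sqint lborel w" "sqint lborel u" for w u :: "real ^ 'd \<Rightarrow> real"
      by (rule integrable_continuous_compact_support[where R=\<delta>])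
        (intro continuous_on_mult continuous_on_bump continuous_on_corr that,
          simp add: bump_eq_0[OF \<delta> less_imp_le])
    note [measurable] = meas[OF sq(4) sq(1)] meas[OF sq(3) sq(1)]
    have "(LINT z|lborel. bump \<delta> z * corr g' f z) = (LINT z|lborel. bump \<delta> (- z) * corr g' f (- z))"
      by (rule integral_lborel_reflect[symmetric]) measurable
    also have "\<dots> = (LINT z|lborel. bump \<delta> z * corr f g' z)" by (simp add: bump_even corr_reflect)
    also have "\<dots> = - (LINT z|lborel. dbump \<delta> s z * corr f g z)"
      by (rule transfer[OF \<delta> sq(3) sq(4) sq(1) g'[OF \<delta>]])
    also have "\<dots> = (LINT z|lborel. dbump \<delta> s (- z) * corr g f (- z))"
      by (simp add: dbump_odd corr_reflect)
    also have "\<dots> = (LINT z|lborel. dbump \<delta> s z * corr g f z)"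
      by (rule integral_lborel_reflect) measurable
    finally have "(LINT z|lborel. bump \<delta> z * corr g' f z) = (LINT z|lborel. dbump \<delta> s z * corr g f z)" .
    moreover have "(LINT z|lborel. bump \<delta> z * corr g f' z) = - (LINT z|lborel. dbump \<delta> s z * corr g f z)"
      by (rule transfer[OF \<delta> sq(1) sq(2) sq(3) f'[OF \<delta>]])
    ultimately show ?thesis
      using int[OF sq(3) sq(2)] int[OF sq(4) sq(1)] by (simp add: distrib_left)
  qed
  have "corr g f' 0 + corr g' f 0 = 0"
    by (rule bump_integrals_determine_value[of "\<lambda>z. corr g f' z + corr g' f z"])
      (intro continuous_on_add continuous_on_corr sq, rule zero)
  then show ?thesis unfolding corr_def add_0 by linarith
qed

section \<open>Weak derivatives on the whole space\<close>

lemma integral_lebesgue_representative: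
  fixes u u' :: "'a::euclidean_space \<Rightarrow> real"
  assumes "u \<in> borel_measurable lebesgue" "u' \<in> borel_measurable borel" "AE x in lebesgue. u x = u' x"
  shows "(LINT x|lebesgue. u x) = (LINT x|lborel. u' x)"
proof -
  have "u' \<in> borel_measurable lborel" using assms(2) by simp
  then have "u' \<in> borel_measurable lebesgue" by (rule measurable_completion)
  with assms have "(LINT x|lebesgue. u x) = (LINT x|lebesgue. u' x)" by (intro integral_cong_AE)
  also have "\<dots> = (LINT x|lborel. u' x)" using assms(2) by (intro integral_completion) simp
  finally show ?thesis .
qed

text \<open>Product measures are formed from Borel measures, whereas functions in \<open>L\<^sup>2\<close> are only
  Lebesgue measurable; Fubini is applied to Borel representatives.\<close>

lemma sqint_borel_representative:
  fixes f :: "'a::euclidean_space \<Rightarrow> real"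
  assumes f: "sqint lebesgue f"
  obtains f' where "sqint lborel f'" "AE x in lebesgue. f x = f' x"
proof -
  have fm: "f \<in> borel_measurable lebesgue" and fi: "integrable lebesgue (\<lambda>x. (f x)\<^sup>2)"
    using f by (auto simp: sqint_def)
  obtain f' where f'[measurable]: "f' \<in> borel_measurable lborel" and ae: "AE x in lborel. f x = f' x"
    using completion_ex_borel_measurable_real[OF fm] by blast
  have ae': "AE x in lebesgue. f x = f' x" using ae by (rule AE_completion)
  have "f' \<in> borel_measurable lebesgue" using f' by (rule measurable_completion)
  then have sqm: "(\<lambda>x. (f' x)\<^sup>2) \<in> borel_measurable lebesgue" "(\<lambda>x. (f x)\<^sup>2) \<in> borel_measurable lebesgue"
    using fm by (auto intro: borel_measurable_power)
  have "integrable lebesgue (\<lambda>x. (f' x)\<^sup>2)"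
    using fi ae' by (subst integrable_cong_AE[OF sqm]) (auto elim!: eventually_mono)
  moreover have "(\<lambda>x. (f' x)\<^sup>2) \<in> borel_measurable lborel" by measurable
  ultimately have "integrable lborel (\<lambda>x. (f' x)\<^sup>2)" by (simp only: integrable_completion)
  then have "sqint lborel f'" using f' by (simp only: sqint_def)
  then show ?thesis using ae' by (rule that)
qed

lemma integral_mult_representative:
  fixes f f' k :: "'a::euclidean_space \<Rightarrow> real"
  assumes f: "sqint lebesgue f" and f': "sqint lborel f'"
    and ae: "AE x in lebesgue. f x = f' x" and k: "continuous_on UNIV k"
  shows "(LINT x|lebesgue. f x * k (x - a)) = (LINT x|lborel. f' x * k (x - a))"
proof (rule integral_lebesgue_representative)
  have [measurable]: "k \<in> borel_measurable borel" by (rule borel_measurable_continuous_onI[OF k])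
  have [measurable]: "f' \<in> borel_measurable borel" using f' by (simp add: sqint_def)
  have "(\<lambda>x. k (x - a)) \<in> borel_measurable lborel" by measurable
  then have "(\<lambda>x. k (x - a)) \<in> borel_measurable lebesgue" by (rule measurable_completion)
  moreover have "f \<in> borel_measurable lebesgue" using f by (simp add: sqint_def)
  ultimately show "(\<lambda>x. f x * k (x - a)) \<in> borel_measurable lebesgue"
    by (rule borel_measurable_times[rotated])
  show "(\<lambda>x. f' x * k (x - a)) \<in> borel_measurable borel" by measurable
  show "AE x in lebesgue. f x * k (x - a) = f' x * k (x - a)" using ae by (rule eventually_mono) simp
qed

lemma has_weak_pd_UNIV:
  "has_weak_pd UNIV s f g \<longleftrightarrow> sqint lebesgue f \<and> sqint lebesgue g \<and>
     (\<forall>\<phi>\<in>test_functions UNIV. (LINT x|lebesgue. f x * pd s \<phi> x) = - (LINT x|lebesgue. g x * \<phi> x))"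
  unfolding has_weak_pd_def L2_space_iff_sqint lebesgue_on_UNIV_eq by simp

lemma has_weak_pd_bump:
  assumes "has_weak_pd UNIV s f g" "0 < \<delta>"
  shows "(LINT x|lebesgue. f x * dbump \<delta> s (x - a)) = - (LINT x|lebesgue. g x * bump \<delta> (x - a))"
proof -
  have "(LINT x|lebesgue. f x * pd s (\<lambda>y. bump \<delta> (y - a)) x) = - (LINT x|lebesgue. g x * bump \<delta> (x - a))"
    using assms(1) bump_test_function[OF assms(2)] unfolding has_weak_pd_UNIV by blast
  then show ?thesis by (simp only: pd_bump)
qed

lemma sqint_lebesgue_eq_0_if_orthogonal_to_bumps:
  fixes f :: "real ^ 'd::finite \<Rightarrow> real"
  assumes f: "sqint lebesgue f" and orth: "\<And>\<delta> a. 0 < \<delta> \<Longrightarrow> (LINT x|lebesgue. f x * bump \<delta> (x - a)) = 0"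
  shows "AE x in lebesgue. f x = 0"
proof -
  obtain f' where f': "sqint lborel f'" and ae: "AE x in lebesgue. f x = f' x"
    using sqint_borel_representative[OF f] by blast
  have "(LINT y|lborel. f' y * bump \<delta> (y - a)) = 0" if "0 < \<delta>" for \<delta> a
    using orth[OF that, of a] unfolding integral_mult_representative[OF f f' ae continuous_on_bump] .
  then have "AE x in lborel. f' x = 0" by (rule sqint_eq_0_if_orthogonal_to_bumps[OF f'])
  then have "AE x in lebesgue. f' x = 0" by (rule AE_completion)
  with ae show ?thesis by eventually_elim simp
qed

lemma AE_eq_if_bump_integrals_eq:
  fixes f g :: "real ^ 'd::finite \<Rightarrow> real"
  assumes f: "sqint lebesgue f" and g: "sqint lebesgue g"
    and eq: "\<And>\<delta> a. 0 < \<delta> \<Longrightarrow> (LINT x|lebesgue. f x * bump \<delta> (x - a)) = (LINT x|lebesgue. g x * bump \<delta> (x - a))"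
  shows "AE x in lebesgue. f x = g x"
proof -
  have b: "sqint lebesgue (\<lambda>x. bump \<delta> (x - a))" if "0 < \<delta>" for \<delta> :: real and a :: "real ^ 'd"
  proof -
    have [measurable]: "(bump \<delta> :: real ^ 'd \<Rightarrow> real) \<in> borel_measurable borel"
      by (rule borel_measurable_continuous_onI[OF continuous_on_bump])
    have [measurable]: "(\<lambda>x. bump \<delta> (x - a)) \<in> borel_measurable lborel" by measurable
    have "integrable lborel (\<lambda>x. (bump \<delta> (x - a))\<^sup>2)"
    proof (rule integrable_continuous_compact_support[where R="\<delta> + norm a"])
      show "continuous_on UNIV (\<lambda>x. (bump \<delta> (x - a))\<^sup>2)"
        by (intro continuous_on_power continuous_on_compose2[OF continuous_on_bump[of UNIV] _ subset_UNIV]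
            continuous_on_diff continuous_on_id continuous_on_const)
      fix x :: "real ^ 'd" assume "\<delta> + norm a < norm x"
      then have "\<delta> \<le> norm (x - a)" using norm_triangle_ineq2[of x a] by linarith
      then show "(bump \<delta> (x - a))\<^sup>2 = 0" using bump_eq_0[OF that] by simp
    qed
    then show ?thesis by (simp add: sqint_def integrable_completion measurable_completion)
  qed
  have "AE x in lebesgue. f x - g x = 0"
  proof (rule sqint_lebesgue_eq_0_if_orthogonal_to_bumps[OF sqint_diff[OF f g]])
    fix \<delta> :: real and a :: "real ^ 'd" assume \<delta>: "0 < \<delta>"
    show "(LINT x|lebesgue. (f x - g x) * bump \<delta> (x - a)) = 0"
      unfolding left_diff_distrib
      using sqint_integrable_mult[OF f b[OF \<delta>]] sqint_integrable_mult[OF g b[OF \<delta>]] eq[OF \<delta>] by simp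
  qed
  then show ?thesis by (rule eventually_mono) simp
qed

lemma weak_pd_unique:
  assumes "has_weak_pd UNIV s f g" "has_weak_pd UNIV s f h"
  shows "AE x in lebesgue. g x = h x"
proof (rule AE_eq_if_bump_integrals_eq)
  show "sqint lebesgue g" "sqint lebesgue h" using assms by (auto simp: has_weak_pd_UNIV)
  fix \<delta> :: real and a :: "real ^ 'a" assume "0 < \<delta>"
  then show "(LINT x|lebesgue. g x * bump \<delta> (x - a)) = (LINT x|lebesgue. h x * bump \<delta> (x - a))"
    using assms[THEN has_weak_pd_bump, of \<delta> a] by linarith
qed

text \<open>Tested with a bump, both mixed derivatives become the integral of \<open>f\<close> against a mixed
  second derivative of the bump.\<close>

lemma weak_pd_commute:
  assumes "has_weak_pd UNIV j f fj" "has_weak_pd UNIV n fj fjn"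
    and "has_weak_pd UNIV n f fn" "has_weak_pd UNIV j fn fnj"
  shows "AE x in lebesgue. fjn x = fnj x"
proof (rule AE_eq_if_bump_integrals_eq)
  show "sqint lebesgue fjn" "sqint lebesgue fnj" using assms by (auto simp: has_weak_pd_UNIV)
  fix \<delta> :: real and a :: "real ^ 'a" assume \<delta>: "0 < \<delta>"
  have second: "(LINT x|lebesgue. gst x * bump \<delta> (x - a)) = (LINT x|lebesgue. f x * pd s (\<lambda>y. dbump \<delta> t (y - a)) x)"
    if "has_weak_pd UNIV s f gs" "has_weak_pd UNIV t gs gst" for s t gs gst
  proof -
    have "(LINT x|lebesgue. gst x * bump \<delta> (x - a)) = - (LINT x|lebesgue. gs x * dbump \<delta> t (x - a))"
      using has_weak_pd_bump[OF that(2) \<delta>, of a] by simp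
    also have "\<dots> = (LINT x|lebesgue. f x * pd s (\<lambda>y. dbump \<delta> t (y - a)) x)"
      using that(1) dbump_test_function[OF \<delta>, of t a] unfolding has_weak_pd_UNIV by simp
    finally show ?thesis .
  qed
  show "(LINT x|lebesgue. fjn x * bump \<delta> (x - a)) = (LINT x|lebesgue. fnj x * bump \<delta> (x - a))"
    unfolding second[OF assms(1,2)] second[OF assms(3,4)] by (simp only: pd_dbump_commute)
qed

lemma weak_integration_by_parts:
  assumes f: "has_weak_pd UNIV s f f'" and g: "has_weak_pd UNIV s g g'"
  shows "(LINT x|lebesgue. g x * f' x) = - (LINT x|lebesgue. g' x * f x)"
proof -
  have sq: "sqint lebesgue f" "sqint lebesgue f'" "sqint lebesgue g" "sqint lebesgue g'"
    using f g by (auto simp: has_weak_pd_UNIV)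
  obtain F where F: "sqint lborel F" "AE x in lebesgue. f x = F x" using sqint_borel_representative[OF sq(1)] by blast
  obtain F' where F': "sqint lborel F'" "AE x in lebesgue. f' x = F' x" using sqint_borel_representative[OF sq(2)] by blast
  obtain G where G: "sqint lborel G" "AE x in lebesgue. g x = G x" using sqint_borel_representative[OF sq(3)] by blast
  obtain G' where G': "sqint lborel G'" "AE x in lebesgue. g' x = G' x" using sqint_borel_representative[OF sq(4)] by blast
  have bumps: "(LINT y|lborel. U y * dbump \<delta> s (y - a)) = - (LINT y|lborel. U' y * bump \<delta> (y - a))"
    if "has_weak_pd UNIV s u u'" "sqint lborel U" "AE x in lebesgue. u x = U x"
      "sqint lborel U'" "AE x in lebesgue. u' x = U' x" "0 < \<delta>" for u u' U U' \<delta> a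
  proof -
    have "(LINT y|lborel. U y * dbump \<delta> s (y - a)) = (LINT y|lebesgue. u y * dbump \<delta> s (y - a))"
      using that(1) by (intro integral_mult_representative[symmetric] that(2,3) continuous_on_dbump)
        (simp add: has_weak_pd_UNIV)
    also have "\<dots> = - (LINT y|lebesgue. u' y * bump \<delta> (y - a))"
      by (rule has_weak_pd_bump[OF that(1,6)])
    also have "(LINT y|lebesgue. u' y * bump \<delta> (y - a)) = (LINT y|lborel. U' y * bump \<delta> (y - a))"
      using that(1) by (intro integral_mult_representative that(4,5) continuous_on_bump)
        (simp add: has_weak_pd_UNIV)
    finally show ?thesis .
  qed
  have prod: "(LINT x|lebesgue. u x * w x) = (LINT x|lborel. U x * W x)"
    if "sqint lebesgue u" "sqint lebesgue w" "sqint lborel U" "sqint lborel W"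
      "AE x in lebesgue. u x = U x" "AE x in lebesgue. w x = W x" for u w U W :: "real ^ 'a \<Rightarrow> real"
  proof (rule integral_lebesgue_representative)
    show "(\<lambda>x. u x * w x) \<in> borel_measurable lebesgue"
      using that(1,2) by (intro borel_measurable_times) (simp_all add: sqint_def)
    show "(\<lambda>x. U x * W x) \<in> borel_measurable borel"
      using that(3,4) by (intro borel_measurable_times) (simp_all add: sqint_def)
    show "AE x in lebesgue. u x * w x = U x * W x" using that(5,6) by eventually_elim simp
  qed
  have "(LINT x|lborel. G x * F' x) = - (LINT x|lborel. G' x * F x)"
    by (rule integral_by_parts_bump_derivative[OF F(1) F'(1) G(1) G'(1) bumps[OF f F F'] bumps[OF g G G']])
  then show ?thesis
    unfolding prod[OF sq(3,2) G(1) F'(1) G(2) F'(2)] prod[OF sq(4,1) G'(1) F(1) G'(2) F(2)] .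
qed

text \<open>Products of \<open>L\<^sup>2\<close> functions with \<open>\<phi>\<close> and its derivatives are thus integrable, which makes
  the integrals in the definition of a weak derivative additive.\<close>

lemma test_function_sqint:
  fixes \<phi> :: "real ^ 'd::finite \<Rightarrow> real"
  assumes \<phi>: "\<phi> \<in> test_functions UNIV"
  shows "sqint lebesgue \<phi>" "sqint lebesgue (pd s \<phi>)"
proof -
  let ?S = "closure {x. \<phi> x \<noteq> 0}"
  have smooth: "smooth \<phi>" and cpt: "compact ?S" using \<phi> by (auto simp: test_functions_def)
  obtain R where R: "\<And>x. x \<in> ?S \<Longrightarrow> norm x \<le> R"
    using compact_imp_bounded[OF cpt] unfolding bounded_iff by blast
  have 0: "\<phi> x = 0" if "x \<notin> ?S" for x
    using that closure_subset[of "{x. \<phi> x \<noteq> 0}"] by blast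
  have pd0: "pd s \<phi> x = 0" if "x \<notin> ?S" for x
  proof -
    have "((\<lambda>_. 0) has_derivative (\<lambda>_. 0)) (at x)" by (rule has_derivative_const)
    then have "(\<phi> has_derivative (\<lambda>_. 0)) (at x)"
    proof (rule has_derivative_transform_within_open[where s="- ?S"])
      show "open (- ?S)" by (rule open_Compl[OF closed_closure])
      show "x \<in> - ?S" using that by blast
      show "0 = \<phi> y" if "y \<in> - ?S" for y by (rule 0[symmetric]) (use that in blast)
    qed
    then show ?thesis by (rule pd_eqI)
  qed
  have "sqint lebesgue h" if h: "continuous_on UNIV h" "\<And>x. x \<notin> ?S \<Longrightarrow> h x = 0" for h :: "real ^ 'd \<Rightarrow> real"
  proof -
    have [measurable]: "h \<in> borel_measurable lborel"
      using borel_measurable_continuous_onI[OF h(1)] by simp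
    have "integrable lborel (\<lambda>x. (h x)\<^sup>2)"
    proof (rule integrable_continuous_compact_support[where R=R])
      show "continuous_on UNIV (\<lambda>x. (h x)\<^sup>2)" by (intro continuous_on_power h)
      fix x :: "real ^ 'd" assume "R < norm x"
      then have "x \<notin> ?S" using R[of x] by linarith
      then show "(h x)\<^sup>2 = 0" by (simp add: h(2))
    qed
    then show ?thesis by (simp add: sqint_def integrable_completion measurable_completion)
  qed
  then show "sqint lebesgue \<phi>" "sqint lebesgue (pd s \<phi>)"
    using 0 pd0 smooth smooth_pd[OF smooth] smooth_continuous_on by blast+
qed

lemma has_weak_pd_linear:
  assumes f: "has_weak_pd UNIV s f f'" and g: "has_weak_pd UNIV s g g'"
  shows "has_weak_pd UNIV s (\<lambda>x. c * (f x + g x)) (\<lambda>x. c * (f' x + g' x))"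
  unfolding has_weak_pd_UNIV
proof (intro conjI ballI)
  have sq: "sqint lebesgue f" "sqint lebesgue f'" "sqint lebesgue g" "sqint lebesgue g'"
    using f g by (auto simp: has_weak_pd_UNIV)
  show "sqint lebesgue (\<lambda>x. c * (f x + g x))" "sqint lebesgue (\<lambda>x. c * (f' x + g' x))"
    by (intro sqint_cmult sqint_add sq)+
  fix \<phi> :: "real ^ 'a \<Rightarrow> real" assume \<phi>: "\<phi> \<in> test_functions UNIV"
  have split: "(LINT x|lebesgue. c * (u x + w x) * k x) = c * ((LINT x|lebesgue. u x * k x) + (LINT x|lebesgue. w x * k x))"
    if "sqint lebesgue u" "sqint lebesgue w" "sqint lebesgue k" for u w k :: "real ^ 'a \<Rightarrow> real"
    using sqint_integrable_mult[OF that(1,3)] sqint_integrable_mult[OF that(2,3)]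
    by (simp add: distrib_right mult.assoc)
  have "(LINT x|lebesgue. f x * pd s \<phi> x) = - (LINT x|lebesgue. f' x * \<phi> x)"
    "(LINT x|lebesgue. g x * pd s \<phi> x) = - (LINT x|lebesgue. g' x * \<phi> x)"
    using f g \<phi> by (auto simp: has_weak_pd_UNIV)
  then show "(LINT x|lebesgue. c * (f x + g x) * pd s \<phi> x) = - (LINT x|lebesgue. c * (f' x + g' x) * \<phi> x)"
    unfolding split[OF sq(1,3) test_function_sqint(2)[OF \<phi>]] split[OF sq(2,4) test_function_sqint(1)[OF \<phi>]]
    by (simp add: algebra_simps)
qed

lemma has_weak_pd_wpd: "has_weak_pd \<Omega> s f g \<Longrightarrow> has_weak_pd \<Omega> s f (wpd \<Omega> s f)"
  unfolding wpd_def by (rule someI[where P="has_weak_pd \<Omega> s f"])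

lemma H1_space_has_weak_pd: "f \<in> H1_space \<Omega> \<Longrightarrow> has_weak_pd \<Omega> s f (wpd \<Omega> s f)"
  unfolding H1_space_def by (drule CollectD, drule conjunct2, drule spec[of _ s], erule exE) (rule has_weak_pd_wpd)

context
  fixes U :: "'d::finite field"
  assumes U: "U \<in> H2_vec"
begin

text \<open>\<open>D1 i j\<close> is \<open>\<partial>\<^sub>jU\<^sub>i\<close> and \<open>D2 i j n\<close> is \<open>\<partial>\<^sub>n\<partial>\<^sub>jU\<^sub>i\<close>.\<close>

abbreviation D1 :: "'d \<Rightarrow> 'd \<Rightarrow> real ^ 'd \<Rightarrow> real" where
  "D1 i j \<equiv> wpd UNIV j (\<lambda>x. U x $ i)"

abbreviation D2 :: "'d \<Rightarrow> 'd \<Rightarrow> 'd \<Rightarrow> real ^ 'd \<Rightarrow> real" where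
  "D2 i j n \<equiv> wpd UNIV n (D1 i j)"

lemma has_weak_pd_D1: "has_weak_pd UNIV j (\<lambda>x. U x $ i) (D1 i j)"
  using U by (intro H1_space_has_weak_pd) (simp add: H2_vec_def H2_space_def)

lemma has_weak_pd_D2: "has_weak_pd UNIV n (D1 i j) (D2 i j n)"
  using U by (intro H1_space_has_weak_pd) (simp add: H2_vec_def H2_space_def)

lemma sqint_D1: "sqint lebesgue (D1 i j)"
  using has_weak_pd_D1 by (simp add: has_weak_pd_UNIV)

lemma sqint_D2: "sqint lebesgue (D2 i j n)"
  using has_weak_pd_D2 by (simp add: has_weak_pd_UNIV)

lemma D2_commute: "AE x in lebesgue. D2 i j n x = D2 i n j x"
  by (rule weak_pd_commute[OF has_weak_pd_D1 has_weak_pd_D2 has_weak_pd_D1 has_weak_pd_D2])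

lemma strain_eq_D1: "strain U i j = (\<lambda>x. 1 / 2 * (D1 i j x + D1 j i x))"
  by (simp add: strain_def fun_eq_iff)

lemma has_weak_pd_strain: "has_weak_pd UNIV n (strain U i j) (\<lambda>x. 1 / 2 * (D2 i j n x + D2 j i n x))"
  unfolding strain_eq_D1 by (rule has_weak_pd_linear[OF has_weak_pd_D2 has_weak_pd_D2])

lemma has_weak_pd_strain_gradient: "has_weak_pd UNIV n (strain U i j) (strain_gradient U i j n)"
  unfolding strain_gradient_def by (rule has_weak_pd_wpd[OF has_weak_pd_strain])

lemma sqint_strain: "sqint lebesgue (strain U i j)" "sqint lebesgue (strain_gradient U i j n)"
  using has_weak_pd_strain_gradient by (auto simp: has_weak_pd_UNIV)

lemma strain_gradient_eq_D2: "AE x in lebesgue. strain_gradient U i j n x = 1 / 2 * (D2 i j n x + D2 j i n x)"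
  by (rule weak_pd_unique[OF has_weak_pd_strain_gradient has_weak_pd_strain])

text \<open>Two integrations by parts, through \<open>- \<integral> U\<^sub>i \<partial>\<^sub>j\<partial>\<^sub>i U\<^sub>j\<close>, exchange the two derivatives.\<close>

lemma integral_D1_cross:
  "(LINT x|lebesgue. D1 j i x * D1 i j x) = (LINT x|lebesgue. D1 j j x * D1 i i x)"
proof -
  have m: "(\<lambda>x. D2 j k l x * U x $ i) \<in> borel_measurable lebesgue" for k l
    using has_weak_pd_D1[of i i] sqint_D2[where i=j and j=k and n=l] by (intro borel_measurable_times) (simp_all add: has_weak_pd_UNIV sqint_def)
  have "(LINT x|lebesgue. D1 j i x * D1 i j x) = - (LINT x|lebesgue. D2 j i j x * U x $ i)"
    by (rule weak_integration_by_parts[OF has_weak_pd_D1 has_weak_pd_D2])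
  also have "(LINT x|lebesgue. D2 j i j x * U x $ i) = (LINT x|lebesgue. D2 j j i x * U x $ i)"
    by (intro integral_cong_AE m eventually_mono[OF D2_commute[where i=j and j=i and n=j]]) simp
  also have "- \<dots> = (LINT x|lebesgue. D1 j j x * D1 i i x)"
    by (rule weak_integration_by_parts[OF has_weak_pd_D1 has_weak_pd_D2, symmetric])
  finally show ?thesis .
qed

text \<open>Expanding the square leaves the cross terms \<open>1/2 \<Sum> \<integral> \<partial>\<^sub>jU\<^sub>i \<partial>\<^sub>iU\<^sub>j\<close>, which equal
  \<open>1/2 \<integral> (div U)\<^sup>2 \<ge> 0\<close>.\<close>

lemma Korn:
  "(\<Sum>i\<in>UNIV. \<Sum>j\<in>UNIV. LINT x|lebesgue. (strain U i j x)\<^sup>2)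
    \<ge> 1 / 2 * (\<Sum>i\<in>UNIV. \<Sum>j\<in>UNIV. LINT x|lebesgue. (D1 i j x)\<^sup>2)"
proof -
  let ?I = "\<lambda>i j. LINT x|lebesgue. (D1 i j x)\<^sup>2"
  let ?X = "\<lambda>i j. LINT x|lebesgue. D1 i i x * D1 j j x"
  have int: "integrable lebesgue (\<lambda>x. (D1 i j x)\<^sup>2)" for i j using sqint_D1 by (simp add: sqint_def)
  have intX: "integrable lebesgue (\<lambda>x. D1 i j x * D1 k l x)" for i j k l
    by (intro sqint_integrable_mult sqint_D1)
  have "(LINT x|lebesgue. (strain U i j x)\<^sup>2) = 1 / 4 * ?I i j + 1 / 4 * ?I j i + 1 / 2 * ?X i j" for i j
  proof -
    have "(LINT x|lebesgue. (strain U i j x)\<^sup>2)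
      = (LINT x|lebesgue. 1 / 4 * (D1 i j x)\<^sup>2 + 1 / 4 * (D1 j i x)\<^sup>2 + 1 / 2 * (D1 i j x * D1 j i x))"
      by (intro Bochner_Integration.integral_cong refl)
        (simp add: strain_eq_D1 power2_eq_square field_simps)
    also have "\<dots> = 1 / 4 * ?I i j + 1 / 4 * ?I j i + 1 / 2 * (LINT x|lebesgue. D1 i j x * D1 j i x)"
      using int intX by simp
    finally show ?thesis by (simp only: integral_D1_cross)
  qed
  then have "(\<Sum>i\<in>UNIV. \<Sum>j\<in>UNIV. LINT x|lebesgue. (strain U i j x)\<^sup>2)
    = 1 / 4 * (\<Sum>i\<in>UNIV. \<Sum>j\<in>UNIV. ?I i j) + 1 / 4 * (\<Sum>i\<in>UNIV. \<Sum>j\<in>UNIV. ?I j i) + 1 / 2 * (\<Sum>i\<in>UNIV. \<Sum>j\<in>UNIV. ?X i j)"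
    by (simp add: sum.distrib sum_distrib_left)
  also have "(\<Sum>i\<in>UNIV. \<Sum>j\<in>UNIV. ?I j i) = (\<Sum>i\<in>UNIV. \<Sum>j\<in>UNIV. ?I i j)" by (rule sum.swap)
  finally have eq: "(\<Sum>i\<in>UNIV. \<Sum>j\<in>UNIV. LINT x|lebesgue. (strain U i j x)\<^sup>2)
    = 1 / 2 * (\<Sum>i\<in>UNIV. \<Sum>j\<in>UNIV. ?I i j) + 1 / 2 * (\<Sum>i\<in>UNIV. \<Sum>j\<in>UNIV. ?X i j)"
    by simp
  have "(\<Sum>i\<in>UNIV. \<Sum>j\<in>UNIV. ?X i j) = (LINT x|lebesgue. (\<Sum>i\<in>UNIV. D1 i i x)\<^sup>2)"
    using intX by (simp add: power2_eq_square sum_product)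
  then have "0 \<le> (\<Sum>i\<in>UNIV. \<Sum>j\<in>UNIV. ?X i j)" by (simp add: integral_nonneg_AE)
  with eq show ?thesis by linarith
qed

text \<open>Solving \<open>2 \<eta>\<^sub>i\<^sub>j\<^sub>n = \<partial>\<^sub>n\<partial>\<^sub>jU\<^sub>i + \<partial>\<^sub>n\<partial>\<^sub>iU\<^sub>j\<close> for the second derivatives, as for Christoffel symbols,
  gives \<open>\<partial>\<^sub>n\<partial>\<^sub>jU\<^sub>i = \<eta>\<^sub>i\<^sub>j\<^sub>n + \<eta>\<^sub>i\<^sub>n\<^sub>j - \<eta>\<^sub>j\<^sub>n\<^sub>i\<close>. The square of a sum of three terms costs a factor \<open>3\<close>,
  and each of the three index patterns contributes the full sum, whence \<open>9\<close>.\<close>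

lemma strain_gradient_controls_D2:
  "(\<Sum>i\<in>UNIV. \<Sum>j\<in>UNIV. \<Sum>n\<in>UNIV. LINT x|lebesgue. (D2 i j n x)\<^sup>2)
    \<le> 9 * (\<Sum>i\<in>UNIV. \<Sum>j\<in>UNIV. \<Sum>n\<in>UNIV. LINT x|lebesgue. (strain_gradient U i j n x)\<^sup>2)"
proof -
  let ?H = "strain_gradient U"
  let ?I = "\<lambda>i j n. LINT x|lebesgue. (?H i j n x)\<^sup>2"
  have int: "integrable lebesgue (\<lambda>x. (?H i j n x)\<^sup>2)" for i j n using sqint_strain(2) by (simp add: sqint_def)
  have "(LINT x|lebesgue. (D2 i j n x)\<^sup>2) \<le> 3 * (?I i j n + ?I i n j + ?I j n i)" for i j n
  proof -
    have "(LINT x|lebesgue. (D2 i j n x)\<^sup>2) \<le> (LINT x|lebesgue. 3 * ((?H i j n x)\<^sup>2 + (?H i n j x)\<^sup>2 + (?H j n i x)\<^sup>2))"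
    proof (rule integral_mono_AE)
      show "integrable lebesgue (\<lambda>x. (D2 i j n x)\<^sup>2)" using sqint_D2 by (simp add: sqint_def)
      show "integrable lebesgue (\<lambda>x. 3 * ((?H i j n x)\<^sup>2 + (?H i n j x)\<^sup>2 + (?H j n i x)\<^sup>2))"
        by (intro integrable_mult_right Bochner_Integration.integrable_add int)
      show "AE x in lebesgue. (D2 i j n x)\<^sup>2 \<le> 3 * ((?H i j n x)\<^sup>2 + (?H i n j x)\<^sup>2 + (?H j n i x)\<^sup>2)"
        using strain_gradient_eq_D2[of i j n] strain_gradient_eq_D2[of i n j] strain_gradient_eq_D2[of j n i]
          D2_commute[where i=i and j=j and n=n] D2_commute[where i=j and j=i and n=n] D2_commute[where i=n and j=i and n=j]
      proof eventually_elim
        case (elim x)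
        define a b c where "a = ?H i j n x" and "b = ?H i n j x" and "c = ?H j n i x"
        have "D2 i j n x = a + b - c" using elim unfolding a_def b_def c_def by simp
        moreover have "0 \<le> (a - b)\<^sup>2 + (a + c)\<^sup>2 + (b + c)\<^sup>2" by simp
        then have "(a + b - c)\<^sup>2 \<le> 3 * (a\<^sup>2 + b\<^sup>2 + c\<^sup>2)"
          by (simp add: power2_eq_square algebra_simps)
        ultimately show ?case by (simp add: a_def b_def c_def)
      qed
    qed
    also have "\<dots> = 3 * (?I i j n + ?I i n j + ?I j n i)" using int by simp
    finally show ?thesis .
  qed
  then have "(\<Sum>i\<in>UNIV. \<Sum>j\<in>UNIV. \<Sum>n\<in>UNIV. LINT x|lebesgue. (D2 i j n x)\<^sup>2)
    \<le> (\<Sum>i\<in>UNIV. \<Sum>j\<in>UNIV. \<Sum>n\<in>UNIV. 3 * (?I i j n + ?I i n j + ?I j n i))"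
    by (intro sum_mono)
  also have "\<dots> = 3 * ((\<Sum>i\<in>UNIV. \<Sum>j\<in>UNIV. \<Sum>n\<in>UNIV. ?I i j n)
      + (\<Sum>i\<in>UNIV. \<Sum>j\<in>UNIV. \<Sum>n\<in>UNIV. ?I i n j) + (\<Sum>i\<in>UNIV. \<Sum>j\<in>UNIV. \<Sum>n\<in>UNIV. ?I j n i))"
    by (simp only: sum_distrib_left[symmetric] sum.distrib)
  also have "(\<Sum>i\<in>UNIV. \<Sum>j\<in>UNIV. \<Sum>n\<in>UNIV. ?I i n j) = (\<Sum>i\<in>UNIV. \<Sum>j\<in>UNIV. \<Sum>n\<in>UNIV. ?I i j n)"
    by (rule sum.cong[OF refl]) (rule sum.swap)
  also have "(\<Sum>i\<in>UNIV. \<Sum>j\<in>UNIV. \<Sum>n\<in>UNIV. ?I j n i) = (\<Sum>j\<in>UNIV. \<Sum>i\<in>UNIV. \<Sum>n\<in>UNIV. ?I j n i)"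
    by (rule sum.swap)
  also have "\<dots> = (\<Sum>i\<in>UNIV. \<Sum>j\<in>UNIV. \<Sum>n\<in>UNIV. ?I i j n)"
    by (rule sum.cong[OF refl]) (rule sum.swap)
  finally show ?thesis by simp
qed

end

section \<open>Coercivity of the corrected energy\<close>

text \<open>Twice the energy density, as a function of plain index functions, so that it applies both
  to tensors and to the values of strain fields at a point.\<close>

definition energy_form :: "real \<Rightarrow> 'd::finite tensor4 \<Rightarrow> 'd tensor5 \<Rightarrow> 'd tensor6 \<Rightarrow>
    ('d \<Rightarrow> 'd \<Rightarrow> real) \<Rightarrow> ('d \<Rightarrow> 'd \<Rightarrow> 'd \<Rightarrow> real) \<Rightarrow> real" where
  "energy_form L C0 C1 A e h =
     (\<Sum>i\<in>UNIV. \<Sum>j\<in>UNIV. \<Sum>k\<in>UNIV. \<Sum>l\<in>UNIV. e i j * C0 i j k l * e k l)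
     + L * (\<Sum>i\<in>UNIV. \<Sum>j\<in>UNIV. \<Sum>k\<in>UNIV. \<Sum>l\<in>UNIV. \<Sum>m\<in>UNIV. e i j * C1 i j k l m * h k l m)
     + L\<^sup>2 * (\<Sum>i\<in>UNIV. \<Sum>j\<in>UNIV. \<Sum>n\<in>UNIV. \<Sum>k\<in>UNIV. \<Sum>l\<in>UNIV. \<Sum>m\<in>UNIV.
               h i j n * A i j n k l m * h k l m)"

definition sumsq2 :: "('d::finite \<Rightarrow> 'd \<Rightarrow> real) \<Rightarrow> real" where
  "sumsq2 e = (\<Sum>i\<in>UNIV. \<Sum>j\<in>UNIV. (e i j)\<^sup>2)"

definition sumsq3 :: "('d::finite \<Rightarrow> 'd \<Rightarrow> 'd \<Rightarrow> real) \<Rightarrow> real" where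
  "sumsq3 h = (\<Sum>i\<in>UNIV. \<Sum>j\<in>UNIV. \<Sum>n\<in>UNIV. (h i j n)\<^sup>2)"

lemma sumsq2_nonneg: "0 \<le> sumsq2 e"
  by (simp add: sumsq2_def sum_nonneg)

lemma sumsq3_nonneg: "0 \<le> sumsq3 h"
  by (simp add: sumsq3_def sum_nonneg)

lemma abs_le_sqrt_sumsq2: "\<bar>e i j\<bar> \<le> sqrt (sumsq2 e)"
proof -
  have "(e i j)\<^sup>2 \<le> (\<Sum>j\<in>UNIV. (e i j)\<^sup>2)" by (rule member_le_sum) auto
  also have "\<dots> \<le> sumsq2 e"
    unfolding sumsq2_def by (rule member_le_sum) (auto intro: sum_nonneg)
  finally show ?thesis by (simp add: real_le_rsqrt)
qed

lemma abs_le_sqrt_sumsq3: "\<bar>h i j n\<bar> \<le> sqrt (sumsq3 h)"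
proof -
  have "(h i j n)\<^sup>2 \<le> (\<Sum>n\<in>UNIV. (h i j n)\<^sup>2)" by (rule member_le_sum) auto
  also have "\<dots> \<le> (\<Sum>j\<in>UNIV. \<Sum>n\<in>UNIV. (h i j n)\<^sup>2)" by (rule member_le_sum) (auto intro: sum_nonneg)
  also have "\<dots> \<le> sumsq3 h"
    unfolding sumsq3_def by (rule member_le_sum) (auto intro!: sum_nonneg)
  finally show ?thesis by (simp add: real_le_rsqrt)
qed

lemma abs_triple_le:
  fixes a b c x y :: real
  assumes "\<bar>a\<bar> \<le> x" "\<bar>b\<bar> \<le> y"
  shows "\<bar>a * c * b\<bar> \<le> \<bar>c\<bar> * (x * y)"
proof -
  have "\<bar>a\<bar> * \<bar>b\<bar> \<le> x * y" using assms by (intro mult_mono) auto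
  then have "\<bar>c\<bar> * (\<bar>a\<bar> * \<bar>b\<bar>) \<le> \<bar>c\<bar> * (x * y)" by (intro mult_left_mono) auto
  then show ?thesis by (simp add: abs_mult mult_ac)
qed

lemma corrected_tensor_contraction:
  "(\<Sum>i\<in>UNIV. \<Sum>j\<in>UNIV. \<Sum>n\<in>UNIV. \<Sum>k\<in>UNIV. \<Sum>l\<in>UNIV. \<Sum>m\<in>UNIV.
      h i j n * corrected_tensor C0 C2 \<theta> i j n k l m * h k l m)
    = \<theta> * (\<Sum>n\<in>UNIV. bform C0 (\<lambda>i j. h i j n) (\<lambda>i j. h i j n))
      - (\<Sum>i\<in>UNIV. \<Sum>j\<in>UNIV. \<Sum>n\<in>UNIV. \<Sum>k\<in>UNIV. \<Sum>l\<in>UNIV. \<Sum>m\<in>UNIV. h i j n * C2 i j n k l m * h k l m)"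
proof -
  have "(\<Sum>i\<in>UNIV. \<Sum>j\<in>UNIV. \<Sum>n\<in>UNIV. \<Sum>k\<in>UNIV. \<Sum>l\<in>UNIV. \<Sum>m\<in>UNIV.
      h i j n * corrected_tensor C0 C2 \<theta> i j n k l m * h k l m)
    = (\<Sum>i\<in>UNIV. \<Sum>j\<in>UNIV. \<Sum>n\<in>UNIV. \<Sum>k\<in>UNIV. \<Sum>l\<in>UNIV. \<Sum>m\<in>UNIV.
        h i j n * \<theta> * C0 i j k l * h k l m * kdelta n m - h i j n * C2 i j n k l m * h k l m)"
    by (intro sum.cong refl) (simp add: corrected_tensor_def algebra_simps)
  also have "\<dots> = (\<Sum>i\<in>UNIV. \<Sum>j\<in>UNIV. \<Sum>n\<in>UNIV. \<Sum>k\<in>UNIV. \<Sum>l\<in>UNIV. \<theta> * (h i j n * C0 i j k l * h k l n))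
      - (\<Sum>i\<in>UNIV. \<Sum>j\<in>UNIV. \<Sum>n\<in>UNIV. \<Sum>k\<in>UNIV. \<Sum>l\<in>UNIV. \<Sum>m\<in>UNIV. h i j n * C2 i j n k l m * h k l m)"
  proof -
    have "(\<Sum>m\<in>UNIV. h i j n * \<theta> * C0 i j k l * h k l m * kdelta n m) = \<theta> * (h i j n * C0 i j k l * h k l n)" for i j n k l
      by (simp add: kdelta_def if_distrib[of "\<lambda>x. _ * x"] cong: if_cong)
    then show ?thesis by (simp add: sum_subtractf)
  qed
  also have "(\<Sum>i\<in>UNIV. \<Sum>j\<in>UNIV. \<Sum>n\<in>UNIV. \<Sum>k\<in>UNIV. \<Sum>l\<in>UNIV. \<theta> * (h i j n * C0 i j k l * h k l n))
    = (\<Sum>i\<in>UNIV. \<Sum>n\<in>UNIV. \<Sum>j\<in>UNIV. \<Sum>k\<in>UNIV. \<Sum>l\<in>UNIV. \<theta> * (h i j n * C0 i j k l * h k l n))"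
    by (rule sum.cong[OF refl]) (rule sum.swap)
  also have "\<dots> = (\<Sum>n\<in>UNIV. \<Sum>i\<in>UNIV. \<Sum>j\<in>UNIV. \<Sum>k\<in>UNIV. \<Sum>l\<in>UNIV. \<theta> * (h i j n * C0 i j k l * h k l n))"
    by (rule sum.swap)
  also have "\<dots> = \<theta> * (\<Sum>n\<in>UNIV. bform C0 (\<lambda>i j. h i j n) (\<lambda>i j. h i j n))"
    by (simp add: bform_def sum_distrib_left)
  finally show ?thesis .
qed

lemma sumsq3_slices: "(\<Sum>n\<in>UNIV. sumsq2 (\<lambda>i j. h i j n)) = sumsq3 h"
proof -
  have "(\<Sum>n\<in>UNIV. sumsq2 (\<lambda>i j. h i j n)) = (\<Sum>i\<in>UNIV. \<Sum>n\<in>UNIV. \<Sum>j\<in>UNIV. (h i j n)\<^sup>2)"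
    unfolding sumsq2_def by (rule sum.swap)
  also have "\<dots> = sumsq3 h"
    unfolding sumsq3_def by (rule sum.cong[OF refl]) (rule sum.swap)
  finally show ?thesis .
qed

text \<open>Write \<open>a = |e|\<close>, \<open>b = L |h|\<close>, and let \<open>M1\<close>, \<open>M2\<close> be the sums of the absolute values of the
  entries of \<open>C1\<close>, \<open>C2\<close>. The form is at least \<open>\<kappa> a\<^sup>2 - M1 a b + (\<theta> \<kappa> - M2) b\<^sup>2\<close>, and
  \<open>M1 a b \<le> \<kappa> a\<^sup>2 / 2 + M1\<^sup>2 b\<^sup>2 / (2 \<kappa>)\<close>. So it is enough that \<open>\<theta> \<kappa> > M2 + M1\<^sup>2 / (2 \<kappa>)\<close>. Neither
  the threshold nor \<open>c\<close> depends on \<open>L\<close>, which has been absorbed in \<open>b\<close>.\<close>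

lemma energy_form_coercive:
  fixes C0 :: "'d::finite tensor4"
  assumes \<kappa>: "\<kappa> > 0" and ell: "\<And>e. (\<And>i j. e i j = e j i) \<Longrightarrow> bform C0 e e \<ge> \<kappa> * sumsq2 e"
  shows "\<exists>\<theta>e>0. \<forall>\<theta>>\<theta>e. \<exists>c>0. \<forall>L>0. \<forall>e h. (\<forall>i j. e i j = e j i) \<longrightarrow> (\<forall>i j n. h i j n = h j i n) \<longrightarrow>
    energy_form L C0 C1 (corrected_tensor C0 C2 \<theta>) e h \<ge> c * (sumsq2 e + L\<^sup>2 * sumsq3 h)"
proof -
  define M1 where "M1 = (\<Sum>i\<in>UNIV. \<Sum>j\<in>UNIV. \<Sum>k\<in>UNIV. \<Sum>l\<in>UNIV. \<Sum>m\<in>UNIV. \<bar>C1 i j k l m\<bar>)"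
  define M2 where "M2 = (\<Sum>i\<in>UNIV. \<Sum>j\<in>UNIV. \<Sum>n\<in>UNIV. \<Sum>k\<in>UNIV. \<Sum>l\<in>UNIV. \<Sum>m\<in>UNIV. \<bar>C2 i j n k l m\<bar>)"
  \<comment> \<open>The summand \<open>1\<close> keeps the threshold positive when \<open>C1\<close> and \<open>C2\<close> vanish.\<close>
  define \<theta>e where "\<theta>e = (M2 + M1\<^sup>2 / (2 * \<kappa>)) / \<kappa> + 1"
  have M: "0 \<le> M1" "0 \<le> M2" by (auto simp: M1_def M2_def intro!: sum_nonneg)
  then have \<theta>e: "\<theta>e > 0" using \<kappa> by (auto simp: \<theta>e_def intro!: add_nonneg_pos)
  have "\<exists>c>0. \<forall>L>0. \<forall>e h. (\<forall>i j. e i j = e j i) \<longrightarrow> (\<forall>i j n. h i j n = h j i n) \<longrightarrow>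
    energy_form L C0 C1 (corrected_tensor C0 C2 \<theta>) e h \<ge> c * (sumsq2 e + L\<^sup>2 * sumsq3 h)" if \<theta>: "\<theta> > \<theta>e" for \<theta>
  proof -
    define r where "r = \<theta> * \<kappa> - M2 - M1\<^sup>2 / (2 * \<kappa>)"
    have "(\<theta>e - 1) * \<kappa> = M2 + M1\<^sup>2 / (2 * \<kappa>)" using \<kappa> by (simp add: \<theta>e_def)
    moreover have "(\<theta>e - 1) * \<kappa> < \<theta> * \<kappa>" using \<theta> \<kappa> by (intro mult_strict_right_mono) auto
    ultimately have r: "r > 0" by (simp add: r_def)
    define c where "c = min (\<kappa> / 2) r"
    have c: "c > 0" "c \<le> \<kappa> / 2" "c \<le> r" using r \<kappa> by (auto simp: c_def)
    have "energy_form L C0 C1 (corrected_tensor C0 C2 \<theta>) e h \<ge> c * (sumsq2 e + L\<^sup>2 * sumsq3 h)"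
      if L: "L > 0" and e: "\<And>i j. e i j = e j i" and h: "\<And>i j n. h i j n = h j i n" for L e h
    proof -
      let ?a = "sqrt (sumsq2 e)" and ?b = "sqrt (sumsq3 h)"
      have a2: "?a\<^sup>2 = sumsq2 e" and b2: "?b\<^sup>2 = sumsq3 h"
        by (simp_all add: sumsq2_nonneg sumsq3_nonneg)
      define X1 where "X1 = (\<Sum>i\<in>UNIV. \<Sum>j\<in>UNIV. \<Sum>k\<in>UNIV. \<Sum>l\<in>UNIV. \<Sum>m\<in>UNIV. e i j * C1 i j k l m * h k l m)"
      define X2 where "X2 = (\<Sum>i\<in>UNIV. \<Sum>j\<in>UNIV. \<Sum>n\<in>UNIV. \<Sum>k\<in>UNIV. \<Sum>l\<in>UNIV. \<Sum>m\<in>UNIV. h i j n * C2 i j n k l m * h k l m)"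
      have "\<bar>X1\<bar> \<le> (\<Sum>i\<in>UNIV. \<Sum>j\<in>UNIV. \<Sum>k\<in>UNIV. \<Sum>l\<in>UNIV. \<Sum>m\<in>UNIV. \<bar>C1 i j k l m\<bar> * (?a * ?b))"
        unfolding X1_def
        by (intro order_trans[OF sum_abs] sum_mono abs_triple_le abs_le_sqrt_sumsq2 abs_le_sqrt_sumsq3)
      then have X1: "\<bar>X1\<bar> \<le> M1 * (?a * ?b)" by (simp only: M1_def sum_distrib_right)
      have "\<bar>X2\<bar> \<le> (\<Sum>i\<in>UNIV. \<Sum>j\<in>UNIV. \<Sum>n\<in>UNIV. \<Sum>k\<in>UNIV. \<Sum>l\<in>UNIV. \<Sum>m\<in>UNIV. \<bar>C2 i j n k l m\<bar> * (?b * ?b))"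
        unfolding X2_def
        by (intro order_trans[OF sum_abs] sum_mono abs_triple_le abs_le_sqrt_sumsq3)
      then have "\<bar>X2\<bar> \<le> M2 * (?b * ?b)" by (simp only: M2_def sum_distrib_right)
      then have X2: "X2 \<le> M2 * sumsq3 h" using b2 by (simp add: power2_eq_square)
      have "(\<Sum>n\<in>UNIV. bform C0 (\<lambda>i j. h i j n) (\<lambda>i j. h i j n)) \<ge> (\<Sum>n\<in>UNIV. \<kappa> * sumsq2 (\<lambda>i j. h i j n))"
        by (intro sum_mono ell h)
      then have B: "(\<Sum>n\<in>UNIV. bform C0 (\<lambda>i j. h i j n) (\<lambda>i j. h i j n)) \<ge> \<kappa> * sumsq3 h"
        by (simp only: sum_distrib_left[symmetric] sumsq3_slices)
      have "\<theta> * (\<kappa> * sumsq3 h) - M2 * sumsq3 h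
          \<le> \<theta> * (\<Sum>n\<in>UNIV. bform C0 (\<lambda>i j. h i j n) (\<lambda>i j. h i j n)) - X2"
        using \<theta> \<theta>e B X2 by (intro diff_mono mult_left_mono) auto
      then have "L\<^sup>2 * (\<theta> * (\<kappa> * sumsq3 h) - M2 * sumsq3 h)
          \<le> L\<^sup>2 * (\<theta> * (\<Sum>n\<in>UNIV. bform C0 (\<lambda>i j. h i j n) (\<lambda>i j. h i j n)) - X2)"
        by (rule mult_left_mono) simp
      moreover have "L * X1 \<ge> L * (- (M1 * (?a * ?b)))"
        using X1 L by (intro mult_left_mono) auto
      moreover have "bform C0 e e \<ge> \<kappa> * sumsq2 e" by (rule ell[OF e])
      moreover have "energy_form L C0 C1 (corrected_tensor C0 C2 \<theta>) e h = bform C0 e e + L * X1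
          + L\<^sup>2 * (\<theta> * (\<Sum>n\<in>UNIV. bform C0 (\<lambda>i j. h i j n) (\<lambda>i j. h i j n)) - X2)"
        unfolding energy_form_def corrected_tensor_contraction X1_def X2_def bform_def[of C0 e e] ..
      ultimately have low: "energy_form L C0 C1 (corrected_tensor C0 C2 \<theta>) e h
          \<ge> \<kappa> * ?a\<^sup>2 - M1 * ?a * (L * ?b) + (\<theta> * \<kappa> - M2) * (L * ?b)\<^sup>2"
        unfolding a2 power_mult_distrib b2 by (simp add: algebra_simps)
      \<comment> \<open>Completing the square: Young's inequality with the weight that uses up half of \<open>\<kappa> |e|\<^sup>2\<close>.\<close>
      have "0 \<le> \<kappa> / 2 * (?a - M1 / \<kappa> * (L * ?b))\<^sup>2" using \<kappa> by simp
      also have "\<dots> = \<kappa> / 2 * ?a\<^sup>2 - M1 * ?a * (L * ?b) + M1\<^sup>2 / (2 * \<kappa>) * (L * ?b)\<^sup>2"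
        using \<kappa> by (simp add: power2_eq_square field_simps)
      finally have "\<kappa> * ?a\<^sup>2 - M1 * ?a * (L * ?b) + (\<theta> * \<kappa> - M2) * (L * ?b)\<^sup>2
          \<ge> \<kappa> / 2 * ?a\<^sup>2 + r * (L * ?b)\<^sup>2"
        by (simp add: r_def algebra_simps)
      moreover have "c * ?a\<^sup>2 \<le> \<kappa> / 2 * ?a\<^sup>2" "c * (L * ?b)\<^sup>2 \<le> r * (L * ?b)\<^sup>2"
        using c by (intro mult_right_mono; simp)+
      ultimately have "energy_form L C0 C1 (corrected_tensor C0 C2 \<theta>) e h \<ge> c * ?a\<^sup>2 + c * (L * ?b)\<^sup>2"
        using low by linarith
      then show ?thesis unfolding a2 power_mult_distrib b2 by (simp add: algebra_simps)
    qed
    with c(1) show ?thesis by blast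
  qed
  with \<theta>e show ?thesis by blast
qed

lemma energy_eq_energy_form: "energy L C0 C1 A \<epsilon> \<eta> = 1 / 2 * energy_form L C0 C1 A (\<lambda>i j. \<epsilon> $ i $ j) (\<lambda>i j n. \<eta> $ i $ j $ n)"
  by (simp add: energy_def energy_form_def)

lemma bilinear_Q_eq_energy_form:
  "bilinear_Q L C0 C1 A U U = (LINT x|lebesgue. energy_form L C0 C1 A (\<lambda>i j. strain U i j x) (\<lambda>i j n. strain_gradient U i j n x))"
  by (simp only: bilinear_Q_def energy_form_def lebesgue_on_UNIV_eq)

lemma sumsq_pos:
  assumes "(\<epsilon> :: real ^ 'd ^ 'd, \<eta> :: real ^ 'd ^ 'd ^ 'd::finite) \<noteq> (0, 0)" and L: "0 < (L::real)"
  shows "0 < sumsq2 (\<lambda>i j. \<epsilon> $ i $ j) + L\<^sup>2 * sumsq3 (\<lambda>i j n. \<eta> $ i $ j $ n)"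
proof -
  let ?s = "sumsq2 (\<lambda>i j. \<epsilon> $ i $ j)" and ?t = "sumsq3 (\<lambda>i j n. \<eta> $ i $ j $ n)"
  consider i j where "\<epsilon> $ i $ j \<noteq> 0" | i j n where "\<eta> $ i $ j $ n \<noteq> 0"
    using assms(1) by (auto simp: vec_eq_iff)
  then have "0 < ?s \<or> 0 < ?t"
  proof cases
    case 1
    have "0 < sqrt ?s" by (rule less_le_trans[OF _ abs_le_sqrt_sumsq2[of _ i j]]) (use 1 in simp)
    then show ?thesis by simp
  next
    case 2
    have "0 < sqrt ?t" by (rule less_le_trans[OF _ abs_le_sqrt_sumsq3[of _ i j n]]) (use 2 in simp)
    then show ?thesis by simp
  qed
  moreover have "0 \<le> ?s" "0 \<le> ?t" by (rule sumsq2_nonneg sumsq3_nonneg)+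
  ultimately show ?thesis
    using L by (auto intro: add_pos_nonneg add_nonneg_pos)
qed

text \<open>The pointwise bound is integrated, with Korn's inequality for the first derivatives and
  the factor \<open>9\<close> for the second ones.\<close>

lemma bilinear_Q_coercive:
  fixes U :: "'d::finite field"
  assumes U: "U \<in> H2_vec" and c: "c > 0" and L: "L > 0"
    and coercive: "\<And>e h. (\<And>i j. e i j = e j i) \<Longrightarrow> (\<And>i j n. h i j n = h j i n) \<Longrightarrow>
      energy_form L C0 C1 A e h \<ge> c * (sumsq2 e + L\<^sup>2 * sumsq3 h)"
  shows "bilinear_Q L C0 C1 A U U \<ge> min (c / 2) (c * L\<^sup>2 / 9) * (H2_norm_sq U - L2_norm_sq U)"
proof -
  let ?e = "\<lambda>x i j. strain U i j x" and ?h = "\<lambda>x i j n. strain_gradient U i j n x"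
  define K where "K = min (c / 2) (c * L\<^sup>2 / 9)"
  define N1 where "N1 = (\<Sum>i\<in>UNIV. \<Sum>j\<in>UNIV. LINT x|lebesgue. (wpd UNIV j (\<lambda>x. U x $ i) x)\<^sup>2)"
  define N2 where "N2 = (\<Sum>i\<in>UNIV. \<Sum>j\<in>UNIV. \<Sum>n\<in>UNIV. LINT x|lebesgue. (wpd UNIV n (wpd UNIV j (\<lambda>x. U x $ i)) x)\<^sup>2)"
  define E where "E = (\<Sum>i\<in>UNIV. \<Sum>j\<in>UNIV. LINT x|lebesgue. (strain U i j x)\<^sup>2)"
  define H where "H = (\<Sum>i\<in>UNIV. \<Sum>j\<in>UNIV. \<Sum>n\<in>UNIV. LINT x|lebesgue. (strain_gradient U i j n x)\<^sup>2)"
  have N: "0 \<le> N1" "0 \<le> N2" by (auto simp: N1_def N2_def intro!: sum_nonneg integral_nonneg_AE)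
  have sq: "sqint lebesgue (\<lambda>x. ?e x i j)" "sqint lebesgue (\<lambda>x. ?h x i j n)" for i j n
    using sqint_strain[OF U] by auto
  have int: "integrable lebesgue (\<lambda>x. (?e x i j)\<^sup>2)" "integrable lebesgue (\<lambda>x. (?h x i j n)\<^sup>2)" for i j n
    using sq by (auto simp: sqint_def)
  have "K * (H2_norm_sq U - L2_norm_sq U) = K * N1 + K * N2"
    by (simp add: H2_norm_sq_def N1_def N2_def lebesgue_on_UNIV_eq algebra_simps)
  also have "\<dots> \<le> c / 2 * N1 + c * L\<^sup>2 / 9 * N2"
    using N by (intro add_mono mult_right_mono) (auto simp: K_def)
  also have "\<dots> \<le> c * E + c * L\<^sup>2 * H"
  proof -
    have "N1 / 2 \<le> E" using Korn[OF U] by (simp add: N1_def E_def)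
    then have "c * (N1 / 2) \<le> c * E" using c by (intro mult_left_mono) auto
    moreover have "N2 / 9 \<le> H" using strain_gradient_controls_D2[OF U] by (simp add: N2_def H_def)
    then have "c * L\<^sup>2 * (N2 / 9) \<le> c * L\<^sup>2 * H" using c by (intro mult_left_mono) auto
    ultimately show ?thesis by simp
  qed
  also have "\<dots> = (LINT x|lebesgue. c * (sumsq2 (?e x) + L\<^sup>2 * sumsq3 (?h x)))"
    using int by (simp add: E_def H_def sumsq2_def sumsq3_def algebra_simps)
  also have "\<dots> \<le> (LINT x|lebesgue. energy_form L C0 C1 A (?e x) (?h x))"
  proof (rule integral_mono)
    show "integrable lebesgue (\<lambda>x. c * (sumsq2 (?e x) + L\<^sup>2 * sumsq3 (?h x)))"
      unfolding sumsq2_def sumsq3_def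
      by (intro integrable_mult_right Bochner_Integration.integrable_add Bochner_Integration.integrable_sum int)
    show "integrable lebesgue (\<lambda>x. energy_form L C0 C1 A (?e x) (?h x))"
      unfolding energy_form_def mult.assoc
      by (intro integrable_mult_right Bochner_Integration.integrable_add Bochner_Integration.integrable_sum
          sqint_integrable_mult sqint_cmult sq)
    have sym: "strain U i j = strain U j i" for i j by (simp add: strain_def fun_eq_iff)
    fix x :: "real ^ 'd"
    show "c * (sumsq2 (?e x) + L\<^sup>2 * sumsq3 (?h x)) \<le> energy_form L C0 C1 A (?e x) (?h x)"
    proof (rule coercive)
      show "?e x i j = ?e x j i" for i j by (rule fun_cong[OF sym])
      show "?h x i j n = ?h x j i n" for i j n unfolding strain_gradient_def by (subst sym) (rule refl)
    qed
  qed
  finally show ?thesis by (simp only: bilinear_Q_eq_energy_form K_def)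
qed

lemma H2_norm_sq_ge: "0 \<le> H2_norm_sq U - L2_norm_sq U"
  unfolding H2_norm_sq_def by (auto intro!: add_nonneg_nonneg sum_nonneg integral_nonneg_AE)

theorem proposition3:
  fixes v :: "'d::finite \<Rightarrow> real ^ 'd"
    and Y :: "(real ^ 'd) set"
    and C :: "real ^ 'd \<Rightarrow> 'd \<Rightarrow> 'd \<Rightarrow> 'd \<Rightarrow> 'd \<Rightarrow> real"
    and chi1 :: "'d \<Rightarrow> 'd \<Rightarrow> real ^ 'd \<Rightarrow> real ^ 'd"
    and chi2 :: "'d \<Rightarrow> 'd \<Rightarrow> 'd \<Rightarrow> real ^ 'd \<Rightarrow> real ^ 'd"
    and chi3 :: "'d \<Rightarrow> 'd \<Rightarrow> 'd \<Rightarrow> 'd \<Rightarrow> real ^ 'd \<Rightarrow> real ^ 'd"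
    and C0 :: "'d \<Rightarrow> 'd \<Rightarrow> 'd \<Rightarrow> 'd \<Rightarrow> real"
    and C1 :: "'d \<Rightarrow> 'd \<Rightarrow> 'd \<Rightarrow> 'd \<Rightarrow> 'd \<Rightarrow> real"
    and C2 :: "'d \<Rightarrow> 'd \<Rightarrow> 'd \<Rightarrow> 'd \<Rightarrow> 'd \<Rightarrow> 'd \<Rightarrow> real"
  assumes "CARD('d) \<in> {2, 3}"
    and "is_basis v"
    and "periodicity_cell v Y"
    and "elasticity_tensor Y C"
    and "cell_functions1 v Y C chi1"
    and "cell_functions2 v Y C chi1 chi2"
    and "cell_functions3 v Y C chi1 chi2 chi3"
    and "C0 = eff0 Y C chi1"
    and "C1 = eff1 Y C chi1 chi2"
    and "C2 = eff2 Y C chi2 chi3"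
  shows "\<exists>\<theta>e>0. \<forall>L>0. \<forall>\<theta>>\<theta>e.
    (\<forall>\<epsilon>\<in>sym2. \<forall>\<eta>\<in>sym2_vec. (\<epsilon>, \<eta>) \<noteq> (0, 0) \<longrightarrow>
       energy L C0 C1 (corrected_tensor C0 C2 \<theta>) \<epsilon> \<eta> > 0) \<and>
    (\<exists>K>0. \<forall>U\<in>H2_vec.
       bilinear_Q L C0 C1 (corrected_tensor C0 C2 \<theta>) U U \<ge> K * (H2_norm_sq U - L2_norm_sq U) \<and>
       K * (H2_norm_sq U - L2_norm_sq U) \<ge> 0)"
proof -
  obtain \<kappa> where \<kappa>: "\<kappa> > 0" and ell: "\<And>e. (\<And>i j. e i j = e j i) \<Longrightarrow> bform C0 e e \<ge> \<kappa> * sumsq2 e"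
    using eff0_elliptic[OF assms(3,4,5)] unfolding assms(8)[symmetric] sumsq2_def[symmetric] by blast
  obtain \<theta>e where \<theta>e: "\<theta>e > 0" and coercive: "\<And>\<theta>. \<theta> > \<theta>e \<Longrightarrow> \<exists>c>0. \<forall>L>0. \<forall>e h.
      (\<forall>i j. e i j = e j i) \<longrightarrow> (\<forall>i j n. h i j n = h j i n) \<longrightarrow>
      energy_form L C0 C1 (corrected_tensor C0 C2 \<theta>) e h \<ge> c * (sumsq2 e + L\<^sup>2 * sumsq3 h)"
    using energy_form_coercive[OF \<kappa> ell, of C1 C2] by blast
  show ?thesis
  proof (rule exI[of _ \<theta>e], intro conjI allI impI ballI)
    show "0 < \<theta>e" by (rule \<theta>e)
  next
    fix L \<theta> :: real and \<epsilon> :: "real ^ 'd ^ 'd" and \<eta> :: "real ^ 'd ^ 'd ^ 'd"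
    assume L: "0 < L" and \<theta>: "\<theta>e < \<theta>" and \<epsilon>: "\<epsilon> \<in> sym2" and \<eta>: "\<eta> \<in> sym2_vec" and ne: "(\<epsilon>, \<eta>) \<noteq> (0, 0)"
    obtain c where c: "c > 0" and q: "\<And>e h. (\<forall>i j. e i j = e j i) \<Longrightarrow> (\<forall>i j n. h i j n = h j i n) \<Longrightarrow>
      energy_form L C0 C1 (corrected_tensor C0 C2 \<theta>) e h \<ge> c * (sumsq2 e + L\<^sup>2 * sumsq3 h)"
      using coercive[OF \<theta>] L by blast
    have "0 < c * (sumsq2 (\<lambda>i j. \<epsilon> $ i $ j) + L\<^sup>2 * sumsq3 (\<lambda>i j n. \<eta> $ i $ j $ n))"
      by (rule mult_pos_pos[OF c sumsq_pos[OF ne L]])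
    also have "\<dots> \<le> energy_form L C0 C1 (corrected_tensor C0 C2 \<theta>) (\<lambda>i j. \<epsilon> $ i $ j) (\<lambda>i j n. \<eta> $ i $ j $ n)"
      by (rule q) (use \<epsilon> \<eta> in \<open>auto simp: sym2_def sym2_vec_def\<close>)
    finally show "0 < energy L C0 C1 (corrected_tensor C0 C2 \<theta>) \<epsilon> \<eta>" by (simp add: energy_eq_energy_form)
  next
    fix L \<theta> :: real
    assume L: "0 < L" and \<theta>: "\<theta>e < \<theta>"
    obtain c where c: "c > 0" and q: "\<And>e h. (\<And>i j. e i j = e j i) \<Longrightarrow> (\<And>i j n. h i j n = h j i n) \<Longrightarrow>
      energy_form L C0 C1 (corrected_tensor C0 C2 \<theta>) e h \<ge> c * (sumsq2 e + L\<^sup>2 * sumsq3 h)"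
      using coercive[OF \<theta>] L by blast
    let ?K = "min (c / 2) (c * L\<^sup>2 / 9)"
    have K: "?K > 0" using c L by simp
    show "\<exists>K>0. \<forall>U\<in>H2_vec.
       bilinear_Q L C0 C1 (corrected_tensor C0 C2 \<theta>) U U \<ge> K * (H2_norm_sq U - L2_norm_sq U) \<and>
       K * (H2_norm_sq U - L2_norm_sq U) \<ge> 0"
    proof (intro exI[of _ ?K] conjI ballI K)
      fix U :: "'d field" assume "U \<in> H2_vec"
      then show "bilinear_Q L C0 C1 (corrected_tensor C0 C2 \<theta>) U U \<ge> ?K * (H2_norm_sq U - L2_norm_sq U)"
        by (rule bilinear_Q_coercive[OF _ c L q])
      show "?K * (H2_norm_sq U - L2_norm_sq U) \<ge> 0"
        by (rule mult_nonneg_nonneg[OF less_imp_le[OF K] H2_norm_sq_ge])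
    qed
  qed
qed

end
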